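(* Let $m,n$ be integers with $m+n\geq 7$, $\min\{m,n\}\geq 2$ and $\max\{m,n\}\geq 3$. Let $a,b\in\mathbb{C}$ with $b\neq 0$ and $a\neq b$, and let $$Q(z)=\sum_{i=0}^{m}\sum_{j=0}^{n}\binom{m}{i}\binom{n}{j}\frac{(-1)^{i+j}}{n+m+1-i-j}\,z^{n+m+1-i-j}a^{j}b^{i},\qquad P(z)=Q(z)+c,$$ where $c\in\mathbb{C}$ satisfies $c\notin\left\{0,-Q(a),-Q(b),-\frac{Q(a)+Q(b)}{2}\right\}$. Let $S_2=\{z\in\mathbb{C}: P(z)=0\}$. If $f$ and $g$ are two nonconstant meromorphic functions on $\mathbb{C}$, both having no simple poles, such that $f$ and $g$ share $\{\infty\}$ IM and share $S_2$ CM, then $f\equiv g$.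
   Context: Meromorphic means meromorphic in the whole complex plane $\mathbb{C}$. For a non-empty set $S\subset\mathbb{C}\cup\{\infty\}$ and a meromorphic function $f$, put $E_f(S)=\bigcup_{\alpha\in S}\{z: f(z)-\alpha=0\}$, where a zero of $f-\alpha$ of multiplicity $k$ is counted $k$ times (so $E_f(S)$ is a set of points with multiplicities); for $\alpha=\infty$ the zeros of $f-\alpha$ are understood to be the poles of $f$, counted with multiplicity. Let $\overline{E}_f(S)$ denote the set of distinct elements of $E_f(S)$. Two meromorphic functions $f,g$ share the set $S$ CM (counting multiplicities) if $E_f(S)=E_g(S)$, and share $S$ IM (ignoring multiplicities) if $\overline{E}_f(S)=\overline{E}_g(S)$. In the formula for $Q$, the convention $0^0=1$ is used if $a=0$. *)

theory Defs
  imports "HOL-Complex_Analysis.Complex_Analysis"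
begin

text \<open>
  Meromorphic functions on the plane are represented by
  \<^term>\<open>f nicely_meromorphic_on UNIV\<close>: every removable singularity is filled in, and
  \<^term>\<open>f z = 0\<close> by convention at each pole. Each meromorphic function has exactly one such
  representative, so \<open>f \<equiv> g\<close> is plain equality. Because of the convention at poles,
  the test \<^term>\<open>f z = \<alpha>\<close> has to be guarded by \<^term>\<open>\<not> is_pole f z\<close>.
\<close>

datatype ecomplex = Fin complex | Infty

text \<open>
  The points where \<open>f\<close> takes a value, each paired with its multiplicity. The multiplicity is
  meaningful only if \<open>f\<close> is not constant equal to that value, since \<^const>\<open>zorder\<close> is
  unspecified for the zero function.
\<close>

fun value_points :: "(complex \<Rightarrow> complex) \<Rightarrow> ecomplex \<Rightarrow> (complex \<times> int) set" where
  "value_points f (Fin \<alpha>) =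
     {(z, k). \<not> is_pole f z \<and> f z = \<alpha> \<and> k = zorder (\<lambda>w. f w - \<alpha>) z}"
| "value_points f Infty = {(z, k). is_pole f z \<and> k = - zorder f z}"

text \<open>
  A point is attached to only one value, and so occurs with only one multiplicity in the union
  below, which therefore encodes the set of points with multiplicities \<open>E\<^sub>f(S)\<close>.
\<close>

definition E_CM :: "(complex \<Rightarrow> complex) \<Rightarrow> ecomplex set \<Rightarrow> (complex \<times> int) set" where
  "E_CM f S = (\<Union>\<alpha>\<in>S. value_points f \<alpha>)"

definition E_IM :: "(complex \<Rightarrow> complex) \<Rightarrow> ecomplex set \<Rightarrow> complex set" where
  "E_IM f S = fst ` E_CM f S"

definition share_CM :: "(complex \<Rightarrow> complex) \<Rightarrow> (complex \<Rightarrow> complex) \<Rightarrow> ecomplex set \<Rightarrow> bool" where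
  "share_CM f g S \<longleftrightarrow> E_CM f S = E_CM g S"

definition share_IM :: "(complex \<Rightarrow> complex) \<Rightarrow> (complex \<Rightarrow> complex) \<Rightarrow> ecomplex set \<Rightarrow> bool" where
  "share_IM f g S \<longleftrightarrow> E_IM f S = E_IM g S"

definition no_simple_poles :: "(complex \<Rightarrow> complex) \<Rightarrow> bool" where
  "no_simple_poles f \<longleftrightarrow> (\<forall>z. is_pole f z \<longrightarrow> - zorder f z \<noteq> 1)"

definition Q :: "nat \<Rightarrow> nat \<Rightarrow> complex \<Rightarrow> complex \<Rightarrow> complex \<Rightarrow> complex" where
  "Q m n a b z =
     (\<Sum>i=0..m. \<Sum>j=0..n.
        of_nat (m choose i) * of_nat (n choose j) * ((-1) ^ (i + j) / of_nat (n + m + 1 - i - j))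
          * z ^ (n + m + 1 - i - j) * a ^ j * b ^ i)"

definition P :: "nat \<Rightarrow> nat \<Rightarrow> complex \<Rightarrow> complex \<Rightarrow> complex \<Rightarrow> complex \<Rightarrow> complex" where
  "P m n a b c z = Q m n a b z + c"

end

theory Submission imports Defs "HOL-Computational_Algebra.Fundamental_Theorem_Algebra" begin

text \<open>
  Let \<open>p\<close> be the polynomial \<open>P\<close>. Its derivative is \<open>(z - a)^n * (z - b)^m\<close>, so \<open>a\<close> and \<open>b\<close> are its only
  critical points, its degree is \<open>n + m + 1\<close>, which is at least 8, and \<open>p(a)\<close>, \<open>p(b)\<close> are different
  (otherwise \<open>p - p(a)\<close> would have too many zeros). The hypotheses on \<open>c\<close> say that \<open>p(a)\<close>, \<open>p(b)\<close> and
  \<open>p(a) + p(b)\<close> do not vanish; in particular the zeros of \<open>p\<close> are simple. Put \<open>F = p(f)\<close> and \<open>G = p(g)\<close>.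

  The analytic input is a self-contained piece of Nevanlinna theory, packed into one vanishing principle,
  \<open>small_meromorphic_function_vanishes\<close>: a meromorphic \<open>h\<close> is zero as soon as
  \<open>|h| (1 + |f|) (1 + |g|)\<close> is locally bounded everywhere and is bounded, off a discrete set, by a power of a sum
  of logarithmic derivatives \<open>|f'/(f - s)|\<close>, \<open>|f''/f'|\<close> and the same for \<open>g\<close>. Indeed, write \<open>f\<close> and \<open>g\<close>
  as quotients \<open>n1/d1\<close>, \<open>n2/d2\<close> of entire functions without common zeros. Then \<open>Y = h/(d1 d2)\<close> is entire and
  \<open>|Y| max(|n1|,|d1|) max(|n2|,|d2|)\<close> is bounded by that power. Now take logarithms and average over circles. The
  average of \<open>log |Y|\<close> is at least \<open>log |Y(0)|\<close> by subharmonicity; the averages of the two logarithmic maxima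
  add up to the Nevanlinna characteristic \<open>T(r)\<close> of the pair, which is unbounded; and logarithmic derivatives
  contribute only \<open>O(log T)\<close> on suitable circles. Hence \<open>T\<close> would be bounded.
  The last of the three facts is proved pointwise: by the Poisson-Jensen
  formula a logarithmic derivative at \<open>z\<close> is controlled by \<open>T\<close> at a slightly larger radius and by the
  distances from \<open>z\<close> to finitely many zeros and poles (\<open>log_deriv_bound\<close>); since there are not many of them, some
  circle stays away from all of them (\<open>circle_with_small_log_derivs\<close>); and a growth lemma in the manner of
  Borel supplies radii at which \<open>T\<close> dominates the logarithm of the resulting bound (\<open>growth_dominates_error\<close>).

  The vanishing principle is applied to three auxiliary functions, each of them a fourth power, so that the
  two factors \<open>1 + |f|\<close> and \<open>1 + |g|\<close> are compensated.

  \<^item> The expression \<open>F''/F' - 2 F'/F\<close> is the logarithmic derivative of \<open>(1/F)'\<close>. Its difference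
  for \<open>F\<close> and \<open>G\<close> vanishes (\<open>pre_schwarzians_agree\<close>): both have only simple poles; at common
  zeros of \<open>F\<close> and \<open>G\<close> with equal multiplicities the polar parts cancel, and for simple zeros so do the constant terms;
  all other poles are removed by the weights \<open>f' (f - a)(f - b)\<close>. Two integrations give constants
  \<open>K\<close>, \<open>B\<close> with \<open>G = K F + B F G\<close> (\<open>equal_pre_schwarzians_imp_moebius\<close>). If \<open>B\<close> were not zero, then
  \<open>f\<close> could have no poles and \<open>p(f)\<close> would omit the value \<open>1/B\<close>, so that the entire function \<open>f\<close> would
  omit two values, against the little Picard theorem (\<open>no_moebius_relation\<close>). So \<open>G = K F\<close>.
  \<^item> If \<open>K\<close> is not 1, then one of the values \<open>K p(a)\<close>, \<open>K p(b)\<close> is not critical, because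
  \<open>p(a) + p(b)\<close> is not zero. Say it is \<open>K p(a)\<close>. Whenever \<open>f\<close> is near \<open>a\<close>, the function
  \<open>g\<close> is near a simple root of \<open>p - K p(a)\<close>, and \<open>(g'/(f - a)^n)^4\<close>
  would have to vanish (\<open>no_relation_at_noncritical_value\<close>).
  \<^item> If \<open>K = 1\<close>, then \<open>p(f) = p(g)\<close>, and \<open>((f - g)^N f'/p'(g))^4\<close> with \<open>N = max n m\<close> vanishes
  (\<open>uniqueness_polynomial\<close>), which forces \<open>f = g\<close>.

  In all three cases local boundedness at a pole of order \<open>q\<close> comes down to a linear inequality
  between \<open>q\<close> and the exponents that holds for all \<open>q \<ge> 2\<close>; this is where the absence of simple poles enters.
  The bound on the degree enters in the first case, where the factors \<open>f - a\<close> and \<open>f - b\<close> of the weights make the orders of poles larger.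
\<close>

section \<open>Means over circles\<close>

definition circ :: "real \<Rightarrow> real \<Rightarrow> complex" where
  "circ r t = of_real r * cis (2 * pi * t)"

definition circle_mean :: "(complex \<Rightarrow> real) \<Rightarrow> real \<Rightarrow> real" where
  "circle_mean \<phi> r = integral {0..1} (\<lambda>t. \<phi> (circ r t))"

lemma norm_circ [simp]: "norm (circ r t) = \<bar>r\<bar>"
  by (simp add: circ_def norm_mult)

lemma circ_add: "circ r (s + t) = circ r s * cis (2 * pi * t)"
  by (simp add: circ_def distrib_left cis_mult)

lemma circ_periodic: "circ r (t + 1) = circ r t"
  by (simp add: circ_add)

lemma circ_onto:
  assumes "norm z = r"
  obtains t where "0 \<le> t" "t < 1" "z = circ r t"
proof -
  define t where "t = Arg2pi z / (2 * pi)"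
  have "z = of_real (norm z) * cis (Arg2pi z)"
    using Arg2pi_eq[of z] by (simp add: cis_conv_exp mult.commute)
  hence "z = circ r t" using assms by (simp add: circ_def t_def)
  moreover have "0 \<le> t" "t < 1" using Arg2pi_ge_0[of z] Arg2pi_lt_2pi[of z] by (auto simp: t_def)
  ultimately show ?thesis using that by blast
qed

lemma continuous_on_circ [continuous_intros]: "continuous_on A (circ r)"
  unfolding circ_def by (intro continuous_intros)

lemma continuous_on_compose_circ:
  assumes "continuous_on (sphere 0 r) \<phi>" "0 \<le> r"
  shows "continuous_on A (\<lambda>t. \<phi> (circ r t))"
  by (rule continuous_on_compose2[OF assms(1)]) (use assms in \<open>auto intro: continuous_intros\<close>)

lemma circ_integrable:
  fixes \<phi> :: "complex \<Rightarrow> 'a::euclidean_space"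
  assumes "continuous_on (sphere 0 r) \<phi>" "0 \<le> r"
  shows "(\<lambda>t. \<phi> (circ r t)) integrable_on {a..b}"
  by (intro integrable_continuous_real continuous_on_compose_circ assms)

lemma circle_mean_mono:
  assumes "continuous_on (sphere 0 r) \<phi>" "continuous_on (sphere 0 r) \<psi>" "0 \<le> r"
    "\<And>z. norm z = r \<Longrightarrow> \<phi> z \<le> \<psi> z"
  shows "circle_mean \<phi> r \<le> circle_mean \<psi> r"
  unfolding circle_mean_def by (intro integral_le circ_integrable) (use assms in auto)

lemma circle_mean_cong:
  assumes "0 \<le> r" "\<And>z. norm z = r \<Longrightarrow> \<phi> z = \<psi> z"
  shows "circle_mean \<phi> r = circle_mean \<psi> r"
  unfolding circle_mean_def by (intro integral_cong) (use assms in auto)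

lemma circle_mean_add:
  assumes "continuous_on (sphere 0 r) \<phi>" "continuous_on (sphere 0 r) \<psi>" "0 \<le> r"
  shows "circle_mean (\<lambda>z. \<phi> z + \<psi> z) r = circle_mean \<phi> r + circle_mean \<psi> r"
  unfolding circle_mean_def by (intro integral_add circ_integrable) (use assms in auto)

lemma circle_mean_diff:
  assumes "continuous_on (sphere 0 r) \<phi>" "continuous_on (sphere 0 r) \<psi>" "0 \<le> r"
  shows "circle_mean (\<lambda>z. \<phi> z - \<psi> z) r = circle_mean \<phi> r - circle_mean \<psi> r"
  unfolding circle_mean_def by (intro integral_diff circ_integrable) (use assms in auto)

lemma circle_mean_cmult: "circle_mean (\<lambda>z. c * \<phi> z) r = c * circle_mean \<phi> r"
  unfolding circle_mean_def by (simp add: integral_mult_right)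

lemma circle_mean_const [simp]: "circle_mean (\<lambda>z. c) r = c"
  unfolding circle_mean_def by simp

lemma circle_mean_0: "circle_mean \<phi> 0 = \<phi> 0"
  unfolding circle_mean_def circ_def by simp

lemma integral_periodic_shift:
  fixes f :: "real \<Rightarrow> real"
  assumes cont: "continuous_on UNIV f" and per: "\<And>t. f (t + 1) = f t" and s: "0 \<le> s" "s \<le> 1"
  shows "integral {0..1} (\<lambda>t. f (s + t)) = integral {0..1} f"
proof -
  have int: "f integrable_on {a..b}" for a b
    by (intro integrable_continuous_real continuous_on_subset[OF cont]) auto
  have "integral {0..1} (\<lambda>t. f (s + t)) = integral {s..1+s} f"
    using integral_shift_Icc_real[of 0 1 f s] by (simp add: o_def add_ac)
  also have "\<dots> = integral {s..1} f + integral {1..1+s} f"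
    using Henstock_Kurzweil_Integration.integral_combine[of s 1 "1+s" f] int s by simp
  also have "integral {1..1+s} f = integral {0..s} (\<lambda>t. f (1 + t))"
    using integral_shift_Icc_real[of 0 s f 1] by (simp add: o_def add_ac)
  also have "\<dots> = integral {0..s} f" using per by (simp add: add.commute)
  also have "integral {s..1} f + integral {0..s} f = integral {0..1} f"
    using Henstock_Kurzweil_Integration.integral_combine[of 0 s 1 f] int s by simp
  finally show ?thesis .
qed

lemma integral_equipartition:
  fixes f :: "real \<Rightarrow> real"
  assumes cont: "continuous_on UNIV f" and N: "N > 0"
  shows "integral {0..1} f = (\<Sum>j<N. integral {real j / N..real (Suc j) / N} f)"
proof -
  have int: "f integrable_on {a..b}" for a b
    by (intro integrable_continuous_real continuous_on_subset[OF cont]) auto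
  have "integral {0..real k / N} f = (\<Sum>j<k. integral {real j / N..real (Suc j) / N} f)" for k
  proof (induction k)
    case (Suc k)
    have "integral {0..real (Suc k) / N} f = integral {0..real k / N} f + integral {real k / N..real (Suc k) / N} f"
      by (rule Henstock_Kurzweil_Integration.integral_combine[symmetric]) (auto simp: int divide_right_mono)
    thus ?case using Suc by simp
  qed auto
  from this[of N] show ?thesis using N by simp
qed

lemma riemann_sum_error:
  fixes f :: "real \<Rightarrow> real"
  assumes cont: "continuous_on UNIV f" and N: "N > 0"
    and osc: "\<And>s t. \<bar>s - t\<bar> \<le> 1 / N \<Longrightarrow> \<bar>f s - f t\<bar> \<le> e"
  shows "\<bar>(\<Sum>j<N. f (real j / N)) / N - integral {0..1} f\<bar> \<le> e"
proof -
  have "\<bar>f (real j / N) / N - integral {real j / N..real (Suc j) / N} f\<bar> \<le> e / N" for j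
  proof -
    have int: "f integrable_on {a..b}" for a b
      by (intro integrable_continuous_real continuous_on_subset[OF cont]) auto
    have len: "real (Suc j) / N - real j / N = 1 / N" using N by (simp add: field_simps)
    have le: "real j / N \<le> real (Suc j) / N" by (intro divide_right_mono) auto
    have "f (real j / N) / N - integral {real j / N..real (Suc j) / N} f
       = integral {real j / N..real (Suc j) / N} (\<lambda>t. f (real j / N) - f t)"
      using le len by (subst integral_diff) (auto simp: int simp del: of_nat_Suc)
    also have "norm \<dots> \<le> e * (real (Suc j) / N - real j / N)"
    proof (rule integral_bound)
      show "continuous_on {real j / N..real (Suc j) / N} (\<lambda>t. f (real j / N) - f t)"
        by (intro continuous_intros continuous_on_subset[OF cont]) auto
      fix t assume t: "t \<in> {real j / N..real (Suc j) / N}"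
      have "\<bar>real j / N - t\<bar> \<le> 1 / N" using t len by auto
      thus "norm (f (real j / N) - f t) \<le> e" using osc by auto
    qed (use le in auto)
    finally show ?thesis using len by simp
  qed
  hence "\<bar>\<Sum>j<N. (f (real j / N) / N - integral {real j / N..real (Suc j) / N} f)\<bar> \<le> (\<Sum>j<N. e / N)"
    by (intro order.trans[OF sum_abs] sum_mono) auto
  also have "\<dots> = e" using N by simp
  finally show ?thesis
    using integral_equipartition[OF cont N] by (simp add: sum_subtractf sum_divide_distrib)
qed

text \<open>
  The Riemann sums use the rotates of an arbitrary starting point \<open>z\<close> of the circle, and the bound is uniform in
  \<open>z\<close>. This uniformity is what allows a sum over rotates to be treated as a function of \<open>z\<close> in the proof of
  monotonicity below.
\<close>

lemma circle_mean_riemann: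
  assumes cont: "continuous_on (sphere 0 r) \<phi>" and r: "0 \<le> r" and e: "e > 0"
  obtains N0 where "\<And>N z. N \<ge> N0 \<Longrightarrow> N > 0 \<Longrightarrow> norm z = r \<Longrightarrow>
      \<bar>(\<Sum>j<N. \<phi> (z * cis (2 * pi * (real j / N)))) / N - circle_mean \<phi> r\<bar> \<le> e"
proof -
  define f where "f = (\<lambda>t. \<phi> (circ r t))"
  have contf: "continuous_on A f" for A
    unfolding f_def by (intro continuous_on_compose_circ assms)
  have per: "f (t + 1) = f t" for t by (simp add: f_def circ_periodic)
  have "uniformly_continuous_on (sphere 0 r) \<phi>"
    by (intro compact_uniformly_continuous assms) auto
  then obtain d where d: "d > 0" "\<And>x y. x \<in> sphere 0 r \<Longrightarrow> y \<in> sphere 0 r \<Longrightarrow> dist x y < d \<Longrightarrow> dist (\<phi> x) (\<phi> y) < e"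
    using e unfolding uniformly_continuous_on_def by metis
  have lip: "norm (circ r s - circ r t) \<le> r * (2 * pi * \<bar>s - t\<bar>)" for s t
  proof -
    have "circ r s - circ r t = of_real r * cis (2*pi*t) * (cis (2 * pi * (s - t)) - 1)"
      using circ_add[of r t "s - t"] by (simp add: circ_def algebra_simps)
    hence "norm (circ r s - circ r t) = r * norm (cis (2 * pi * (s - t)) - 1)"
      using r by (simp add: norm_mult)
    also have "norm (cis (2 * pi * (s - t)) - 1) \<le> \<bar>2 * pi * (s - t)\<bar>"
    proof -
      have "norm (cis x - 1) \<le> \<bar>x\<bar>" for x
        using dist_exp_i_1[of x] abs_sin_le_one[of "x/2"] abs_sin_x_le_abs_x[of "x/2"] by (simp add: cis_conv_exp mult.commute)
      thus ?thesis .
    qed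
    finally show ?thesis using r by (simp add: abs_mult mult_left_mono)
  qed
  obtain N0 :: nat where N0: "r * (2 * pi) / d < N0" using reals_Archimedean2 by blast
  show ?thesis
  proof (rule that[of N0])
    fix N :: nat and z :: complex assume N: "N \<ge> N0" "N > 0" and z: "norm z = r"
    obtain s where s: "0 \<le> s" "s < 1" "z = circ r s" using circ_onto[OF z] by blast
    have osc: "\<bar>f x - f y\<bar> \<le> e" if "\<bar>x - y\<bar> \<le> 1 / N" for x y
    proof -
      have "norm (circ r x - circ r y) \<le> r * (2 * pi * (1 / N))"
        using lip[of x y] that r by (smt (verit) mult_left_mono pi_gt_zero)
      also have "\<dots> < d"
      proof -
        have "r * (2 * pi) / d < N" using N0 N by linarith
        thus ?thesis using d(1) N by (simp add: field_simps)
      qed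
      finally have "dist (\<phi> (circ r x)) (\<phi> (circ r y)) < e"
        using d(2) r by (auto simp: dist_norm)
      thus ?thesis by (simp add: f_def dist_real_def)
    qed
    have "\<bar>(\<Sum>j<N. f (s + real j / N)) / N - integral {0..1} (\<lambda>t. f (s + t))\<bar> \<le> e"
    proof (rule riemann_sum_error[OF _ N(2)])
      show "continuous_on UNIV (\<lambda>t. f (s + t))"
        by (rule continuous_on_compose2[OF contf[of UNIV]]) (auto intro: continuous_intros)
    qed (use osc in auto)
    moreover have "integral {0..1} (\<lambda>t. f (s + t)) = integral {0..1} f"
      by (rule integral_periodic_shift) (use contf per s in auto)
    moreover have "f (s + x) = \<phi> (z * cis (2 * pi * x))" for x by (simp add: f_def circ_add s)
    ultimately show "\<bar>(\<Sum>j<N. \<phi> (z * cis (2 * pi * (real j / N)))) / N - circle_mean \<phi> r\<bar> \<le> e"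
      by (simp add: circle_mean_def f_def)
  qed
qed

definition log_max :: "(complex \<Rightarrow> complex) \<Rightarrow> (complex \<Rightarrow> complex) \<Rightarrow> complex \<Rightarrow> real" where
  "log_max A B z = ln (max (norm (A z)) (norm (B z)))"

lemma continuous_on_log_max:
  assumes "continuous_on S A" "continuous_on S B" "\<And>z. z \<in> S \<Longrightarrow> A z \<noteq> 0 \<or> B z \<noteq> 0"
  shows "continuous_on S (log_max A B)"
  unfolding log_max_def
  by (intro continuous_intros assms) (use assms(3) in \<open>auto simp: max_def\<close>)

text \<open>
  The function \<open>log_max A B\<close> is subharmonic. A direct proof from the maximum modulus principle: on both circles the
  mean is approximated by the average over the \<open>N\<close> rotates of a point, and the exponential of the sum over the
  rotates is a product of maxima. That product is an upper bound for the modulus of an entire function which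
  attains it at the chosen point \<open>r\<close> of the smaller circle.
\<close>

theorem circle_mean_log_max_mono:
  assumes A: "A holomorphic_on UNIV" and B: "B holomorphic_on UNIV"
    and rR: "0 \<le> r" "r \<le> R"
    and nz: "\<And>z. norm z = r \<or> norm z = R \<Longrightarrow> A z \<noteq> 0 \<or> B z \<noteq> 0"
  shows "circle_mean (log_max A B) r \<le> circle_mean (log_max A B) R"
proof (cases "r = R")
  case False
  hence R: "R > 0" "r < R" using rR by auto
  have cA: "continuous_on S A" and cB: "continuous_on S B" for S
    using A B by (auto intro!: holomorphic_on_imp_continuous_on intro: holomorphic_on_subset)
  have cr: "continuous_on (sphere 0 r) (log_max A B)" and cR: "continuous_on (sphere 0 R) (log_max A B)"
    by (intro continuous_on_log_max cA cB; use nz in auto)+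
  have "circle_mean (log_max A B) r \<le> circle_mean (log_max A B) R + e" if e: "e > 0" for e
  proof -
    obtain N1 where N1: "\<And>N z. N \<ge> N1 \<Longrightarrow> N > 0 \<Longrightarrow> norm z = r \<Longrightarrow>
      \<bar>(\<Sum>j<N. log_max A B (z * cis (2 * pi * (real j / N)))) / N - circle_mean (log_max A B) r\<bar> \<le> e/2"
      using circle_mean_riemann[OF cr rR(1), of "e/2"] e by (metis half_gt_zero)
    obtain N2 where N2: "\<And>N z. N \<ge> N2 \<Longrightarrow> N > 0 \<Longrightarrow> norm z = R \<Longrightarrow>
      \<bar>(\<Sum>j<N. log_max A B (z * cis (2 * pi * (real j / N)))) / N - circle_mean (log_max A B) R\<bar> \<le> e/2"
      using circle_mean_riemann[OF cR, of "e/2"] e R by (metis half_gt_zero less_imp_le)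
    define N where "N = max 1 (max N1 N2)"
    have N: "N > 0" "N \<ge> N1" "N \<ge> N2" by (auto simp: N_def)
    define w where "w = (\<lambda>j. cis (2 * pi * (real j / N)))"
    have average: "S \<le> N * (m + e/2) \<and> N * (m - e/2) \<le> S" if "\<bar>S / N - m\<bar> \<le> e/2" for S m
    proof -
      have "S / N \<le> m + e/2" "m - e/2 \<le> S / N" using that unfolding abs_le_iff by linarith+
      thus ?thesis using N(1) by (simp add: pos_divide_le_eq pos_le_divide_eq mult.commute)
    qed
    define \<phi> where "\<phi> = (\<lambda>z. (\<Sum>j<N. log_max A B (z * w j)))"
    have nw: "norm (z * w j) = norm z" for z j by (simp add: w_def norm_mult)
    have ex: "exp (\<phi> z) = (\<Prod>j<N. max (norm (A (z * w j))) (norm (B (z * w j))))"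
      if "norm z = r \<or> norm z = R" for z
    proof -
      have "exp (log_max A B (z * w j)) = max (norm (A (z * w j))) (norm (B (z * w j)))" for j
        unfolding log_max_def using nz[of "z * w j"] that nw by (subst exp_ln) (auto simp: max_def)
      thus ?thesis by (simp add: \<phi>_def exp_sum)
    qed
    \<comment> \<open>At the point \<open>r\<close> each factor picks the larger of \<open>A\<close> and \<open>B\<close>. So \<open>|G|\<close> equals \<open>exp \<phi>\<close> at \<open>r\<close>,
        and it is at most \<open>exp \<phi>\<close> on the circle of radius \<open>R\<close>.\<close>
    define c where "c = (\<lambda>j. if norm (A (of_real r * w j)) \<ge> norm (B (of_real r * w j)) then A else B)"
    define G where "G = (\<lambda>z. \<Prod>j<N. c j (z * w j))"
    have holc: "c j holomorphic_on UNIV" for j using A B by (simp add: c_def)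
    have holG: "G holomorphic_on UNIV"
      unfolding G_def
    proof (rule holomorphic_on_prod)
      fix j
      have "c j \<circ> (\<lambda>z. z * w j) holomorphic_on UNIV"
        by (intro holomorphic_on_compose holomorphic_intros holomorphic_on_subset[OF holc]) auto
      thus "(\<lambda>z. c j (z * w j)) holomorphic_on UNIV" by (simp add: o_def)
    qed
    have "norm (G (of_real r)) \<le> exp (N * (circle_mean (log_max A B) R + e/2))"
    proof (rule maximum_modulus_frontier[where S = "cball 0 R" and f = G])
      show "G holomorphic_on interior (cball 0 R)" using holG holomorphic_on_subset by blast
      show "continuous_on (closure (cball 0 R)) G"
        using holG holomorphic_on_imp_continuous_on continuous_on_subset by blast
      show "complex_of_real r \<in> cball 0 R" using rR by simp
      fix z assume "z \<in> frontier (cball (0::complex) R)"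
      hence z: "norm z = R" using R by simp
      have "norm (G z) \<le> exp (\<phi> z)" using ex[of z] z
        by (auto simp: G_def prod_norm[symmetric] c_def intro!: prod_mono)
      also have "\<phi> z \<le> N * (circle_mean (log_max A B) R + e/2)"
        using average[OF N2[OF N(3) N(1) z]] by (simp add: \<phi>_def w_def)
      finally show "norm (G z) \<le> exp (N * (circle_mean (log_max A B) R + e/2))" by simp
    qed auto
    moreover have "norm (G (of_real r)) = exp (\<phi> (of_real r))"
      using rR by (subst ex) (auto simp: G_def prod_norm[symmetric] c_def max_def intro!: prod.cong)
    ultimately have "\<phi> (of_real r) \<le> N * (circle_mean (log_max A B) R + e/2)" by simp
    moreover have "N * (circle_mean (log_max A B) r - e/2) \<le> \<phi> (of_real r)"
      using average[OF N1[OF N(2) N(1), of "of_real r"]] rR by (simp add: \<phi>_def w_def)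
    ultimately have "N * (circle_mean (log_max A B) r - e/2) \<le> N * (circle_mean (log_max A B) R + e/2)" by linarith
    thus ?thesis using N(1) by (simp add: mult_le_cancel_left)
  qed
  thus ?thesis by (rule field_le_epsilon)
qed auto

section \<open>Logarithmic derivatives of quotients of entire functions\<close>

lemma has_integral_circ:
  assumes "(f has_contour_integral I) (circlepath 0 R)"
  shows "((\<lambda>t. f (circ R t) * circ R t) has_integral I / (2 * pi * \<i>)) {0..1}"
proof -
  have "((\<lambda>x. f (circlepath 0 R x) * vector_derivative (circlepath 0 R) (at x within {0..1})) has_integral I) {0..1}"
    using assms by (simp add: has_contour_integral_def)
  moreover have eq: "circlepath 0 R x = circ R x" for x
    by (simp add: circlepath circ_def cis_conv_exp mult_ac)
  ultimately have "((\<lambda>x. f (circ R x) * (2 * pi * \<i> * circ R x)) has_integral I) {0..1}"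
    by (elim has_integral_eq[rotated])
       (auto simp: vector_derivative_circlepath01 circ_def cis_conv_exp mult_ac)
  hence "((\<lambda>x. 1 / (2 * pi * \<i>) * (f (circ R x) * (2 * pi * \<i> * circ R x))) has_integral 1 / (2 * pi * \<i>) * I) {0..1}"
    by (rule has_integral_mult_right)
  thus ?thesis by (simp add: field_simps)
qed

text \<open>
  Only the real part of \<open>h\<close> enters on the right, which is the point of the Poisson formula: for \<open>h = log (A/B)\<close> the real part is
  controlled by moduli, whereas the imaginary part is not. Cauchy's formula expresses \<open>deriv h z\<close> as the mean of \<open>h k\<close>
  with a kernel \<open>k\<close>; the mean of \<open>cnj h * k\<close> is zero, and adding the two replaces \<open>h\<close> by \<open>2 Re h\<close>.
\<close>

lemma norm_deriv_le_circle_mean_Re: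
  assumes h: "h holomorphic_on ball 0 R'" and R: "0 < R" "R < R'" and z: "norm z \<le> r" "r < R"
  shows "norm (deriv h z) \<le> 2 * R / (R - r)\<^sup>2 * circle_mean (\<lambda>\<zeta>. \<bar>Re (h \<zeta>)\<bar>) R"
proof -
  have sub: "cball 0 R \<subseteq> ball (0::complex) R'" using R by auto
  have hc: "h holomorphic_on cball 0 R" using h sub holomorphic_on_subset by blast
  have hb: "h holomorphic_on ball 0 R" using hc holomorphic_on_subset by fastforce
  have contc: "continuous_on (cball 0 R) h" using hc holomorphic_on_imp_continuous_on by blast
  have zR: "z \<in> ball 0 R" using z by auto
  define k where "k = (\<lambda>t. circ R t / (circ R t - z)\<^sup>2)"
  have "((\<lambda>u. h u / (u - z) ^ Suc 1) has_contour_integral (2 * pi * \<i>) / fact 1 * (deriv ^^ 1) h z) (circlepath 0 R)"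
    by (rule Cauchy_has_contour_integral_higher_derivative_circlepath[OF contc hb zR])
  from has_integral_circ[OF this]
  have 1: "((\<lambda>t. h (circ R t) * k t) has_integral deriv h z) {0..1}"
    by (simp add: k_def numeral_2_eq_2)
  have den: "of_real R ^ 2 - cnj z * u \<noteq> 0" if "norm u \<le> R" for u
  proof
    assume "of_real R ^ 2 - cnj z * u = 0"
    hence "norm (of_real R ^ 2 :: complex) = norm (cnj z * u)" by simp
    hence "R\<^sup>2 = norm z * norm u" by (simp add: norm_mult norm_power)
    moreover have "norm z * norm u \<le> norm z * R" using that by (intro mult_left_mono) auto
    moreover have "norm z * R < R * R" using zR R by auto
    ultimately show False by (simp add: power2_eq_square)
  qed
  \<comment> \<open>On the circle \<open>cnj u = R\<^sup>2 / u\<close>; therefore \<open>cnj (F u) R\<^sup>2 = cnj (h u) k\<close>,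
      and the mean of the holomorphic function \<open>F\<close> is \<open>F 0 = 0\<close>.\<close>
  define F where "F = (\<lambda>u. h u * u / (of_real R ^ 2 - cnj z * u)\<^sup>2)"
  have "((\<lambda>u. F u / (u - 0) ^ Suc 0) has_contour_integral (2 * pi * \<i>) / fact 0 * (deriv ^^ 0) F 0) (circlepath 0 R)"
  proof (rule Cauchy_has_contour_integral_higher_derivative_circlepath)
    show "continuous_on (cball 0 R) F"
      unfolding F_def using den by (intro continuous_intros contc) auto
    show "F holomorphic_on ball 0 R"
      unfolding F_def using den by (intro holomorphic_intros hb) auto
  qed (use R in auto)
  hence "((\<lambda>u. F u / u) has_contour_integral 0) (circlepath 0 R)" by (simp add: F_def)
  from has_integral_circ[OF this]
  have "((\<lambda>t. F (circ R t) / circ R t * circ R t) has_integral 0) {0..1}" by simp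
  hence "((\<lambda>t. cnj (F (circ R t) / circ R t * circ R t)) has_integral cnj 0) {0..1}"
    by (drule_tac has_integral_linear[OF _ bounded_linear_cnj]) (simp add: o_def)
  hence "((\<lambda>t. cnj (F (circ R t) / circ R t * circ R t) * of_real R ^ 2) has_integral cnj 0 * of_real R ^ 2) {0..1}"
    by (rule has_integral_mult_left)
  moreover have "cnj (F u / u * u) * of_real R ^ 2 = cnj (h u) * (u / (u - z)\<^sup>2)" if "norm u = R" for u
  proof -
    have u: "u * cnj u = of_real R ^ 2" using that by (simp add: complex_norm_square[symmetric])
    have u0: "u \<noteq> 0" "u \<noteq> z" using that R z by auto
    have "cnj (F u / u * u) = cnj (h u) * cnj u / (of_real R ^ 2 - z * cnj u)\<^sup>2" using u0 by (simp add: F_def)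
    also have "of_real R ^ 2 - z * cnj u = (u - z) * cnj u" using u by (simp add: algebra_simps)
    finally have "cnj (F u / u * u) * of_real R ^ 2 = cnj (h u) * cnj u / ((u - z) * cnj u)\<^sup>2 * (u * cnj u)" by (simp add: u)
    also have "\<dots> = cnj (h u) * (u / (u - z)\<^sup>2)" using u0 by (simp add: power_mult_distrib power2_eq_square[of "cnj u"])
    finally show ?thesis .
  qed
  ultimately have 2: "((\<lambda>t. cnj (h (circ R t)) * k t) has_integral 0) {0..1}"
    using R by (simp add: k_def)
  have "((\<lambda>t. h (circ R t) * k t + cnj (h (circ R t)) * k t) has_integral deriv h z + 0) {0..1}"
    by (intro has_integral_add 1 2)
  moreover have "h u * c + cnj (h u) * c = of_real (2 * Re (h u)) * c" for u c
    by (simp add: complex_add_cnj flip: distrib_right)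
  ultimately have 3: "((\<lambda>t. of_real (2 * Re (h (circ R t))) * k t) has_integral deriv h z) {0..1}" by simp
  have int: "(\<lambda>t. 2 * R / (R - r)\<^sup>2 * \<bar>Re (h (circ R t))\<bar>) integrable_on {0..1}"
    by (intro integrable_on_mult_right circ_integrable continuous_intros continuous_on_subset[OF contc])
       (use R in auto)
  have "norm (integral {0..1} (\<lambda>t. of_real (2 * Re (h (circ R t))) * k t))
      \<le> integral {0..1} (\<lambda>t. 2 * R / (R - r)\<^sup>2 * \<bar>Re (h (circ R t))\<bar>)"
  proof (rule integral_norm_bound_integral)
    fix t
    have nr: "R - r \<le> norm (circ R t - z)"
      using norm_triangle_ineq2[of "circ R t" z] z R by simp
    have "norm (k t) = R / (norm (circ R t - z))\<^sup>2" using R by (simp add: k_def norm_divide norm_power)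
    also have "\<dots> \<le> R / (R - r)\<^sup>2" using nr z R by (intro divide_left_mono power_mono mult_pos_pos zero_less_power) auto
    finally have "norm (k t) \<le> R / (R - r)\<^sup>2" .
    hence "\<bar>2 * Re (h (circ R t))\<bar> * norm (k t) \<le> \<bar>2 * Re (h (circ R t))\<bar> * (R / (R - r)\<^sup>2)" by (intro mult_left_mono) auto
    thus "norm (of_real (2 * Re (h (circ R t))) * k t) \<le> 2 * R / (R - r)\<^sup>2 * \<bar>Re (h (circ R t))\<bar>"
      unfolding norm_mult norm_of_real by (simp add: abs_mult mult_ac)
  qed (use 3 int in auto)
  thus ?thesis using 3 by (simp add: circle_mean_def integral_unique)
qed

lemma entire_divide_out_zero:
  fixes A :: "complex \<Rightarrow> complex"
  assumes A: "A holomorphic_on UNIV" and nz: "A z0 \<noteq> 0"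
  obtains k E where "E holomorphic_on UNIV" "E a \<noteq> 0" "\<And>z. A z = (z - a) ^ k * E z"
proof -
  define k where "k = nat (zorder A a)"
  define g where "g = zor_poly A a"
  obtain r where r: "r > 0" "g holomorphic_on cball a r"
    "\<And>w. w \<in> cball a r \<Longrightarrow> A w = g w * (w - a) ^ k \<and> g w \<noteq> 0"
    using zorder_exist_zero[OF A, of a] nz unfolding k_def g_def
    by (metis UNIV_I connected_UNIV open_UNIV)
  define E where "E = (\<lambda>z. if z = a then g a else A z / (z - a) ^ k)"
  have Eg: "E z = g z" if "z \<in> cball a r" for z
    using r(3)[OF that] by (auto simp: E_def)
  have "E holomorphic_on ball a r"
    using r(2) Eg by (subst holomorphic_cong[OF refl, of _ E g]) (auto intro: holomorphic_on_subset)
  moreover have "E holomorphic_on (- {a})"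
  proof -
    have "(\<lambda>z. A z / (z - a) ^ k) holomorphic_on (- {a})"
      by (intro holomorphic_intros holomorphic_on_subset[OF A]) auto
    thus ?thesis by (rule holomorphic_transform) (auto simp: E_def)
  qed
  ultimately have "E holomorphic_on (ball a r \<union> (- {a}))"
    by (rule holomorphic_on_Un) auto
  moreover have "ball a r \<union> (- {a}) = UNIV" using r(1) by auto
  ultimately have "E holomorphic_on UNIV" by simp
  moreover have "E a \<noteq> 0" using r(3)[of a] r(1) by (simp add: E_def)
  moreover have "A z = (z - a) ^ k * E z" for z
    using r(3)[of a] r(1) by (auto simp: E_def)
  ultimately show ?thesis using that by blast
qed

lemma entire_divide_out_zeros:
  fixes A :: "complex \<Rightarrow> complex"
  assumes A: "A holomorphic_on UNIV" and nz: "A 0 \<noteq> 0" and Z: "finite Z"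
  shows "\<exists>zs E. set zs \<subseteq> Z \<and> E holomorphic_on UNIV \<and> (\<forall>z. A z = (\<Prod>a\<leftarrow>zs. z - a) * E z) \<and> (\<forall>a\<in>Z. E a \<noteq> 0)"
  using Z
proof (induction Z)
  case empty
  show ?case by (rule exI[of _ "[]"], rule exI[of _ A]) (use A in auto)
next
  case (insert b Z)
  then obtain zs E where E: "set zs \<subseteq> Z" "E holomorphic_on UNIV" "\<And>z. A z = (\<Prod>a\<leftarrow>zs. z - a) * E z" "\<And>a. a \<in> Z \<Longrightarrow> E a \<noteq> 0"
    by blast
  have "E 0 \<noteq> 0" using E(3)[of 0] nz by auto
  then obtain k E' where E': "E' holomorphic_on UNIV" "E' b \<noteq> 0" "\<And>z. E z = (z - b) ^ k * E' z"
    using entire_divide_out_zero[OF E(2)] by blast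
  have "set (replicate k b @ zs) \<subseteq> insert b Z" using E(1) by auto
  moreover have "A z = (\<Prod>a\<leftarrow>replicate k b @ zs. z - a) * E' z" for z
    by (simp add: E(3) E'(3) mult_ac)
  moreover have "E' a \<noteq> 0" if "a \<in> insert b Z" for a
    using that E(4)[of a] E'(2) E'(3)[of a] by auto
  ultimately show ?case using E'(1) by blast
qed

lemma entire_factor_disc:
  fixes A :: "complex \<Rightarrow> complex"
  assumes A: "A holomorphic_on UNIV" and nz: "A 0 \<noteq> 0" and R: "R > 0"
    and sph: "\<And>z. norm z = R \<Longrightarrow> A z \<noteq> 0"
  obtains zs E where "\<And>a. a \<in> set zs \<Longrightarrow> norm a < R" "E holomorphic_on UNIV"
    "\<And>z. A z = (\<Prod>a\<leftarrow>zs. z - a) * E z" "\<And>z. norm z \<le> R \<Longrightarrow> E z \<noteq> 0"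
proof -
  define Z where "Z = {z \<in> cball 0 R. A z = 0}"
  have "finite Z"
  proof (cases "A constant_on UNIV")
    case True
    hence "Z = {}" using nz by (fastforce simp: Z_def constant_on_def)
    thus ?thesis by simp
  next
    case False
    thus ?thesis unfolding Z_def by (intro holomorphic_compact_finite_zeros[OF A]) auto
  qed
  then obtain zs E where E: "set zs \<subseteq> Z" "E holomorphic_on UNIV" "\<And>z. A z = (\<Prod>a\<leftarrow>zs. z - a) * E z" "\<And>a. a \<in> Z \<Longrightarrow> E a \<noteq> 0"
    using entire_divide_out_zeros[OF A nz] by meson
  have "norm a < R" if "a \<in> set zs" for a
    using that E(1) sph[of a] by (force simp: Z_def)
  moreover have "E z \<noteq> 0" if "norm z \<le> R" for z
    using E(3)[of z] E(4)[of z] that by (auto simp: Z_def)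
  ultimately show ?thesis using that E(2,3) by blast
qed

text \<open>
  For a function with zeros \<open>zs\<close> in the disc of radius \<open>R\<close> and zero-free part \<open>E\<close> this is the quotient by the Blaschke product: every factor \<open>z - a\<close>
  is replaced by one that has the same modulus on the circle and no zero in the disc.
\<close>

definition reflect :: "real \<Rightarrow> complex list \<Rightarrow> (complex \<Rightarrow> complex) \<Rightarrow> complex \<Rightarrow> complex" where
  "reflect R zs E z = (\<Prod>a\<leftarrow>zs. (of_real R ^ 2 - cnj a * z) / of_real R) * E z"

lemma reflect_factor_nonzero:
  assumes "norm a < R" "norm z \<le> R"
  shows "of_real R ^ 2 - cnj a * z \<noteq> 0"
proof
  assume "of_real R ^ 2 - cnj a * z = 0"
  hence "norm (of_real R ^ 2 :: complex) = norm (cnj a * z)" by simp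
  hence "R\<^sup>2 = norm a * norm z" by (simp add: norm_mult norm_power)
  moreover have "norm a * norm z \<le> norm a * R" using assms by (intro mult_left_mono) auto
  moreover have "norm a * R < R * R" using assms by (intro mult_strict_right_mono) (auto intro: le_less_trans[OF norm_ge_zero])
  ultimately show False by (simp add: power2_eq_square)
qed

lemma holomorphic_prod_list:
  "(\<And>a. a \<in> set zs \<Longrightarrow> f a holomorphic_on S) \<Longrightarrow> (\<lambda>z. \<Prod>a\<leftarrow>zs. f a z) holomorphic_on S"
  by (induction zs) (auto intro!: holomorphic_intros)

lemma reflect_holomorphic:
  assumes "E holomorphic_on UNIV" "R > 0"
  shows "reflect R zs E holomorphic_on UNIV"
  unfolding reflect_def using assms by (intro holomorphic_intros holomorphic_prod_list) auto

lemma reflect_nonzero: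
  assumes "\<And>a. a \<in> set zs \<Longrightarrow> norm a < R" "E z \<noteq> 0" "norm z \<le> R" "R > 0"
  shows "reflect R zs E z \<noteq> 0"
  using assms reflect_factor_nonzero[of _ R z] by (force simp: reflect_def prod_list_zero_iff)

lemma norm_reflect:
  assumes "norm z = R" "R > 0"
  shows "norm (reflect R zs E z) = norm ((\<Prod>a\<leftarrow>zs. z - a) * E z)"
proof -
  have z: "z * cnj z = of_real R ^ 2" using assms by (simp add: complex_norm_square[symmetric])
  have "norm ((of_real R ^ 2 - cnj a * z) / of_real R) = norm (z - a)" for a
  proof -
    have "of_real R ^ 2 - cnj a * z = z * cnj (z - a)" using z by (simp add: algebra_simps)
    thus ?thesis using assms by (simp add: norm_mult norm_divide del: complex_cnj_diff)
  qed
  hence "norm (\<Prod>a\<leftarrow>zs. (of_real R ^ 2 - cnj a * z) / of_real R) = norm (\<Prod>a\<leftarrow>zs. z - a)"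
    by (induction zs) (simp_all only: list.map prod_list.Nil prod_list.Cons norm_mult)
  thus ?thesis by (simp only: reflect_def norm_mult)
qed

lemma circle_mean_ln_norm_ge:
  assumes A: "A holomorphic_on UNIV" and "A 0 \<noteq> 0" "0 \<le> R" "\<And>z. norm z = R \<Longrightarrow> A z \<noteq> 0"
  shows "ln (norm (A 0)) \<le> circle_mean (log_max A A) R"
  using circle_mean_log_max_mono[OF A A, of 0 R] assms by (auto simp: circle_mean_0 log_max_def)

text \<open>
  The reflected function has the modulus of \<open>A\<close> on the circle of radius \<open>R\<close>, while at the centre every zero of
  modulus at most \<open>R'\<close> makes it larger than \<open>|A 0|\<close> by a factor of at least \<open>R/R'\<close>. Subharmonicity of the logarithm of
  the reflected function therefore bounds the number of such zeros.
\<close>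

lemma jensen_inequality:
  fixes A E :: "complex \<Rightarrow> complex" and R R' :: real
  assumes A: "A holomorphic_on UNIV" "A 0 \<noteq> 0" "R > 0" "\<And>z. norm z = R \<Longrightarrow> A z \<noteq> 0"
    and E: "E holomorphic_on UNIV" "\<And>z. A z = (\<Prod>a\<leftarrow>zs. z - a) * E z"
    and zs: "\<And>a. a \<in> set zs \<Longrightarrow> norm a \<le> R'" "0 < R'" "R' < R"
  shows "length zs * (R - R') / R \<le> circle_mean (log_max A A) R - ln (norm (A 0))"
proof -
  let ?B = "reflect R zs E"
  have E0: "E 0 \<noteq> 0" using A(2) E(2)[of 0] by auto
  have nB: "norm (?B z) = norm (A z)" if "norm z = R" for z
    using norm_reflect[OF that, of zs E] A(3) E(2) by simp
  have B0: "norm (A 0) * (R / R') ^ length zs \<le> norm (?B 0)"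
    unfolding reflect_def E(2) using zs(1)
  proof (induction zs)
    case (Cons a zs)
    have "norm a * R / R' \<le> R" using Cons.prems[of a] zs(2,3) A(3) by (simp add: divide_le_eq)
    hence "(norm a * (R / R')) * (norm ((\<Prod>a\<leftarrow>zs. 0 - a) * E 0) * (R / R') ^ length zs)
       \<le> R * norm ((\<Prod>a\<leftarrow>zs. (of_real R ^ 2 - cnj a * 0) / of_real R) * E 0)"
      using Cons A(3) zs(2) by (intro mult_mono Cons.IH) (auto intro!: mult_nonneg_nonneg)
    thus ?case using A(3) by (simp add: norm_mult norm_divide norm_power power2_eq_square mult_ac)
  qed auto
  have pos: "0 < norm (A 0) * (R / R') ^ length zs" using A zs by simp
  have "ln (norm (?B 0)) \<le> circle_mean (log_max ?B ?B) R"
  proof (rule circle_mean_ln_norm_ge)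
    show "?B 0 \<noteq> 0" using pos B0 by auto
    show "?B z \<noteq> 0" if "norm z = R" for z using nB[OF that] A(4)[OF that] by auto
    show "?B holomorphic_on UNIV" using E(1) A(3) by (rule reflect_holomorphic)
  qed (use A(3) in auto)
  also have "circle_mean (log_max ?B ?B) R = circle_mean (log_max A A) R"
    using A(3) nB by (intro circle_mean_cong) (auto simp: log_max_def)
  finally have 1: "ln (norm (?B 0)) \<le> circle_mean (log_max A A) R" .
  have "ln (norm (A 0)) + length zs * ln (R / R') = ln (norm (A 0) * (R / R') ^ length zs)"
    using A zs by (simp add: ln_mult ln_realpow)
  also have "\<dots> \<le> ln (norm (?B 0))" using B0 pos by (subst ln_le_cancel_iff) linarith+
  finally have 2: "ln (norm (A 0)) + length zs * ln (R / R') \<le> ln (norm (?B 0))" .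
  have "(R - R') / R \<le> ln (R / R')"
    using ln_le_minus_one[of "R' / R"] A(3) zs
    by (simp add: ln_div diff_divide_distrib)
  hence "length zs * ((R - R') / R) \<le> length zs * ln (R / R')" by (intro mult_left_mono) auto
  thus ?thesis using 1 2 by simp
qed

lemma has_field_derivative_prod_list:
  assumes "\<And>a. a \<in> set zs \<Longrightarrow> (f a has_field_derivative f' a) (at z)" "(E has_field_derivative E') (at z)"
    "\<And>a. a \<in> set zs \<Longrightarrow> f a z \<noteq> 0" "E z \<noteq> 0"
  shows "((\<lambda>z. (\<Prod>a\<leftarrow>zs. f a z) * E z) has_field_derivative
     ((\<Prod>a\<leftarrow>zs. f a z) * E z) * ((\<Sum>a\<leftarrow>zs. f' a / f a z) + E' / E z)) (at (z::complex))"
  using assms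
proof (induction zs)
  case (Cons a zs)
  have "((\<lambda>z. f a z * ((\<Prod>a\<leftarrow>zs. f a z) * E z)) has_field_derivative
     f' a * ((\<Prod>a\<leftarrow>zs. f a z) * E z) + ((\<Prod>a\<leftarrow>zs. f a z) * E z) * ((\<Sum>a\<leftarrow>zs. f' a / f a z) + E' / E z) * f a z) (at z)"
    using Cons by (intro DERIV_mult) auto
  hence D: "((\<lambda>z. (\<Prod>a\<leftarrow>a # zs. f a z) * E z) has_field_derivative
     f' a * ((\<Prod>a\<leftarrow>zs. f a z) * E z) + ((\<Prod>a\<leftarrow>zs. f a z) * E z) * ((\<Sum>a\<leftarrow>zs. f' a / f a z) + E' / E z) * f a z) (at z)"
    by (simp add: mult.assoc)
  have eq: "f' a * X + X * S * f a z = f a z * X * (f' a / f a z + S)" for X S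
    using Cons.prems(3)[of a] by (simp add: distrib_left mult_ac)
  from DERIV_cong[OF D eq] show ?case by (simp add: mult.assoc add.assoc)
qed simp

lemma logderiv_reflect:
  assumes A: "\<And>z. A z = (\<Prod>a\<leftarrow>zs. z - a) * E z" and E: "E holomorphic_on UNIV"
    and zs: "\<And>a. a \<in> set zs \<Longrightarrow> norm a < R" and z: "norm z \<le> R" "A z \<noteq> 0" and R: "R > 0"
  shows "deriv A z / A z = deriv (reflect R zs E) z / reflect R zs E z
      + (\<Sum>a\<leftarrow>zs. 1 / (z - a) + cnj a / (of_real R ^ 2 - cnj a * z))"
proof -
  have E': "(E has_field_derivative deriv E z) (at z)" using E by (rule holomorphic_derivI) auto
  have nz: "E z \<noteq> 0" "\<And>a. a \<in> set zs \<Longrightarrow> z - a \<noteq> 0" using z(2) A by (auto simp: prod_list_zero_iff)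
  have "A = (\<lambda>z. (\<Prod>a\<leftarrow>zs. z - a) * E z)" using A by blast
  moreover have "((\<lambda>z. (\<Prod>a\<leftarrow>zs. z - a) * E z) has_field_derivative
     ((\<Prod>a\<leftarrow>zs. z - a) * E z) * ((\<Sum>a\<leftarrow>zs. 1 / (z - a)) + deriv E z / E z)) (at z)"
    using nz E' by (intro has_field_derivative_prod_list) (auto intro!: derivative_eq_intros)
  ultimately have 1: "deriv A z / A z = (\<Sum>a\<leftarrow>zs. 1 / (z - a)) + deriv E z / E z"
    using z(2) by (simp add: DERIV_imp_deriv)
  have "((\<lambda>z. (\<Prod>a\<leftarrow>zs. (of_real R ^ 2 - cnj a * z) / of_real R) * E z) has_field_derivative
     ((\<Prod>a\<leftarrow>zs. (of_real R ^ 2 - cnj a * z) / of_real R) * E z) *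
      ((\<Sum>a\<leftarrow>zs. (- cnj a / of_real R) / ((of_real R ^ 2 - cnj a * z) / of_real R)) + deriv E z / E z)) (at z)"
    using nz E' R reflect_factor_nonzero[of _ R z] zs z(1)
    by (intro has_field_derivative_prod_list) (auto intro!: derivative_eq_intros)
  hence "deriv (reflect R zs E) z = reflect R zs E z * ((\<Sum>a\<leftarrow>zs. (- cnj a / of_real R) / ((of_real R ^ 2 - cnj a * z) / of_real R)) + deriv E z / E z)"
    unfolding reflect_def by (rule DERIV_imp_deriv)
  moreover have "reflect R zs E z \<noteq> 0" by (rule reflect_nonzero) (use zs z nz R in auto)
  ultimately have 2: "deriv (reflect R zs E) z / reflect R zs E z =
      (\<Sum>a\<leftarrow>zs. - (cnj a / (of_real R ^ 2 - cnj a * z))) + deriv E z / E z" using R by simp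
  have "(\<Sum>a\<leftarrow>zs. - u a) = - (\<Sum>a\<leftarrow>zs. u a)" for u :: "complex \<Rightarrow> complex"
    by (induction zs) auto
  thus ?thesis unfolding 1 2 by (simp only: sum_list_addf, simp)
qed


text \<open>
  This is the pointwise form of the lemma on the logarithmic derivative. The list \<open>zs\<close> contains the zeros of \<open>A\<close> and \<open>B\<close> in the disc of
  radius \<open>R1\<close>; Jensen's inequality between \<open>R1\<close> and \<open>R2\<close> bounds its length. After reflecting these zeros in the
  circle of radius \<open>R1\<close>, the quotient is zero-free, and its logarithm is estimated through its real part, whose modulus
  on the circle has the mean \<open>2 M(A,B) - M(A,A) - M(B,B)\<close> in terms of means of \<open>log_max\<close>. Each reflected zero costs the
  difference of the logarithmic derivatives of \<open>z - a\<close> and of its replacement.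
\<close>

lemma log_deriv_bound:
  fixes A B :: "complex \<Rightarrow> complex" and r R1 R2 U :: real
  defines "c \<equiv> \<bar>ln (norm (A 0))\<bar> + \<bar>ln (norm (B 0))\<bar>"
  assumes A: "A holomorphic_on UNIV" "A 0 \<noteq> 0" and B: "B holomorphic_on UNIV" "B 0 \<noteq> 0"
    and R: "0 \<le> r" "r < R1" "R1 < R2"
    and nz: "\<And>z. norm z = R1 \<or> norm z = R2 \<Longrightarrow> A z \<noteq> 0 \<and> B z \<noteq> 0"
    and U: "circle_mean (log_max A B) R2 \<le> U"
  obtains zs where "real (length zs) \<le> 2 * (U + c) * R2 / (R2 - R1)"
    "\<And>z. norm z \<le> r \<Longrightarrow> z \<notin> set zs \<Longrightarrow> A z \<noteq> 0 \<and> B z \<noteq> 0 \<and>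
      norm (deriv A z / A z - deriv B z / B z) \<le>
        2 * R1 / (R1 - r)\<^sup>2 * (2 * (U + c)) + (\<Sum>a\<leftarrow>zs. 1 / norm (z - a) + 1 / (R1 - r))"
proof -
  have R1: "R1 > 0" and R2: "R2 > 0" using R by auto
  obtain zsA EA where EA: "\<And>a. a \<in> set zsA \<Longrightarrow> norm a < R1" "EA holomorphic_on UNIV"
    "\<And>z. A z = (\<Prod>a\<leftarrow>zsA. z - a) * EA z" "\<And>z. norm z \<le> R1 \<Longrightarrow> EA z \<noteq> 0"
    using entire_factor_disc[OF A R1] nz by metis
  obtain zsB EB where EB: "\<And>a. a \<in> set zsB \<Longrightarrow> norm a < R1" "EB holomorphic_on UNIV"
    "\<And>z. B z = (\<Prod>a\<leftarrow>zsB. z - a) * EB z" "\<And>z. norm z \<le> R1 \<Longrightarrow> EB z \<noteq> 0"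
    using entire_factor_disc[OF B R1] nz by metis
  have contA: "continuous_on S A" and contB: "continuous_on S B" for S
    using A B by (auto intro!: holomorphic_on_imp_continuous_on intro: holomorphic_on_subset)
  have cont: "continuous_on (sphere 0 R') (log_max A A)" "continuous_on (sphere 0 R') (log_max B B)"
      "continuous_on (sphere 0 R') (log_max A B)" if "R' = R1 \<or> R' = R2" for R'
    using that nz by (intro continuous_on_log_max contA contB; auto)+
  have U1: "circle_mean (log_max A B) R1 \<le> U"
    using circle_mean_log_max_mono[OF A(1) B(1), of R1 R2] R U nz by force
  have lm: "log_max A A z \<le> log_max A B z" "log_max B B z \<le> log_max A B z" if "A z \<noteq> 0" "B z \<noteq> 0" for z
    unfolding log_max_def using that by (simp_all add: less_max_iff_disj)
  have UA: "circle_mean (log_max A A) R2 \<le> U"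
    using circle_mean_mono[OF cont(1,3)[of R2]] lm R2 U nz by force
  have UB: "circle_mean (log_max B B) R2 \<le> U"
    using circle_mean_mono[OF cont(2,3)[of R2]] lm R2 U nz by force
  have "length zsA * (R2 - R1) / R2 \<le> circle_mean (log_max A A) R2 - ln (norm (A 0))"
    using nz EA(1) R1 R2 R by (intro jensen_inequality[OF A R2 _ EA(2,3)]) (auto intro: less_imp_le)
  also have "\<dots> \<le> U + c" using UA by (simp add: c_def)
  finally have nA: "length zsA * (R2 - R1) / R2 \<le> U + c" .
  have "length zsB * (R2 - R1) / R2 \<le> circle_mean (log_max B B) R2 - ln (norm (B 0))"
    using nz EB(1) R1 R2 R by (intro jensen_inequality[OF B R2 _ EB(2,3)]) (auto intro: less_imp_le)
  also have "\<dots> \<le> U + c" using UB by (simp add: c_def)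
  finally have nB: "length zsB * (R2 - R1) / R2 \<le> U + c" .
  have len: "real (length (zsA @ zsB)) \<le> 2 * (U + c) * R2 / (R2 - R1)"
  proof -
    have "length (zsA @ zsB) * (R2 - R1) / R2 \<le> 2 * (U + c)" using nA nB by (simp add: distrib_right add_divide_distrib)
    thus ?thesis using R R2 by (simp add: field_simps)
  qed
  let ?A = "reflect R1 zsA EA" and ?B = "reflect R1 zsB EB"
  have hA: "?A holomorphic_on UNIV" and hB: "?B holomorphic_on UNIV"
    using EA(2) EB(2) R1 by (auto intro: reflect_holomorphic)
  have nzA: "?A z \<noteq> 0" and nzB: "?B z \<noteq> 0" if "norm z \<le> R1" for z
    using reflect_nonzero[of zsA R1 EA z] reflect_nonzero[of zsB R1 EB z] that EA(1,4) EB(1,4) R1 by blast+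
  \<comment> \<open>A holomorphic logarithm of the quotient is needed on a disc slightly larger than the closed disc of radius \<open>R1\<close>.\<close>
  define W where "W = {z. ?A z * ?B z \<noteq> 0}"
  have "open W" unfolding W_def
    by (intro open_Collect_neq continuous_intros holomorphic_on_imp_continuous_on hA hB)
  moreover have "cball 0 R1 \<subseteq> W" using nzA nzB by (auto simp: W_def)
  ultimately obtain e where e: "e > 0" "(\<Union>x\<in>cball 0 R1. cball x e) \<subseteq> W"
    using compact_subset_open_imp_cball_epsilon_subset[of "cball 0 R1" W] by auto
  have sub: "ball 0 (R1 + e) \<subseteq> W"
  proof
    fix z :: complex assume z: "z \<in> ball 0 (R1 + e)"
    show "z \<in> W"
    proof (cases "norm z \<le> R1")
      case True thus ?thesis using e by force
    next
      case False
      define x where "x = of_real (R1 / norm z) * z"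
      have nz: "norm z > 0" "norm z > R1" using False R1 by auto
      have "norm x = R1" unfolding x_def norm_mult norm_of_real using nz R1 by simp
      moreover have "norm (x - z) = norm z - R1"
      proof -
        have "R1 / norm z - 1 = (R1 - norm z) / norm z" using nz by (simp add: diff_divide_distrib)
        moreover have "x - z = of_real (R1 / norm z - 1) * z" by (simp add: x_def algebra_simps)
        ultimately have "x - z = of_real ((R1 - norm z) / norm z) * z" by simp
        hence "norm (x - z) = \<bar>(R1 - norm z) / norm z\<bar> * norm z" by (simp only: norm_mult norm_of_real)
        thus ?thesis using nz by (simp add: abs_divide)
      qed
      ultimately have "z \<in> cball x e" "x \<in> cball 0 R1" using z by (auto simp: dist_norm)
      thus ?thesis using e by blast
    qed
  qed
  have hol: "(\<lambda>z. ?A z / ?B z) holomorphic_on ball 0 (R1 + e)"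
    using sub by (intro holomorphic_intros holomorphic_on_subset[OF hA] holomorphic_on_subset[OF hB]) (auto simp: W_def)
  have nzq: "?A z / ?B z \<noteq> 0" if "z \<in> ball 0 (R1 + e)" for z using that sub by (auto simp: W_def)
  have "0 \<in> ball (0::complex) (R1 + e)" using R1 e(1) by simp
  then obtain h where h: "h holomorphic_on ball 0 (R1 + e)" "\<And>z. z \<in> ball 0 (R1 + e) \<Longrightarrow> exp (h z) = ?A z / ?B z"
    using holomorphic_logarithm_exists[OF convex_ball open_ball hol nzq] by blast
  have dh: "deriv h z = deriv ?A z / ?A z - deriv ?B z / ?B z" if "z \<in> ball 0 (R1 + e)" for z
  proof -
    have AB: "?A z \<noteq> 0" "?B z \<noteq> 0" using that sub by (auto simp: W_def)
    have "(h has_field_derivative deriv h z) (at z)" using h(1) that by (rule_tac holomorphic_derivI) auto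
    hence "((\<lambda>z. exp (h z)) has_field_derivative exp (h z) * deriv h z) (at z)"
      by (auto intro!: derivative_eq_intros)
    hence "((\<lambda>z. ?A z / ?B z) has_field_derivative exp (h z) * deriv h z) (at z)"
      by (rule has_field_derivative_transform_within_open[of _ _ _ "ball 0 (R1 + e)"]) (use that h(2) in auto)
    moreover have "((\<lambda>z. ?A z / ?B z) has_field_derivative (deriv ?A z * ?B z - ?A z * deriv ?B z) / (?B z * ?B z)) (at z)"
      by (rule DERIV_divide) (use AB hA hB in \<open>auto intro: holomorphic_derivI\<close>)
    ultimately have "exp (h z) * deriv h z = (deriv ?A z * ?B z - ?A z * deriv ?B z) / (?B z * ?B z)"
      by (rule DERIV_unique)
    thus ?thesis using AB h(2)[OF that] by (simp add: field_simps)
  qed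
  \<comment> \<open>\<open>|x - y| = 2 max x y - x - y\<close> with \<open>x = log |A z|\<close> and \<open>y = log |B z|\<close>.\<close>
  have "\<bar>Re (h z)\<bar> = 2 * log_max A B z - log_max A A z - log_max B B z" if z: "norm z = R1" for z
  proof -
    have nzz: "norm (A z) > 0" "norm (B z) > 0" using nz z by auto
    have "exp (Re (h z)) = norm (exp (h z))" by simp
    also have "\<dots> = norm (A z) / norm (B z)"
      using h(2)[of z] z e(1) norm_reflect[OF z R1] EA(3) EB(3) by (simp add: norm_divide)
    finally have "Re (h z) = ln (norm (A z) / norm (B z))" by (metis ln_exp)
    also have "\<dots> = ln (norm (A z)) - ln (norm (B z))" using nzz by (simp add: ln_div)
    finally show ?thesis using nzz unfolding log_max_def by (auto simp: max_def)
  qed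
  hence "circle_mean (\<lambda>z. \<bar>Re (h z)\<bar>) R1 = circle_mean (\<lambda>z. 2 * log_max A B z - log_max A A z - log_max B B z) R1"
    using R1 by (intro circle_mean_cong) auto
  also have "\<dots> = 2 * circle_mean (log_max A B) R1 - circle_mean (log_max A A) R1 - circle_mean (log_max B B) R1"
    using cont[of R1] R1 by (subst circle_mean_diff, intro continuous_intros, auto)+ (simp add: circle_mean_cmult)
  also have "\<dots> \<le> 2 * (U + c)"
    using circle_mean_ln_norm_ge[OF A, of R1] circle_mean_ln_norm_ge[OF B, of R1] R1 U1 nz by (force simp: c_def)
  finally have mean: "circle_mean (\<lambda>z. \<bar>Re (h z)\<bar>) R1 \<le> 2 * (U + c)" .
  show ?thesis
  proof (rule that[OF len])
    fix z assume z: "norm z \<le> r" "z \<notin> set (zsA @ zsB)"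
    have z1: "norm z \<le> R1" "norm z < R1" using z R by auto
    have AB: "A z \<noteq> 0" "B z \<noteq> 0" using z EA(3,4) EB(3,4) z1 by (auto simp: prod_list_zero_iff)
    have "norm (deriv h z) \<le> 2 * R1 / (R1 - r)\<^sup>2 * circle_mean (\<lambda>\<zeta>. \<bar>Re (h \<zeta>)\<bar>) R1"
      using e(1) by (intro norm_deriv_le_circle_mean_Re[OF h(1) R1 _ z(1) R(2)]) auto
    also have "\<dots> \<le> 2 * R1 / (R1 - r)\<^sup>2 * (2 * (U + c))"
      using mean R1 by (intro mult_left_mono) auto
    finally have h': "norm (deriv h z) \<le> 2 * R1 / (R1 - r)\<^sup>2 * (2 * (U + c))" .
    define t where "t = (\<lambda>a. 1 / (z - a) + cnj a / (of_real R1 ^ 2 - cnj a * z))"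
    have t: "norm (\<Sum>a\<leftarrow>zs. t a) \<le> (\<Sum>a\<leftarrow>zs. 1 / norm (z - a) + 1 / (R1 - r))" if "\<And>a. a \<in> set zs \<Longrightarrow> norm a < R1" for zs
      using that
    proof (induction zs)
      case (Cons a zs)
      have na: "norm a < R1" using Cons.prems by simp
      have "R1 * (R1 - r) \<le> R1\<^sup>2 - norm a * norm z"
        using mult_mono[of "norm a" R1 "norm z" r] na z(1) R1 by (simp add: power2_eq_square right_diff_distrib)
      also have "\<dots> \<le> norm (of_real R1 ^ 2 - cnj a * z)"
        using norm_triangle_ineq2[of "of_real R1 ^ 2" "cnj a * z"] by (simp add: norm_mult norm_power)
      finally have "R1 * (R1 - r) \<le> norm (of_real R1 ^ 2 - cnj a * z)" .
      hence "norm a / norm (of_real R1 ^ 2 - cnj a * z) \<le> R1 / (R1 * (R1 - r))"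
        using na R R1 by (intro frac_le) auto
      hence "norm (t a) \<le> 1 / norm (z - a) + 1 / (R1 - r)"
        unfolding t_def using R1 by (intro order.trans[OF norm_triangle_ineq]) (simp add: norm_divide)
      thus ?case using Cons by (simp add: order.trans[OF norm_triangle_ineq] add_mono)
    qed auto
    have "deriv A z / A z - deriv B z / B z = deriv h z + (\<Sum>a\<leftarrow>zsA. t a) - (\<Sum>a\<leftarrow>zsB. t a)"
      using logderiv_reflect[OF EA(3,2,1) z1(1) AB(1) R1] logderiv_reflect[OF EB(3,2,1) z1(1) AB(2) R1]
        dh[of z] z1 e(1) by (simp add: t_def)
    hence "norm (deriv A z / A z - deriv B z / B z) \<le> norm (deriv h z) + norm (\<Sum>a\<leftarrow>zsA. t a) + norm (\<Sum>a\<leftarrow>zsB. t a)"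
      by (metis norm_triangle_ineq4 norm_triangle_ineq order.trans add_right_mono)
    thus "A z \<noteq> 0 \<and> B z \<noteq> 0 \<and> norm (deriv A z / A z - deriv B z / B z) \<le>
        2 * R1 / (R1 - r)\<^sup>2 * (2 * (U + c)) + (\<Sum>a\<leftarrow>zsA @ zsB. 1 / norm (z - a) + 1 / (R1 - r))"
      using AB h' t[of zsA] t[of zsB] EA(1) EB(1) by simp
  qed
qed

section \<open>Circles on which logarithmic derivatives are small\<close>

lemma entire_avoids_zero_cosparse:
  assumes "A holomorphic_on UNIV" "A z0 \<noteq> 0"
  shows "\<forall>\<^sub>\<approx>z\<in>UNIV. A z \<noteq> 0"
proof -
  have "(\<forall>x\<in>UNIV. A x = 0) \<or> (\<forall>\<^sub>\<approx>x\<in>UNIV. A x \<noteq> 0)"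
    using assms(1) by (intro nicely_meromorphic_imp_constant_or_avoid analytic_on_imp_nicely_meromorphic_on) (auto simp: analytic_on_open)
  thus ?thesis using assms(2) by auto
qed

lemma entire_zeros_countable:
  assumes "A holomorphic_on UNIV" "A z0 \<noteq> 0"
  shows "countable {z. A z = 0}"
proof -
  have "{z. A z = 0} sparse_in UNIV" using entire_avoids_zero_cosparse[OF assms] by (simp add: eventually_cosparse)
  from sparse_imp_countable[OF open_UNIV this] show ?thesis by simp
qed

text \<open>
  The radii that are too close to some \<open>|a|\<close> fill a set of measure at most half of \<open>\<delta>\<close>, so they do not
  exhaust the interval, even after removing a countable set.
\<close>

lemma radius_away_from_points:
  fixes r \<delta> :: real and zs :: "complex list"
  assumes d: "\<delta> > 0" and D: "countable D"
  obtains \<rho> where "r < \<rho>" "\<rho> < r + \<delta>" "\<rho> \<notin> D" "\<And>a. a \<in> set zs \<Longrightarrow> \<delta> / (4 * (real (length zs) + 1)) \<le> \<bar>\<rho> - norm a\<bar>"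
proof (rule ccontr)
  assume no: "\<not> thesis"
  define \<eta> where "\<eta> = \<delta> / (4 * (real (length zs) + 1))"
  have e: "\<eta> > 0" using d by (simp add: \<eta>_def)
  define B where "B = (\<Union>a\<in>set zs. {norm a - \<eta>..norm a + \<eta>})"
  have sub: "{r<..<r + \<delta>} \<subseteq> B \<union> D"
  proof
    fix \<rho> assume \<rho>: "\<rho> \<in> {r<..<r + \<delta>}"
    show "\<rho> \<in> B \<union> D"
    proof (rule ccontr)
      assume "\<rho> \<notin> B \<union> D"
      hence "\<rho> \<notin> D" "\<And>a. a \<in> set zs \<Longrightarrow> \<eta> \<le> \<bar>\<rho> - norm a\<bar>" by (force simp: B_def)+
      thus False using no \<rho> that unfolding \<eta>_def by auto
    qed
  qed
  have Bm: "B \<in> sets lborel" unfolding B_def by (intro sets.finite_UN) auto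
  have D0: "emeasure lborel D = 0" "D \<in> sets lborel"
    using countable_imp_null_set_lborel[OF D] by auto
  have "emeasure lborel {r<..<r + \<delta>} \<le> emeasure lborel (B \<union> D)"
    using sub D0 Bm by (intro emeasure_mono) auto
  also have "\<dots> \<le> emeasure lborel B + emeasure lborel D"
    using D0 Bm by (intro emeasure_subadditive) auto
  also have "\<dots> = emeasure lborel B" using D0 by simp
  also have "\<dots> \<le> (\<Sum>a\<in>set zs. emeasure lborel {norm a - \<eta>..norm a + \<eta>})"
    unfolding B_def by (intro emeasure_subadditive_finite) auto
  also have "\<dots> = ennreal (card (set zs) * (2 * \<eta>))"
    using e by (simp add: ennreal_of_nat_eq_real_of_nat ennreal_mult)
  also have "\<dots> \<le> ennreal (length zs * (2 * \<eta>))"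
    using e card_length[of zs] by (intro ennreal_leI mult_right_mono) auto
  finally have "\<delta> \<le> length zs * (2 * \<eta>)" using d e by (simp add: ennreal_le_iff)
  also have "\<dots> < \<delta>" using d by (simp add: \<eta>_def field_simps add_pos_nonneg)
  finally show False by simp
qed

text \<open>
  The three radii at which \<open>log_deriv_bound\<close> is used are separated by gaps of at least \<open>\<delta>\<close>: the target \<open>\<rho>\<close> below
  \<open>r + \<delta>\<close>, the circle of reflection between \<open>r + 2 * \<delta>\<close> and \<open>r + 3 * \<delta>\<close>, and the circle of the
  hypothesis on the mean beyond \<open>r + 4 * \<delta>\<close>. All pairs of the finite family are treated simultaneously, so that one
  circle serves for all of them; \<open>L\<close> bounds the number of zeros of each pair, and the square of \<open>L\<close> arises
  because each of these zeros is only known to have a distance of order \<open>\<delta> / L\<close> from the circle.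
\<close>

lemma circle_with_small_log_derivs:
  fixes A B :: "'i \<Rightarrow> complex \<Rightarrow> complex" and r \<delta> R2 V c :: real
  defines "L \<equiv> 2 * (V + c) * (r + 5 * \<delta>) / \<delta>"
  assumes I: "finite I" and D: "countable D" and r: "0 \<le> r" and d: "\<delta> > 0"
    and hol: "\<And>i. i \<in> I \<Longrightarrow> A i holomorphic_on UNIV \<and> B i holomorphic_on UNIV \<and> A i 0 \<noteq> 0 \<and> B i 0 \<noteq> 0"
    and c: "\<And>i. i \<in> I \<Longrightarrow> \<bar>ln (norm (A i 0))\<bar> + \<bar>ln (norm (B i 0))\<bar> \<le> c" "0 \<le> c" and V: "V \<ge> 1"
    and R2: "r + 4 * \<delta> \<le> R2" "R2 \<le> r + 5 * \<delta>"
    and nz: "\<And>i z. i \<in> I \<Longrightarrow> norm z = R2 \<Longrightarrow> A i z \<noteq> 0 \<and> B i z \<noteq> 0"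
    and mean: "\<And>i. i \<in> I \<Longrightarrow> circle_mean (log_max (A i) (B i)) R2 \<le> V"
  obtains \<rho> where "r < \<rho>" "\<rho> < r + \<delta>" "\<rho> \<notin> D"
    "\<And>i z. i \<in> I \<Longrightarrow> norm z = \<rho> \<Longrightarrow> A i z \<noteq> 0 \<and> B i z \<noteq> 0 \<and>
       norm (deriv (A i) z / A i z - deriv (B i) z / B i z) \<le> (7 + 4 * real (card I)) * L\<^sup>2 / \<delta>"
proof -
  have "L \<ge> 2 * 1 * 1"
  proof -
    have "1 * \<delta> \<le> (V + c) * (r + 5 * \<delta>)" using V c(2) r d by (intro mult_mono) auto
    thus ?thesis using d by (simp add: L_def field_simps)
  qed
  hence L: "L \<ge> 1" by simp
  define D1 where "D1 = (\<Union>i\<in>I. norm ` {z. A i z = 0} \<union> norm ` {z. B i z = 0})"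
  have "countable D1" unfolding D1_def
    using I hol by (intro countable_UN countable_Un countable_image entire_zeros_countable[where ?z0.0=0]) (auto intro: countable_finite)
  then obtain R1 where R1: "r + 2 * \<delta> < R1" "R1 < r + 2 * \<delta> + \<delta>" "R1 \<notin> D1"
    using radius_away_from_points[of \<delta> D1 "r + 2 * \<delta>" "[]"] d by auto
  have "\<exists>zs. real (length zs) \<le> L \<and> (\<forall>z. norm z \<le> r + \<delta> \<longrightarrow> z \<notin> set zs \<longrightarrow> A i z \<noteq> 0 \<and> B i z \<noteq> 0 \<and>
      norm (deriv (A i) z / A i z - deriv (B i) z / B i z) \<le> 2 * L / \<delta> + (\<Sum>a\<leftarrow>zs. 1 / norm (z - a) + 1 / \<delta>))"
    if i: "i \<in> I" for i
  proof -
    define ci where "ci = \<bar>ln (norm (A i 0))\<bar> + \<bar>ln (norm (B i 0))\<bar>"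
    have ci: "ci \<le> c" "0 \<le> ci" using c(1)[OF i] by (auto simp: ci_def)
    have nz': "A i z \<noteq> 0 \<and> B i z \<noteq> 0" if "norm z = R1 \<or> norm z = R2" for z
      using that R1(3) nz[OF i] i by (auto simp: D1_def)
    have rr: "0 \<le> r + \<delta>" "r + \<delta> < R1" "R1 < R2" using r d R1 R2 by auto
    obtain zs where zs: "real (length zs) \<le> 2 * (V + ci) * R2 / (R2 - R1)"
      "\<And>z. norm z \<le> r + \<delta> \<Longrightarrow> z \<notin> set zs \<Longrightarrow> A i z \<noteq> 0 \<and> B i z \<noteq> 0 \<and>
        norm (deriv (A i) z / A i z - deriv (B i) z / B i z) \<le>
        2 * R1 / (R1 - (r + \<delta>))\<^sup>2 * (2 * (V + ci)) + (\<Sum>a\<leftarrow>zs. 1 / norm (z - a) + 1 / (R1 - (r + \<delta>)))"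
      using log_deriv_bound[of "A i" "B i" "r + \<delta>" R1 R2 V] hol[OF i] rr nz' mean[OF i]
      unfolding ci_def by metis
    have 1: "2 * (V + ci) * R2 / (R2 - R1) \<le> L"
      unfolding L_def using V ci R1 R2 r d by (intro frac_le mult_mono) auto
    have "2 * R1 / (R1 - (r + \<delta>))\<^sup>2 * (2 * (V + ci)) \<le> 2 * (r + 5 * \<delta>) / \<delta>\<^sup>2 * (2 * (V + c))"
      using V ci R1 R2 r d by (intro mult_mono frac_le power_mono) auto
    also have "\<dots> = 2 * L / \<delta>" by (simp add: L_def power2_eq_square)
    finally have 2: "2 * R1 / (R1 - (r + \<delta>))\<^sup>2 * (2 * (V + ci)) \<le> 2 * L / \<delta>" .
    have 3: "(\<Sum>a\<leftarrow>zs. 1 / norm (z - a) + 1 / (R1 - (r + \<delta>))) \<le> (\<Sum>a\<leftarrow>zs. 1 / norm (z - a) + 1 / \<delta>)" for z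
      using R1 d by (intro sum_list_mono add_left_mono frac_le) auto
    show ?thesis
    proof (intro exI[of _ zs] conjI allI impI)
      show "real (length zs) \<le> L" using zs(1) 1 by linarith
      fix z assume z: "norm z \<le> r + \<delta>" "z \<notin> set zs"
      show "norm (deriv (A i) z / A i z - deriv (B i) z / B i z) \<le> 2 * L / \<delta> + (\<Sum>a\<leftarrow>zs. 1 / norm (z - a) + 1 / \<delta>)"
        using zs(2)[OF z] 2 3[of z] by linarith
    qed (use zs(2) in blast)+
  qed
  then obtain zs where zs: "\<And>i. i \<in> I \<Longrightarrow> real (length (zs i)) \<le> L"
     "\<And>i z. i \<in> I \<Longrightarrow> norm z \<le> r + \<delta> \<Longrightarrow> z \<notin> set (zs i) \<Longrightarrow> A i z \<noteq> 0 \<and> B i z \<noteq> 0 \<and>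
      norm (deriv (A i) z / A i z - deriv (B i) z / B i z) \<le> 2 * L / \<delta> + (\<Sum>a\<leftarrow>zs i. 1 / norm (z - a) + 1 / \<delta>)"
    by metis
  obtain xs where xs: "set xs = I" "distinct xs" using finite_distinct_list[OF I] by blast
  define Z where "Z = concat (map zs xs)"
  define N where "N = real (length Z)"
  have "length Z = (\<Sum>i\<in>I. length (zs i))"
    using xs by (simp add: Z_def length_concat o_def sum_list_distinct_conv_sum_set)
  hence "N = (\<Sum>i\<in>I. real (length (zs i)))" by (simp add: N_def)
  also have "\<dots> \<le> (\<Sum>i\<in>I. L)" using zs(1) by (rule sum_mono)
  finally have N: "N \<le> card I * L" by simp
  obtain \<rho> where \<rho>: "r < \<rho>" "\<rho> < r + \<delta>" "\<rho> \<notin> D" "\<And>a. a \<in> set Z \<Longrightarrow> \<delta> / (4 * (N + 1)) \<le> \<bar>\<rho> - norm a\<bar>"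
    using radius_away_from_points[OF d D, of r Z] unfolding N_def by metis
  show ?thesis
  proof (rule that[OF \<rho>(1-3)])
    fix i and z :: complex assume i: "i \<in> I" and z: "norm z = \<rho>"
    have Npos: "N \<ge> 0" by (simp add: N_def)
    have far: "\<delta> / (4 * (N + 1)) \<le> norm (z - a)" if "a \<in> set (zs i)" for a
    proof -
      have "a \<in> set Z" using that i xs by (auto simp: Z_def)
      from \<rho>(4)[OF this] show ?thesis using norm_triangle_ineq3[of z a] z by linarith
    qed
    have pos: "\<delta> / (4 * (N + 1)) > 0" using d Npos by simp
    have "z \<notin> set (zs i)" using far[of z] pos by auto
    hence 1: "A i z \<noteq> 0 \<and> B i z \<noteq> 0 \<and>
      norm (deriv (A i) z / A i z - deriv (B i) z / B i z) \<le> 2 * L / \<delta> + (\<Sum>a\<leftarrow>zs i. 1 / norm (z - a) + 1 / \<delta>)"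
      using zs(2)[OF i, of z] z \<rho>(2) by simp
    have "(\<Sum>a\<leftarrow>zs i. 1 / norm (z - a) + 1 / \<delta>) \<le> (\<Sum>a\<leftarrow>zs i. (4 * (N + 1) + 1) / \<delta>)"
    proof (rule sum_list_mono)
      fix a assume a: "a \<in> set (zs i)"
      have "1 / norm (z - a) \<le> 1 / (\<delta> / (4 * (N + 1)))" using far[OF a] pos by (intro frac_le) auto
      thus "1 / norm (z - a) + 1 / \<delta> \<le> (4 * (N + 1) + 1) / \<delta>" by (simp add: add_divide_distrib)
    qed
    also have "\<dots> = length (zs i) * ((4 * (N + 1) + 1) / \<delta>)" by (simp add: sum_list_triv)
    also have "\<dots> \<le> L * ((4 * (card I * L + 1) + 1) / \<delta>)"
      using zs(1)[OF i] N d Npos L by (intro mult_mono divide_right_mono) auto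
    finally have "norm (deriv (A i) z / A i z - deriv (B i) z / B i z) \<le> 2 * L / \<delta> + L * ((4 * (card I * L + 1) + 1) / \<delta>)"
      using 1 by linarith
    also have "\<dots> = (7 * L + 4 * card I * L\<^sup>2) / \<delta>"
      using d by (simp add: add_divide_distrib distrib_left power2_eq_square)
    also have "\<dots> \<le> (7 * L\<^sup>2 + 4 * card I * L\<^sup>2) / \<delta>"
      using L d by (intro divide_right_mono add_right_mono mult_left_mono) (auto simp: power2_eq_square)
    also have "\<dots> = (7 + 4 * real (card I)) * L\<^sup>2 / \<delta>" by (simp add: algebra_simps)
    finally show "A i z \<noteq> 0 \<and> B i z \<noteq> 0 \<and>
       norm (deriv (A i) z / A i z - deriv (B i) z / B i z) \<le> (7 + 4 * real (card I)) * L\<^sup>2 / \<delta>"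
      using 1 by blast
  qed
qed

section \<open>Growth of monotone functions\<close>

text \<open>
  If \<open>T\<close> more than doubled at every step, iterating \<open>r + 1 / T r\<close> would double \<open>T\<close> each time, while the steps, being the reciprocals of \<open>T\<close>,
  would decrease geometrically; so \<open>T\<close> would be unbounded on a bounded interval.
\<close>

lemma borel_growth:
  fixes T :: "real \<Rightarrow> real"
  assumes mono: "\<And>r s. 0 \<le> r \<Longrightarrow> r \<le> s \<Longrightarrow> T r \<le> T s" and T1: "\<And>r. 0 \<le> r \<Longrightarrow> 1 \<le> T r"
    and r0: "0 \<le> r0"
  obtains r where "r0 \<le> r" "T (r + 1 / T r) \<le> 2 * T r"
proof (rule ccontr)
  assume "\<not> thesis"
  hence no: "2 * T r < T (r + 1 / T r)" if "r0 \<le> r" for r using that \<open>\<And>r. r0 \<le> r \<Longrightarrow> T (r + 1 / T r) \<le> 2 * T r \<Longrightarrow> thesis\<close> by (meson not_le)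
  define s where "s = rec_nat r0 (\<lambda>_ r. r + 1 / T r)"
  have s: "s 0 = r0" "\<And>n. s (Suc n) = s n + 1 / T (s n)" by (simp_all add: s_def)
  have *: "r0 \<le> s n \<and> 2 ^ n \<le> T (s n) \<and> s n \<le> r0 + 2 - 2 * (1/2) ^ n" for n
  proof (induction n)
    case 0 show ?case using s T1 r0 by simp
  next
    case (Suc n)
    have p: "(0::real) < 2 ^ n" by simp
    have Tp: "T (s n) > 0" using Suc p by linarith
    have "1 / T (s n) \<le> 1 / 2 ^ n" using Suc p by (intro frac_le) auto
    also have "\<dots> = (1/2) ^ n" by (simp add: power_one_over)
    finally have "s (Suc n) \<le> r0 + 2 - 2 * (1/2) ^ Suc n" using Suc s(2)[of n] by simp
    moreover have "r0 \<le> s (Suc n)" using Suc s(2)[of n] Tp by (simp add: add_increasing2)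
    moreover have "2 ^ Suc n \<le> T (s (Suc n))" using no[of "s n"] Suc s(2)[of n] by simp
    ultimately show ?case by blast
  qed
  have "2 ^ n \<le> T (r0 + 2)" for n
  proof -
    have "s n \<le> r0 + 2" using *[of n] by (smt (verit) zero_le_power half_gt_zero_iff)
    thus ?thesis using *[of n] mono[of "s n" "r0 + 2"] r0 by linarith
  qed
  moreover obtain n where "T (r0 + 2) < 2 ^ n" using real_arch_pow[of 2] by auto
  ultimately show False by (metis not_le)
qed

text \<open>
  The expressions \<open>x\<^sup>2 / \<delta>\<close> and \<open>y\<^sup>2 / \<delta>\<close> are, up to constants, the bounds for logarithmic derivatives that
  come out of a first and of a second use of \<open>circle_with_small_log_derivs\<close>, when the largest radius involved is \<open>r + 9 * \<delta>\<close>.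
  If \<open>T\<close> grows very slowly along some sequence of radii, a gap \<open>\<delta>\<close> proportional to \<open>r\<close> keeps both expressions bounded. Otherwise \<open>r\<close> is
  bounded by a power of \<open>T\<close>, the gap \<open>1 / (9 * T r)\<close> is taken from the Borel lemma, and both expressions are bounded by
  powers of \<open>T r\<close>, whose logarithm is negligible against \<open>T r\<close>. The fourth power in the case distinction is an arbitrary choice
  among the exponents that are at least 2.
\<close>

lemma growth_dominates_error:
  fixes T :: "real \<Rightarrow> real" and K :: real
  assumes mono: "\<And>r s. 0 \<le> r \<Longrightarrow> r \<le> s \<Longrightarrow> T r \<le> T s" and T1: "\<And>r. 0 \<le> r \<Longrightarrow> 1 \<le> T r"
    and unb: "\<And>M. \<exists>r\<ge>0. M \<le> T r" and K: "K \<ge> 0"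
  obtains r \<delta> where "0 \<le> r" "0 < \<delta>"
    "let x = T (r + 9 * \<delta>) * (r + 9 * \<delta>) / \<delta>; y = x * (1 + x\<^sup>2 / \<delta>) in K * ln (1 + K * y\<^sup>2 / \<delta>) + K < T r"
proof (cases "\<forall>M. \<exists>r\<ge>M. T (2 * r) ^ 4 \<le> r")
  case True
  define C where "C = K * ln (1 + K * (2917\<^sup>2 * 2916)) + K"
  obtain r1 where r1: "r1 \<ge> 0" "C + 1 \<le> T r1" using unb by blast
  obtain r where r: "r \<ge> max r1 1" "T (2 * r) ^ 4 \<le> r" using True by blast
  define \<delta> where "\<delta> = r / 9"
  define x where "x = T (r + 9 * \<delta>) * (r + 9 * \<delta>) / \<delta>"
  define y where "y = x * (1 + x\<^sup>2 / \<delta>)"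
  have rp: "r > 0" "\<delta> > 0" using r by (auto simp: \<delta>_def)
  let ?T = "T (2 * r)"
  have Tp: "?T \<ge> 1" using T1[of "2 * r"] rp by simp
  have x: "x = 18 * ?T" using rp by (simp add: x_def \<delta>_def field_simps)
  have "?T\<^sup>2 * ?T\<^sup>2 \<le> r" using r(2) by (simp add: power2_eq_square power4_eq_xxxx)
  moreover have "?T\<^sup>2 * 1 \<le> ?T\<^sup>2 * ?T\<^sup>2" using Tp by (intro mult_left_mono) (auto simp: one_le_power)
  ultimately have "?T\<^sup>2 \<le> r" by linarith
  hence xd: "x\<^sup>2 / \<delta> \<le> 2916" "x\<^sup>2 / \<delta> \<ge> 0" using rp by (auto simp: x \<delta>_def power_mult_distrib divide_le_eq)
  have y2: "y\<^sup>2 / \<delta> = (1 + x\<^sup>2 / \<delta>)\<^sup>2 * (x\<^sup>2 / \<delta>)" by (simp add: y_def power_mult_distrib)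
  have "(1 + x\<^sup>2 / \<delta>)\<^sup>2 * (x\<^sup>2 / \<delta>) \<le> 2917\<^sup>2 * 2916"
    using xd by (intro mult_mono power_mono) auto
  hence "K * (y\<^sup>2 / \<delta>) \<le> K * (2917\<^sup>2 * 2916)" unfolding y2 using K by (intro mult_left_mono) auto
  moreover have "0 \<le> K * (y\<^sup>2 / \<delta>)" using K rp by simp
  ultimately have "K * ln (1 + K * (y\<^sup>2 / \<delta>)) + K \<le> C"
    unfolding C_def using K by (intro add_right_mono mult_left_mono) (auto simp: ln_le_cancel_iff)
  also have "C < T r" using r1 r mono[of r1 r] by linarith
  finally show ?thesis using rp by (intro that[of r \<delta>]) (auto simp: Let_def x_def y_def)
next
  case False
  then obtain r1 where r1: "\<And>r. r \<ge> r1 \<Longrightarrow> r < T (2 * r) ^ 4" by (meson not_le)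
  define C where "C = ((54 * (1 + 54\<^sup>2 * 9))\<^sup>2 * 9 :: real)"
  define C1 where "C1 = K * ln (1 + K * C) + K"
  have "((\<lambda>t. ln t / t) \<longlongrightarrow> 0) (at_top :: real filter)" by (rule ln_x_over_x_tendsto_0)
  hence "eventually (\<lambda>t. ln t / t < 1 / (2 * (39 * K + 1))) (at_top :: real filter)"
    using K by (intro order_tendstoD) auto
  then obtain M where M: "\<And>t. t \<ge> M \<Longrightarrow> ln t / t < 1 / (2 * (39 * K + 1))" by (auto simp: eventually_at_top_linorder)
  obtain r2 where r2: "r2 \<ge> 0" "max M (2 * C1 + 1) \<le> T r2" using unb by blast
  have "0 \<le> max r2 (max (2 * r1) 0)" by simp
  then obtain r where r: "max r2 (max (2 * r1) 0) \<le> r" "T (r + 1 / T r) \<le> 2 * T r"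
    using borel_growth[of T "max r2 (max (2 * r1) 0)"] mono T1 by metis
  define t where "t = T r"
  have t1: "t \<ge> 1" using T1 r by (simp add: t_def)
  have tM: "t \<ge> M" "t > 2 * C1" using r2 r mono[of r2 r] by (auto simp: t_def)
  define \<delta> where "\<delta> = 1 / (9 * t)"
  define x where "x = T (r + 9 * \<delta>) * (r + 9 * \<delta>) / \<delta>"
  define y where "y = x * (1 + x\<^sup>2 / \<delta>)"
  have d: "\<delta> > 0" "9 * \<delta> = 1 / t" using t1 by (auto simp: \<delta>_def)
  have rp: "r \<ge> 0" using r by simp
  have rt: "r \<le> 2 * t ^ 4" using r1[of "r / 2"] r by (simp add: t_def)
  have t4: "1 \<le> t ^ 4" using t1 by (simp add: one_le_power)
  have "1 / t \<le> 1" "0 \<le> 1 / t" using t1 by auto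
  hence r9: "r + 9 * \<delta> \<le> 3 * t ^ 4" "0 \<le> r + 9 * \<delta>" using rt t4 d(2) rp by linarith+
  have T9: "T (r + 9 * \<delta>) \<le> 2 * t" "0 \<le> T (r + 9 * \<delta>)" using r(2) d(2) T1[of "r + 9 * \<delta>"] r9(2) by (auto simp: t_def)
  have "T (r + 9 * \<delta>) * (r + 9 * \<delta>) * (9 * t) \<le> (2 * t) * (3 * t ^ 4) * (9 * t)"
    using r9 T9 t1 by (intro mult_mono) auto
  hence x: "x \<le> 54 * t ^ 6" "0 \<le> x" using T9 r9 d(1) t1 by (auto simp: x_def \<delta>_def power_numeral_reduce mult_ac)
  have "x\<^sup>2 / \<delta> \<le> (54 * t ^ 6)\<^sup>2 / \<delta>" using x d by (intro divide_right_mono power_mono) auto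
  also have "\<dots> = 54\<^sup>2 * 9 * t ^ 13" using t1 by (simp add: \<delta>_def power_mult_distrib power_numeral_reduce)
  finally have xd: "x\<^sup>2 / \<delta> \<le> 54\<^sup>2 * 9 * t ^ 13" .
  have t13: "1 \<le> t ^ 13" and t39: "1 \<le> t ^ 39" using t1 by (auto intro: one_le_power)
  have "(1 + 54\<^sup>2 * 9) * t ^ 13 = t ^ 13 + 54\<^sup>2 * 9 * t ^ 13" by (simp add: distrib_right)
  hence "1 + x\<^sup>2 / \<delta> \<le> (1 + 54\<^sup>2 * 9) * t ^ 13" using xd t13 by linarith
  hence "y \<le> (54 * t ^ 6) * ((1 + 54\<^sup>2 * 9) * t ^ 13)"
    unfolding y_def using x(1) by (rule_tac mult_mono) (use x d t1 in \<open>auto intro: add_nonneg_nonneg\<close>)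
  moreover have "0 \<le> y" unfolding y_def using x d by (intro mult_nonneg_nonneg) auto
  ultimately have "y\<^sup>2 / \<delta> \<le> ((54 * t ^ 6) * ((1 + 54\<^sup>2 * 9) * t ^ 13))\<^sup>2 / \<delta>" using d by (intro divide_right_mono power_mono) auto
  also have "\<dots> = C * t ^ 39"
    using t1 power_add[of t 38 1] by (simp add: C_def \<delta>_def power_mult_distrib power_mult[symmetric] power_add[symmetric])
  finally have "y\<^sup>2 / \<delta> \<le> C * t ^ 39" .
  hence "K * (y\<^sup>2 / \<delta>) \<le> K * (C * t ^ 39)" using K by (intro mult_left_mono) auto
  moreover have "(1 + K * C) * t ^ 39 = t ^ 39 + K * (C * t ^ 39)" by (simp add: distrib_right)
  ultimately have "1 + K * (y\<^sup>2 / \<delta>) \<le> (1 + K * C) * t ^ 39" using t39 by linarith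
  moreover have "0 \<le> K * (y\<^sup>2 / \<delta>)" using K d by simp
  moreover have KC: "1 + K * C > 0" using K by (simp add: C_def add_pos_nonneg)
  ultimately have "ln (1 + K * (y\<^sup>2 / \<delta>)) \<le> ln ((1 + K * C) * t ^ 39)" using t1 by (subst ln_le_cancel_iff) auto
  also have "\<dots> = ln (1 + K * C) + 39 * ln t" using t1 KC by (simp add: ln_mult ln_realpow)
  finally have "K * ln (1 + K * (y\<^sup>2 / \<delta>)) \<le> K * (ln (1 + K * C) + 39 * ln t)" using K by (rule mult_left_mono)
  moreover have "39 * K * ln t < t / 2"
  proof -
    have "ln t < 1 / (2 * (39 * K + 1)) * t" using M[OF tM(1)] t1 by (simp add: divide_less_eq)
    hence "(39 * K + 1) * ln t < t / 2" using K by (simp add: field_simps)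
    moreover have "(39 * K + 1) * ln t = 39 * K * ln t + ln t" by (simp add: distrib_right)
    moreover have "0 \<le> ln t" using t1 by simp
    ultimately show ?thesis by linarith
  qed
  ultimately have "K * ln (1 + K * (y\<^sup>2 / \<delta>)) + K < t" using tM(2) by (simp add: C1_def algebra_simps)
  thus ?thesis using rp d by (intro that[of r \<delta>]) (auto simp: Let_def x_def y_def t_def)
qed

section \<open>The vanishing principle for entire functions\<close>

text \<open>
  The index \<open>(b, Some s)\<close> stands for \<open>q - s\<close>, and \<open>(b, None)\<close> for the derivative of \<open>q\<close>, where \<open>q\<close> is the
  quotient \<open>nm b / dn b\<close>. Each of these functions is represented as a quotient of entire functions, and \<open>logderiv_of\<close> is its
  logarithmic derivative. The Boolean \<open>b\<close> numbers the two functions under consideration.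
\<close>

context
  fixes nm dn :: "bool \<Rightarrow> complex \<Rightarrow> complex"
begin

fun num_of :: "bool \<times> complex option \<Rightarrow> complex \<Rightarrow> complex" where
  "num_of (b, None) z = deriv (nm b) z * dn b z - nm b z * deriv (dn b) z"
| "num_of (b, Some s) z = nm b z - s * dn b z"

fun den_of :: "bool \<times> complex option \<Rightarrow> complex \<Rightarrow> complex" where
  "den_of (b, None) z = (dn b z)\<^sup>2"
| "den_of (b, Some s) z = dn b z"

definition logderiv_of :: "bool \<times> complex option \<Rightarrow> complex \<Rightarrow> complex" where
  "logderiv_of i z = deriv (num_of i) z / num_of i z - deriv (den_of i) z / den_of i z"

end

text \<open>
  \<open>T\<close> is the sum of the Nevanlinna characteristics of the two quotients plus a constant that makes it at least 1. Since \<open>Y\<close>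
  satisfies \<open>log |Y 0| \<le> circle_mean (log |Y|)\<close>, the hypothesis \<open>bound\<close> gives
  \<open>T \<rho> \<le> O(1) + N * log (1 + \<Lambda>)\<close> on every circle of radius \<open>\<rho>\<close> on which the sum of logarithmic derivatives is at most \<open>\<Lambda>\<close>. Such a circle is produced in two
  steps. The functions \<open>q - s\<close> have characteristic \<open>O(T)\<close>, so their logarithmic derivatives are small on a first circle. There
  \<open>q' = q * (q'/q)\<close> has a characteristic bounded by that of \<open>q\<close> and by this first estimate, so a second use, at a smaller radius,
  gives a circle on which the logarithmic derivatives of \<open>q'\<close> are small as well.
\<close>

lemma no_small_entire_function:
  fixes nm dn :: "bool \<Rightarrow> complex \<Rightarrow> complex" and Y :: "complex \<Rightarrow> complex" and C :: real and S :: "complex set"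
  defines "J \<equiv> (UNIV :: bool set) \<times> insert None (Some ` S)"
  assumes S: "finite S" "0 \<in> S" and D: "countable D"
    and hol: "\<And>b. nm b holomorphic_on UNIV" "\<And>b. dn b holomorphic_on UNIV" "Y holomorphic_on UNIV"
    and cop: "\<And>b z. nm b z \<noteq> 0 \<or> dn b z \<noteq> 0"
    and at0: "Y 0 \<noteq> 0" "\<And>i. i \<in> J \<Longrightarrow> num_of nm dn i 0 \<noteq> 0 \<and> den_of dn i 0 \<noteq> 0"
    and bound: "\<And>z. norm z \<notin> D \<Longrightarrow> norm (Y z) * (\<Prod>b\<in>UNIV. max (norm (nm b z)) (norm (dn b z)))
       \<le> C * (1 + (\<Sum>i\<in>J. norm (logderiv_of nm dn i z))) ^ N"
  shows False
proof -
  define I where "I = (UNIV :: bool set) \<times> (Some ` S)"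
  have finJ: "finite J" and finI: "finite I" and IJ: "I \<subseteq> J" using S by (auto simp: I_def J_def)
  let ?m = "\<lambda>b. log_max (nm b) (dn b)"
  define \<mu> where "\<mu> = (\<lambda>b r. circle_mean (?m b) r)"
  define c0 where "c0 = 1 + (\<Sum>b\<in>UNIV. \<bar>?m b 0\<bar>) + (\<Sum>s\<in>S. ln (1 + norm s))"
  define T where "T = (\<lambda>r. (\<Sum>b\<in>UNIV. \<mu> b r) + c0)"
  have contn: "continuous_on X (nm b)" and contd: "continuous_on X (dn b)" and contY: "continuous_on X Y" for b X
    using hol by (auto intro!: holomorphic_on_imp_continuous_on intro: holomorphic_on_subset)
  have contm: "continuous_on X (?m b)" for b X by (intro continuous_on_log_max contn contd cop)
  have mu_mono: "\<mu> b r \<le> \<mu> b s" if "0 \<le> r" "r \<le> s" for b r s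
    unfolding \<mu>_def by (intro circle_mean_log_max_mono hol that cop)
  have mu0: "- \<bar>?m b 0\<bar> \<le> \<mu> b r" if "0 \<le> r" for b r
    using mu_mono[of 0 r b] that by (simp add: \<mu>_def circle_mean_0)
  have lnS: "0 \<le> ln (1 + norm s)" for s :: complex by simp
  have mono: "T r \<le> T s" if "0 \<le> r" "r \<le> s" for r s
    unfolding T_def using mu_mono[OF that] by (intro add_right_mono sum_mono) auto
  have T_ge: "\<mu> b r + ln (1 + norm s) + 1 \<le> T r" if "0 \<le> r" "s \<in> S" for b r s
  proof -
    have "ln (1 + norm s) \<le> (\<Sum>s\<in>S. ln (1 + norm s))" using that S by (intro member_le_sum) auto
    moreover have "\<mu> b r \<le> (\<Sum>b\<in>UNIV. \<mu> b r + \<bar>?m b 0\<bar>)"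
    proof -
      have "\<mu> b r + \<bar>?m b 0\<bar> \<le> (\<Sum>b\<in>UNIV. \<mu> b r + \<bar>?m b 0\<bar>)"
      proof (rule member_le_sum)
        show "0 \<le> \<mu> b' r + \<bar>?m b' 0\<bar>" for b' using mu0[OF that(1), of b'] by linarith
      qed auto
      thus ?thesis by linarith
    qed
    ultimately show ?thesis unfolding T_def c0_def by (simp add: sum.distrib)
  qed
  have T1: "1 \<le> T r" if "0 \<le> r" for r
  proof -
    have "(\<Sum>b\<in>UNIV. - \<bar>?m b 0\<bar>) \<le> (\<Sum>b\<in>UNIV. \<mu> b r)" using mu0[OF that] by (intro sum_mono) auto
    moreover have "0 \<le> (\<Sum>s\<in>S. ln (1 + norm s))" by (intro sum_nonneg) auto
    ultimately show ?thesis unfolding T_def c0_def by (simp add: sum_negf)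
  qed
  have holp: "num_of nm dn i holomorphic_on UNIV" "den_of dn i holomorphic_on UNIV" for i
  proof -
    obtain b o' where i: "i = (b, o')" by (cases i)
    have eqs: "num_of nm dn (b, None) = (\<lambda>z. deriv (nm b) z * dn b z - nm b z * deriv (dn b) z)"
      "den_of dn (b, None) = (\<lambda>z. (dn b z)\<^sup>2)"
      "num_of nm dn (b, Some s) = (\<lambda>z. nm b z - s * dn b z)" "den_of dn (b, Some s) = dn b" for s
      by auto
    show "num_of nm dn i holomorphic_on UNIV"
      unfolding i by (cases o') (auto simp: eqs intro!: holomorphic_intros hol)
    show "den_of dn i holomorphic_on UNIV"
      unfolding i by (cases o') (auto simp: eqs intro!: holomorphic_intros hol)
  qed
  have contp: "continuous_on X (num_of nm dn i)" "continuous_on X (den_of dn i)" for i X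
    by (rule holomorphic_on_imp_continuous_on, rule holomorphic_on_subset[OF holp(1)], simp)
       (rule holomorphic_on_imp_continuous_on, rule holomorphic_on_subset[OF holp(2)], simp)
  define D1 where "D1 = D \<union> norm ` {z. Y z = 0} \<union> (\<Union>i\<in>J. norm ` {z. num_of nm dn i z = 0} \<union> norm ` {z. den_of dn i z = 0})"
  have D1: "countable D1" unfolding D1_def
    using finJ D by (intro countable_UN countable_Un countable_image entire_zeros_countable[where ?z0.0=0] holp hol)
      (auto intro: countable_finite simp: at0)
  have nzJ: "num_of nm dn i z \<noteq> 0 \<and> den_of dn i z \<noteq> 0" if "norm z \<notin> D1" "i \<in> J" for i z
    using that by (auto simp: D1_def)
  \<comment> \<open>The quotient \<open>nm True / dn True\<close> takes the value \<open>s\<close> at 0, so \<open>G\<close> has a zero of order \<open>k \<ge> 1\<close> there, and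
      the mean of \<open>log |G|\<close> over the circle of radius \<open>r\<close> is at least \<open>k * ln r + O(1)\<close>.\<close>
  have unb: "\<exists>r\<ge>0. M \<le> T r" for M
  proof -
    let ?n = "nm True" and ?d = "dn True"
    have d0: "?d 0 \<noteq> 0" using at0(2)[of "(True, None)"] by (auto simp: J_def)
    define s where "s = ?n 0 / ?d 0"
    define G where "G = (\<lambda>z. ?n z - s * ?d z)"
    have holG: "G holomorphic_on UNIV" unfolding G_def by (intro holomorphic_intros hol)
    have "\<exists>z0. G z0 \<noteq> 0"
    proof (rule ccontr)
      assume "\<nexists>z0. G z0 \<noteq> 0"
      hence "?n = (\<lambda>z. s * ?d z)" by (auto simp: G_def fun_eq_iff)
      hence "deriv ?n 0 = s * deriv ?d 0" by (simp add: deriv_cmult holomorphic_on_imp_differentiable_at[OF hol(2)])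
      hence "num_of nm dn (True, None) 0 = 0" using d0 by (simp add: s_def)
      thus False using at0(2)[of "(True, None)"] by (auto simp: J_def)
    qed
    then obtain z0 where z0: "G z0 \<noteq> 0" by blast
    obtain k E where E: "E holomorphic_on UNIV" "E 0 \<noteq> 0" "\<And>z. G z = (z - 0) ^ k * E z"
      using entire_divide_out_zero[OF holG z0] by blast
    have k: "k \<ge> 1" using E(3)[of 0] E(2) d0 by (cases k) (auto simp: G_def s_def)
    define L where "L = M - ln (norm (E 0)) + ln (1 + norm s) + (\<Sum>b\<in>UNIV. \<bar>?m b 0\<bar>)"
    define r0 where "r0 = max 1 (exp L)"
    have "countable (norm ` {z. E z = 0})" using entire_zeros_countable[OF E(1,2)] by simp
    then obtain r where r: "r0 < r" "r \<notin> norm ` {z. E z = 0}"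
      using radius_away_from_points[of 1 "norm ` {z. E z = 0}" r0 "[]"] by auto
    have r1: "1 < r" "exp L < r" using r(1) by (auto simp: r0_def)
    have nzE: "E z \<noteq> 0" if "norm z = r" for z using that r(2) by auto
    have contE: "continuous_on X E" for X using E(1) holomorphic_on_imp_continuous_on continuous_on_subset by blast
    have cE: "continuous_on (sphere 0 r) (log_max E E)" by (intro continuous_on_log_max contE) (use nzE in auto)
    have "ln (norm (E 0)) \<le> circle_mean (log_max E E) r" using E(1,2) nzE r1 by (intro circle_mean_ln_norm_ge) auto
    moreover have "L \<le> ln r" using r1 by (metis less_imp_le ln_exp ln_le_cancel_iff exp_gt_zero order.strict_trans)
    ultimately have "L + ln (norm (E 0)) \<le> circle_mean (\<lambda>z. ln r + log_max E E z) r"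
      using r1 by (subst circle_mean_add) (auto intro!: cE continuous_intros)
    also have "\<dots> \<le> circle_mean (\<lambda>z. ?m True z + ln (1 + norm s)) r"
    proof (rule circle_mean_mono)
      fix z :: complex assume z: "norm z = r"
      have Ez: "norm (E z) > 0" using nzE[OF z] by simp
      have "r \<le> r ^ k" using k r1 by (metis less_imp_le power_increasing power_one_right)
      hence "r * norm (E z) \<le> r ^ k * norm (E z)" by (intro mult_right_mono) auto
      also have "\<dots> = norm (G z)" by (simp add: E(3) norm_mult norm_power z)
      also have "\<dots> \<le> norm (?n z) + norm s * norm (?d z)"
        unfolding G_def by (rule order.trans[OF norm_triangle_ineq4]) (simp add: norm_mult)
      also have "\<dots> \<le> max (norm (?n z)) (norm (?d z)) + norm s * max (norm (?n z)) (norm (?d z))"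
        by (intro add_mono mult_left_mono) auto
      also have "\<dots> = max (norm (?n z)) (norm (?d z)) * (1 + norm s)" by (simp add: algebra_simps)
      finally have le: "r * norm (E z) \<le> max (norm (?n z)) (norm (?d z)) * (1 + norm s)" .
      have pos: "0 < max (norm (?n z)) (norm (?d z))" using cop[of True z] by (auto simp: less_max_iff_disj)
      have s1: "0 < 1 + norm s" by (simp add: add_pos_nonneg)
      have "ln r + log_max E E z = ln (r * norm (E z))" using Ez r1 by (simp add: log_max_def ln_mult)
      also have "\<dots> \<le> ln (max (norm (?n z)) (norm (?d z)) * (1 + norm s))" using le Ez r1 pos s1 by (subst ln_le_cancel_iff) auto
      also have "\<dots> = ?m True z + ln (1 + norm s)" unfolding log_max_def using pos s1 by (rule ln_mult_pos)
      finally show "ln r + log_max E E z \<le> ?m True z + ln (1 + norm s)" .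
    qed (use r1 in \<open>auto intro!: cE contm continuous_intros\<close>)
    also have "\<dots> = \<mu> True r + ln (1 + norm s)"
      using r1 by (subst circle_mean_add) (auto intro!: contm simp: \<mu>_def)
    finally have "M \<le> \<mu> True r - (\<Sum>b\<in>UNIV. \<bar>?m b 0\<bar>)" by (simp add: L_def)
    also have "\<dots> \<le> T r" using mu0[of r False] r1 sum_nonneg[of S "\<lambda>s. ln (1 + norm s)"]
      by (simp add: T_def c0_def UNIV_bool)
    finally show ?thesis using r1 by (intro exI[of _ r]) auto
  qed
  define c where "c = (\<Sum>i\<in>J. \<bar>ln (norm (num_of nm dn i 0))\<bar> + \<bar>ln (norm (den_of dn i 0))\<bar>)"
  have c0: "0 \<le> c" unfolding c_def by (intro sum_nonneg) auto
  have c: "\<bar>ln (norm (num_of nm dn i 0))\<bar> + \<bar>ln (norm (den_of dn i 0))\<bar> \<le> c" if "i \<in> J" for i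
    unfolding c_def using that finJ by (intro member_le_sum[of i J "\<lambda>i. \<bar>ln (norm (num_of nm dn i 0))\<bar> + \<bar>ln (norm (den_of dn i 0))\<bar>"]) auto
  define k1 where "k1 = (7 + 4 * real (card I)) * (2 * (1 + c))\<^sup>2"
  define k2 where "k2 = (7 + 4 * real (card J)) * (2 * (2 + k1 + c))\<^sup>2"
  define K where "K = real N + card J * k2 + c0 + \<bar>ln C\<bar> + \<bar>ln (norm (Y 0))\<bar>"
  have kpos: "0 \<le> k1" "0 \<le> k2" by (auto simp: k1_def k2_def)
  have "0 \<le> c0" unfolding c0_def by (intro add_nonneg_nonneg sum_nonneg) auto
  hence Kpos: "0 \<le> K" "real N \<le> K" "card J * k2 \<le> K" "c0 + \<bar>ln C\<bar> + \<bar>ln (norm (Y 0))\<bar> \<le> K" using kpos by (auto simp: K_def)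
  \<comment> \<open>Above \<open>r + 8 * \<delta>\<close> there is only \<open>R3\<close>, where the characteristic is evaluated; the first circle \<open>\<rho>2\<close> lies between
      \<open>r + 4 * \<delta>\<close> and \<open>r + 5 * \<delta>\<close>, and the second one, \<open>\<rho>\<close>, between \<open>r\<close> and \<open>r + \<delta>\<close>.\<close>
  obtain r \<delta> where r: "0 \<le> r" "0 < \<delta>" and gr: "let x = T (r + 9 * \<delta>) * (r + 9 * \<delta>) / \<delta>; y = x * (1 + x\<^sup>2 / \<delta>) in K * ln (1 + K * y\<^sup>2 / \<delta>) + K < T r"
    using growth_dominates_error[of T K] mono T1 unb Kpos(1) by metis
  define R where "R = r + 9 * \<delta>"
  define x where "x = T R * R / \<delta>"
  define y where "y = x * (1 + x\<^sup>2 / \<delta>)"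
  have gr: "K * ln (1 + K * y\<^sup>2 / \<delta>) + K < T r" using gr by (simp add: Let_def x_def y_def R_def)
  have R0: "0 \<le> R" using r by (simp add: R_def)
  have TR: "1 \<le> T R" using T1 R0 by simp
  have x0: "0 \<le> x" using TR R0 r by (simp add: x_def)
  obtain R3 where "r + 8 * \<delta> < R3" "R3 < r + 8 * \<delta> + \<delta>" "R3 \<notin> D1"
    using radius_away_from_points[OF r(2) D1] by metis
  hence R3: "r + 8 * \<delta> < R3" "R3 < R" "R3 \<notin> D1" by (simp_all add: R_def)
  have meanI: "circle_mean (log_max (num_of nm dn i) (den_of dn i)) \<rho> \<le> T R" if i: "i \<in> I" and \<rho>: "0 \<le> \<rho>" "\<rho> \<le> R" "\<rho> \<notin> D1" for i \<rho>
  proof -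
    obtain b s where i': "i = (b, Some s)" "s \<in> S" using i by (auto simp: I_def)
    have nz: "num_of nm dn i z \<noteq> 0 \<and> den_of dn i z \<noteq> 0" if "norm z = \<rho>" for z using nzJ[of z i] that \<rho>(3) i IJ by auto
    have "circle_mean (log_max (num_of nm dn i) (den_of dn i)) \<rho> \<le> circle_mean (\<lambda>z. ?m b z + ln (1 + norm s)) \<rho>"
    proof (rule circle_mean_mono)
      show "continuous_on (sphere 0 \<rho>) (log_max (num_of nm dn i) (den_of dn i))"
        by (intro continuous_on_log_max contp) (use nz in auto)
      fix z :: complex assume z: "norm z = \<rho>"
      let ?M = "max (norm (nm b z)) (norm (dn b z))"
      have M0: "0 \<le> ?M" by (simp add: le_max_iff_disj)
      have "norm (num_of nm dn i z) \<le> norm (nm b z) + norm s * norm (dn b z)"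
        unfolding i' by (simp, rule order.trans[OF norm_triangle_ineq4]) (simp add: norm_mult)
      also have "\<dots> \<le> ?M + norm s * ?M" by (intro add_mono mult_left_mono) auto
      finally have "norm (num_of nm dn i z) \<le> ?M * (1 + norm s)" by (simp add: algebra_simps)
      moreover have "norm (den_of dn i z) \<le> ?M * (1 + norm s)"
      proof -
        have "norm (den_of dn i z) \<le> ?M * 1" unfolding i' by simp
        also have "\<dots> \<le> ?M * (1 + norm s)" using M0 by (intro mult_left_mono) auto
        finally show ?thesis .
      qed
      ultimately have le: "max (norm (num_of nm dn i z)) (norm (den_of dn i z)) \<le> ?M * (1 + norm s)" by simp
      have pos: "0 < ?M" using cop[of b z] by (auto simp: less_max_iff_disj)
      have s1: "0 < 1 + norm s" by (simp add: add_pos_nonneg)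
      have "log_max (num_of nm dn i) (den_of dn i) z \<le> ln (?M * (1 + norm s))"
        unfolding log_max_def using le nz[OF z] pos s1 by (subst ln_le_cancel_iff) (auto simp: less_max_iff_disj)
      also have "\<dots> = ?m b z + ln (1 + norm s)" unfolding log_max_def using pos s1 by (rule ln_mult_pos)
      finally show "log_max (num_of nm dn i) (den_of dn i) z \<le> ?m b z + ln (1 + norm s)" .
    qed (use \<rho> in \<open>auto intro!: contm continuous_intros\<close>)
    also have "\<dots> = \<mu> b \<rho> + ln (1 + norm s)" using \<rho> by (subst circle_mean_add) (auto intro!: contm simp: \<mu>_def)
    also have "\<dots> \<le> T \<rho>" using T_ge[OF \<rho>(1) i'(2), of b] by simp
    also have "\<dots> \<le> T R" using mono \<rho> by blast
    finally show ?thesis .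
  qed
  have r4: "0 \<le> r + 4 * \<delta>" using r by simp
  obtain \<rho>2 where \<rho>2: "r + 4 * \<delta> < \<rho>2" "\<rho>2 < r + 4 * \<delta> + \<delta>" "\<rho>2 \<notin> D1"
    and ld1: "\<And>i z. i \<in> I \<Longrightarrow> norm z = \<rho>2 \<Longrightarrow> num_of nm dn i z \<noteq> 0 \<and> den_of dn i z \<noteq> 0 \<and>
       norm (deriv (num_of nm dn i) z / num_of nm dn i z - deriv (den_of dn i) z / den_of dn i z)
        \<le> (7 + 4 * real (card I)) * (2 * (T R + c) * ((r + 4 * \<delta>) + 5 * \<delta>) / \<delta>)\<^sup>2 / \<delta>"
  proof (rule circle_with_small_log_derivs[OF finI D1 r4 r(2), of "num_of nm dn" "den_of dn" c "T R" R3])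
    show "num_of nm dn i holomorphic_on UNIV \<and> den_of dn i holomorphic_on UNIV \<and> num_of nm dn i 0 \<noteq> 0 \<and> den_of dn i 0 \<noteq> 0" if "i \<in> I" for i
      using that IJ at0(2) holp by blast
    show "num_of nm dn i z \<noteq> 0 \<and> den_of dn i z \<noteq> 0" if "i \<in> I" "norm z = R3" for i z using that R3(3) nzJ[of z i] IJ by blast
    show "circle_mean (log_max (num_of nm dn i) (den_of dn i)) R3 \<le> T R" if "i \<in> I" for i
      using that R3 r by (intro meanI) auto
  qed (use c IJ c0 TR R3 in \<open>auto simp: R_def\<close>)
  have L1: "2 * (T R + c) * ((r + 4 * \<delta>) + 5 * \<delta>) / \<delta> \<le> 2 * (1 + c) * x"
  proof -
    have "T R + c \<le> (1 + c) * T R" using TR c0 mult_left_mono[of 1 "T R" c] by (simp add: algebra_simps)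
    hence "2 * (T R + c) * R / \<delta> \<le> 2 * ((1 + c) * T R) * R / \<delta>" using R0 r by (intro divide_right_mono mult_right_mono) auto
    thus ?thesis by (simp add: x_def R_def algebra_simps)
  qed
  have bd1: "norm (logderiv_of nm dn i z) \<le> k1 * x\<^sup>2 / \<delta>" if "i \<in> I" "norm z = \<rho>2" for i z
  proof -
    have "(7 + 4 * real (card I)) * (2 * (T R + c) * ((r + 4 * \<delta>) + 5 * \<delta>) / \<delta>)\<^sup>2 / \<delta>
       \<le> (7 + 4 * real (card I)) * (2 * (1 + c) * x)\<^sup>2 / \<delta>"
      using L1 r TR c0 by (intro divide_right_mono mult_left_mono power_mono) auto
    also have "\<dots> = k1 * x\<^sup>2 / \<delta>" by (simp add: k1_def power_mult_distrib)
    finally show ?thesis using ld1[OF that] by (auto simp: logderiv_of_def)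
  qed
  \<comment> \<open>\<open>V2\<close> bounds the characteristics of the derivatives on the first circle: \<open>T R\<close> twice for the
      squared denominator, and the bound \<open>bd1\<close> for the factor \<open>q'/q\<close>.\<close>
  define V2 where "V2 = (2 + k1) * (T R * (1 + x\<^sup>2 / \<delta>))"
  have xd: "0 \<le> x\<^sup>2 / \<delta>" using r by simp
  have T_le: "T R \<le> T R * (1 + x\<^sup>2 / \<delta>)" using TR xd mult_left_mono[of 1 "1 + x\<^sup>2 / \<delta>" "T R"] by simp
  have V2_ge: "T R \<le> V2" "2 * T R + k1 * x\<^sup>2 / \<delta> \<le> V2"
  proof -
    have "k1 * (x\<^sup>2 / \<delta>) \<le> k1 * (T R * (1 + x\<^sup>2 / \<delta>))"
      using kpos TR xd mult_mono[of 1 "T R" "x\<^sup>2 / \<delta>" "1 + x\<^sup>2 / \<delta>"] by (intro mult_left_mono) auto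
    thus b: "2 * T R + k1 * x\<^sup>2 / \<delta> \<le> V2" using T_le
      unfolding V2_def distrib_right[of _ _ "T R * (1 + x\<^sup>2 / \<delta>)"] by simp
    have "0 \<le> k1 * x\<^sup>2 / \<delta>" using kpos r by simp
    thus "T R \<le> V2" using b TR by linarith
  qed
  have \<rho>2': "0 \<le> \<rho>2" "\<rho>2 \<le> R" using \<rho>2 r by (auto simp: R_def)
  have meanJ: "circle_mean (log_max (num_of nm dn i) (den_of dn i)) \<rho>2 \<le> V2" if i: "i \<in> J" for i
  proof (cases "i \<in> I")
    case True
    from meanI[OF this \<rho>2' \<rho>2(3)] V2_ge show ?thesis by linarith
  next
    case False
    then obtain b where b: "i = (b, None)" using i by (auto simp: I_def J_def)
    have i0: "(b, Some 0) \<in> I" using S by (auto simp: I_def)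
    let ?B = "k1 * x\<^sup>2 / \<delta>"
    have B0: "0 \<le> ?B" using kpos r by simp
    have nz: "num_of nm dn i z \<noteq> 0 \<and> den_of dn i z \<noteq> 0" if "norm z = \<rho>2" for z using nzJ[of z i] that \<rho>2(3) i by auto
    have "circle_mean (log_max (num_of nm dn i) (den_of dn i)) \<rho>2 \<le> circle_mean (\<lambda>z. 2 * ?m b z + ?B) \<rho>2"
    proof (rule circle_mean_mono)
      show "continuous_on (sphere 0 \<rho>2) (log_max (num_of nm dn i) (den_of dn i))"
        by (intro continuous_on_log_max contp) (use nz in auto)
      fix z :: complex assume z: "norm z = \<rho>2"
      let ?M = "max (norm (nm b z)) (norm (dn b z))"
      have M0: "0 \<le> ?M" by (simp add: le_max_iff_disj)
      have nz0: "nm b z \<noteq> 0" "dn b z \<noteq> 0" using nzJ[of z "(b, Some 0)"] i0 IJ z \<rho>2(3) by auto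
      have "num_of nm dn (b, Some 0) = nm b" "den_of dn (b, Some 0) = dn b" by (rule ext, simp)+
      hence "norm (deriv (nm b) z / nm b z - deriv (dn b) z / dn b z) \<le> ?B"
        using bd1[OF i0 z] by (simp add: logderiv_of_def)
      hence "norm (nm b z) * norm (dn b z) * norm (deriv (nm b) z / nm b z - deriv (dn b) z / dn b z) \<le> ?M * ?M * ?B"
        using M0 by (intro mult_mono mult_nonneg_nonneg) auto
      moreover have "num_of nm dn i z = nm b z * dn b z * (deriv (nm b) z / nm b z - deriv (dn b) z / dn b z)"
        unfolding b using nz0 by (simp add: field_simps)
      ultimately have "norm (num_of nm dn i z) \<le> ?M * ?M * ?B" by (simp add: norm_mult)
      also have "\<dots> \<le> ?M * ?M * (1 + ?B)" by (intro mult_left_mono) auto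
      finally have 1: "norm (num_of nm dn i z) \<le> ?M * ?M * (1 + ?B)" .
      have "norm (den_of dn i z) \<le> ?M * ?M * 1" unfolding b using M0 by (simp add: power2_eq_square norm_mult mult_mono del: le_max_iff_disj)
      also have "\<dots> \<le> ?M * ?M * (1 + ?B)" using B0 by (intro mult_left_mono) auto
      finally have le: "max (norm (num_of nm dn i z)) (norm (den_of dn i z)) \<le> ?M * ?M * (1 + ?B)" using 1 by simp
      have pos: "0 < ?M" using nz0 by (auto simp: less_max_iff_disj)
      have B1: "0 < 1 + ?B" using B0 by linarith
      have "log_max (num_of nm dn i) (den_of dn i) z \<le> ln (?M * ?M * (1 + ?B))"
        unfolding log_max_def using le nz[OF z] pos B1 by (subst ln_le_cancel_iff) (auto simp: less_max_iff_disj simp del: max_less_iff_conj intro!: mult_pos_pos)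
      also have "\<dots> = 2 * ?m b z + ln (1 + ?B)"
        unfolding log_max_def using pos B1 by (subst ln_mult_pos, simp, simp, subst ln_mult_pos) auto
      also have "\<dots> \<le> 2 * ?m b z + ?B" using ln_add_one_self_le_self[OF B0] by simp
      finally show "log_max (num_of nm dn i) (den_of dn i) z \<le> 2 * ?m b z + ?B" .
    qed (use \<rho>2' in \<open>auto intro!: contm continuous_intros\<close>)
    also have "\<dots> = 2 * \<mu> b \<rho>2 + ?B"
      using \<rho>2' by (subst circle_mean_add) (auto intro!: contm continuous_intros simp: \<mu>_def circle_mean_cmult)
    also have "\<dots> \<le> 2 * T R + ?B"
      using T_ge[OF \<rho>2'(1) S(2), of b] mono[OF \<rho>2'] by simp
    finally show ?thesis using V2_ge by linarith
  qed
  obtain \<rho> where \<rho>: "r < \<rho>" "\<rho> < r + \<delta>" "\<rho> \<notin> D1"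
    and ld2: "\<And>i z. i \<in> J \<Longrightarrow> norm z = \<rho> \<Longrightarrow> num_of nm dn i z \<noteq> 0 \<and> den_of dn i z \<noteq> 0 \<and>
       norm (deriv (num_of nm dn i) z / num_of nm dn i z - deriv (den_of dn i) z / den_of dn i z)
        \<le> (7 + 4 * real (card J)) * (2 * (V2 + c) * (r + 5 * \<delta>) / \<delta>)\<^sup>2 / \<delta>"
  proof (rule circle_with_small_log_derivs[OF finJ D1 r, of "num_of nm dn" "den_of dn" c V2 \<rho>2])
    show "num_of nm dn i holomorphic_on UNIV \<and> den_of dn i holomorphic_on UNIV \<and> num_of nm dn i 0 \<noteq> 0 \<and> den_of dn i 0 \<noteq> 0" if "i \<in> J" for i
      using that at0(2) holp by blast
    show "num_of nm dn i z \<noteq> 0 \<and> den_of dn i z \<noteq> 0" if "i \<in> J" "norm z = \<rho>2" for i z using that \<rho>2(3) nzJ[of z i] by blast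
  qed (use c c0 TR V2_ge \<rho>2 meanJ in auto)
  have V20: "0 \<le> V2" using V2_ge TR by linarith
  have L2: "2 * (V2 + c) * (r + 5 * \<delta>) / \<delta> \<le> 2 * (2 + k1 + c) * y"
  proof -
    have "c * 1 \<le> c * (T R * (1 + x\<^sup>2 / \<delta>))" using order.trans[OF TR T_le] c0 by (rule mult_left_mono)
    hence "V2 + c \<le> (2 + k1 + c) * (T R * (1 + x\<^sup>2 / \<delta>))"
      unfolding V2_def distrib_right[of _ _ "T R * (1 + x\<^sup>2 / \<delta>)"] by simp
    hence "2 * (V2 + c) * (r + 5 * \<delta>) / \<delta> \<le> 2 * ((2 + k1 + c) * (T R * (1 + x\<^sup>2 / \<delta>))) * R / \<delta>"
      using R0 r V20 c0 by (intro divide_right_mono mult_mono) (auto simp: R_def)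
    also have "\<dots> = 2 * (2 + k1 + c) * y" by (simp add: x_def y_def)
    finally show ?thesis .
  qed
  have bd2: "norm (logderiv_of nm dn i z) \<le> k2 * y\<^sup>2 / \<delta>" if "i \<in> J" "norm z = \<rho>" for i z
  proof -
    have "(7 + 4 * real (card J)) * (2 * (V2 + c) * (r + 5 * \<delta>) / \<delta>)\<^sup>2 / \<delta>
       \<le> (7 + 4 * real (card J)) * (2 * (2 + k1 + c) * y)\<^sup>2 / \<delta>"
      using L2 r V20 c0 by (intro divide_right_mono mult_left_mono power_mono) auto
    also have "\<dots> = k2 * y\<^sup>2 / \<delta>" by (simp add: k2_def power_mult_distrib)
    finally show ?thesis using ld2[OF that] by (auto simp: logderiv_of_def)
  qed
  have \<rho>0: "0 \<le> \<rho>" using \<rho> r by simp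
  have nzY: "Y z \<noteq> 0" if "norm z = \<rho>" for z using that \<rho>(3) by (auto simp: D1_def)
  have contlY: "continuous_on (sphere 0 \<rho>) (log_max Y Y)" by (intro continuous_on_log_max contY) (use nzY in auto)
  let ?E = "ln C + real N * ln (1 + K * y\<^sup>2 / \<delta>)"
  have yd: "0 \<le> y\<^sup>2 / \<delta>" using r by simp
  have "circle_mean (\<lambda>z. log_max Y Y z + (?m True z + ?m False z)) \<rho> \<le> circle_mean (\<lambda>z. ?E) \<rho>"
  proof (rule circle_mean_mono)
    fix z :: complex assume z: "norm z = \<rho>"
    let ?M = "\<lambda>b. max (norm (nm b z)) (norm (dn b z))"
    have pos: "0 < ?M b" for b using cop[of b z] by (auto simp: less_max_iff_disj)
    have Yz: "0 < norm (Y z)" using nzY[OF z] by simp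
    have "(\<Sum>i\<in>J. norm (logderiv_of nm dn i z)) \<le> (\<Sum>i\<in>J. k2 * y\<^sup>2 / \<delta>)" using bd2 z by (intro sum_mono) auto
    also have "\<dots> = (card J * k2) * (y\<^sup>2 / \<delta>)" by simp
    also have "\<dots> \<le> K * (y\<^sup>2 / \<delta>)" using Kpos yd by (intro mult_right_mono) auto
    finally have sum: "(\<Sum>i\<in>J. norm (logderiv_of nm dn i z)) \<le> K * y\<^sup>2 / \<delta>" by simp
    have sum0: "0 \<le> (\<Sum>i\<in>J. norm (logderiv_of nm dn i z))" by (intro sum_nonneg) auto
    let ?S = "1 + (\<Sum>i\<in>J. norm (logderiv_of nm dn i z))"
    have "\<rho> \<notin> D" using \<rho>(3) by (auto simp: D1_def)
    hence b: "norm (Y z) * (?M True * ?M False) \<le> C * ?S ^ N"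
      using bound[of z] z by (simp add: UNIV_bool mult_ac)
    have lhs: "0 < norm (Y z) * (?M True * ?M False)" using pos Yz by (intro mult_pos_pos) auto
    have S1: "0 < ?S" using sum0 by linarith
    have Cp: "0 < C" using b lhs S1 by (smt (verit) zero_less_mult_iff zero_less_power mult_nonpos_nonneg)
    have "log_max Y Y z + (?m True z + ?m False z) = ln (norm (Y z) * (?M True * ?M False))"
      using pos Yz by (simp add: log_max_def ln_mult_pos[OF Yz] ln_mult_pos[OF pos pos] mult_pos_pos[OF pos pos] del: max_less_iff_conj)
    also have "\<dots> \<le> ln (C * ?S ^ N)" using b lhs by (subst ln_le_cancel_iff) auto
    also have "\<dots> = ln C + real N * ln ?S" using Cp S1 by (simp add: ln_mult_pos ln_realpow)
    also have "\<dots> \<le> ?E" using sum S1 by (intro add_left_mono mult_left_mono) (auto simp: ln_le_cancel_iff)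
    finally show "log_max Y Y z + (?m True z + ?m False z) \<le> ?E" .
  qed (use \<rho>0 in \<open>auto intro!: contlY contm continuous_intros\<close>)
  moreover have "circle_mean (\<lambda>z. log_max Y Y z + (?m True z + ?m False z)) \<rho> = circle_mean (log_max Y Y) \<rho> + (\<mu> True \<rho> + \<mu> False \<rho>)"
    using \<rho>0 contlY contm unfolding \<mu>_def by (subst circle_mean_add, simp, intro continuous_intros contm, simp, subst circle_mean_add) (auto intro!: contm)
  moreover have "ln (norm (Y 0)) \<le> circle_mean (log_max Y Y) \<rho>" using hol(3) at0(1) \<rho>0 nzY by (rule circle_mean_ln_norm_ge)
  moreover have "\<mu> True \<rho> + \<mu> False \<rho> = T \<rho> - c0" by (simp add: T_def UNIV_bool)
  moreover have "T r \<le> T \<rho>" using mono r \<rho> by simp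
  ultimately have "T r \<le> ?E + c0 - ln (norm (Y 0))" by simp
  also have "\<dots> \<le> K + real N * ln (1 + K * y\<^sup>2 / \<delta>)" using Kpos(4) by (simp add: abs_le_iff)
  also have "\<dots> \<le> K + K * ln (1 + K * y\<^sup>2 / \<delta>)"
    using Kpos yd mult_nonneg_nonneg[OF Kpos(1) yd] by (intro add_left_mono mult_right_mono) auto
  finally show False using gr by simp
qed

section \<open>The vanishing principle for meromorphic functions\<close>

definition logderiv_sum :: "complex set \<Rightarrow> (complex \<Rightarrow> complex) \<Rightarrow> complex \<Rightarrow> real" where
  "logderiv_sum S f z = (\<Sum>s\<in>S. norm (deriv f z / (f z - s))) + norm (deriv (deriv f) z / deriv f z)"

lemma logderiv_sum_nonneg: "0 \<le> logderiv_sum S f z"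
  unfolding logderiv_sum_def by (intro add_nonneg_nonneg sum_nonneg) auto

lemma logderiv_sum_mono: "finite S \<Longrightarrow> S' \<subseteq> S \<Longrightarrow> logderiv_sum S' f z \<le> logderiv_sum S f z"
  unfolding logderiv_sum_def by (intro add_right_mono sum_mono2) auto

lemma deriv_translate: "deriv (\<lambda>w. \<phi> (\<xi> + w)) z = deriv \<phi> (\<xi> + z)" for \<phi> :: "complex \<Rightarrow> complex"
  using deriv_shift_0[of "\<lambda>w. \<phi> (\<xi> + w)" z] deriv_shift_0[of \<phi> "\<xi> + z"] by (simp add: o_def add.assoc)

lemma logderiv_quotient:
  fixes p u q :: "complex \<Rightarrow> complex"
  assumes "open U" "z \<in> U" "\<And>w. w \<in> U \<Longrightarrow> p w = u w * q w" "u holomorphic_on U" "q holomorphic_on U" "u z \<noteq> 0" "q z \<noteq> 0"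
  shows "deriv p z / p z - deriv q z / q z = deriv u z / u z"
proof -
  have "(u has_field_derivative deriv u z) (at z)" "(q has_field_derivative deriv q z) (at z)"
    using assms by (auto intro: holomorphic_derivI)
  hence "((\<lambda>w. u w * q w) has_field_derivative deriv u z * q z + deriv q z * u z) (at z)" by (rule DERIV_mult)
  hence "(p has_field_derivative deriv u z * q z + deriv q z * u z) (at z)"
    by (rule has_field_derivative_transform_within_open[of _ _ _ U]) (use assms in auto)
  hence "deriv p z = deriv u z * q z + deriv q z * u z" by (rule DERIV_imp_deriv)
  thus ?thesis using assms by (simp add: field_simps)
qed

lemma meromorphic_quotient_of_entire:
  assumes "f nicely_meromorphic_on UNIV"
  obtains n d where "n holomorphic_on UNIV" "d holomorphic_on UNIV" "\<And>z. f z = n z / d z"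
    "\<And>z. d z = 0 \<longleftrightarrow> is_pole f z" "\<And>z. n z \<noteq> 0 \<or> d z \<noteq> 0"
proof -
  obtain h f1 f2 where H:
    "h holomorphic_on UNIV" "f1 holomorphic_on UNIV" "f2 holomorphic_on UNIV"
    "\<forall>z. f1 z = 0 \<longleftrightarrow> \<not>is_pole f z \<and> f z = 0"
    "\<forall>z. f2 z = 0 \<longleftrightarrow> is_pole f z"
    "\<forall>z. \<not>is_pole f z \<longrightarrow> zorder f1 z = zorder f z"
    "\<forall>z. is_pole f z \<longrightarrow> zorder f2 z = -zorder f z"
    "\<forall>z. h z \<noteq> 0"
    "\<forall>z. f z = h z * f1 z / f2 z"
    using weierstrass_factorization_meromorphic_UNIV[OF assms] .
  show ?thesis
    by (rule that[of "\<lambda>z. h z * f1 z" f2]) (use H in \<open>auto intro!: holomorphic_intros\<close>)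
qed

lemma not_cosparse_False: "\<not> (\<forall>\<^sub>\<approx>z\<in>(UNIV::complex set). False)"
proof
  assume "\<forall>\<^sub>\<approx>z\<in>(UNIV::complex set). False"
  hence "(UNIV :: complex set) sparse_in UNIV" by (simp add: eventually_cosparse)
  from sparse_imp_countable[OF open_UNIV this] have "countable (UNIV :: complex set)" by simp
  thus False using uncountable_ball[of 1 "0 :: complex"] countable_subset[of "ball (0::complex) 1" UNIV] by simp
qed

lemma deriv_nonzero_cosparse:
  assumes f: "f nicely_meromorphic_on UNIV" and nc: "\<not> f constant_on UNIV"
  shows "\<forall>\<^sub>\<approx>z\<in>UNIV. deriv f z \<noteq> 0"
proof (rule ccontr)
  assume "\<not> ?thesis"
  moreover have mero: "f meromorphic_on UNIV" using f by (simp add: nicely_meromorphic_on_def)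
  ultimately have zero: "\<forall>\<^sub>\<approx>z\<in>UNIV. deriv f z = 0"
    using meromorphic_imp_constant_or_avoid[of "deriv f" UNIV 0] by (auto intro: meromorphic_intros)
  obtain n d where nd: "n holomorphic_on UNIV" "d holomorphic_on UNIV" "\<And>z. f z = n z / d z"
    "\<And>z. d z = 0 \<longleftrightarrow> is_pole f z" using meromorphic_quotient_of_entire[OF f] by metis
  let ?W = "\<lambda>z. deriv n z * d z - n z * deriv d z"
  have feq: "f = (\<lambda>z. n z / d z)" using nd(3) by blast
  have derivf: "(f has_field_derivative ?W z / (d z)\<^sup>2) (at z)" if "d z \<noteq> 0" for z
  proof -
    have "((\<lambda>z. n z / d z) has_field_derivative ?W z / (d z * d z)) (at z)"
      by (rule DERIV_divide) (use that nd(1,2) in \<open>auto intro: holomorphic_derivI\<close>)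
    thus ?thesis using feq by (simp add: power2_eq_square)
  qed
  have W0: "?W z0 = 0" for z0
  proof (rule ccontr)
    assume "?W z0 \<noteq> 0"
    moreover have "?W holomorphic_on UNIV" by (intro holomorphic_intros nd) auto
    ultimately have "\<forall>\<^sub>\<approx>z\<in>UNIV. ?W z \<noteq> 0" using entire_avoids_zero_cosparse by blast
    with zero meromorphic_on_imp_not_pole_cosparse[OF mero] have "\<forall>\<^sub>\<approx>z\<in>(UNIV::complex set). False"
      by eventually_elim (use derivf DERIV_imp_deriv nd(4) in fastforce)
    thus False using not_cosparse_False by blast
  qed
  have "\<not> (\<forall>z. d z = 0)"
  proof
    assume "\<forall>z. d z = 0"
    hence "\<And>z. f z = 0" by (simp add: nd(3))
    thus False using nc by (auto simp: constant_on_def)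
  qed
  then obtain z0 where z0: "d z0 \<noteq> 0" by blast
  have "open {z. d z \<noteq> 0}"
    by (intro open_Collect_neq continuous_intros holomorphic_on_imp_continuous_on nd(2))
  then obtain e where e: "e > 0" "ball z0 e \<subseteq> {z. d z \<noteq> 0}" using z0 by (metis (mono_tags) mem_Collect_eq open_contains_ball)
  have "\<exists>c. \<forall>x\<in>ball z0 e. f x = c"
  proof (rule has_field_derivative_zero_constant)
    fix x assume "x \<in> ball z0 e"
    hence "(f has_field_derivative 0) (at x)" using derivf[of x] W0[of x] e by auto
    thus "(f has_field_derivative 0) (at x within ball z0 e)" by (simp add: has_field_derivative_at_within)
  qed auto
  hence "f constant_on ball z0 e" by (auto simp: constant_on_def)
  hence "f constant_on UNIV"
    by (rule constant_on_extend_nicely_meromorphic_on[OF f]) (use e in auto)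
  thus False using nc by blast
qed

lemma avoids_value_cosparse:
  assumes "f nicely_meromorphic_on UNIV" "\<not> f constant_on UNIV"
  shows "\<forall>\<^sub>\<approx>z\<in>UNIV. f z \<noteq> s"
  using nicely_meromorphic_imp_constant_or_avoid[OF assms(1), of s] assms(2) by (auto simp: constant_on_def)

lemma pole_large:
  fixes f :: "complex \<Rightarrow> complex"
  assumes "is_pole f z"
  shows "\<forall>\<^sub>F w in at z. M \<le> norm (f w)"
proof -
  have "filterlim (\<lambda>w. norm (f w)) at_top (at z)"
    using assms unfolding is_pole_def by (simp add: filterlim_at_infinity_imp_norm_at_top)
  thus ?thesis by (simp add: filterlim_at_top)
qed

lemma bounded_not_pole:
  fixes f :: "complex \<Rightarrow> complex"
  assumes "\<forall>\<^sub>F w in at z. norm (f w) \<le> M"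
  shows "\<not> is_pole f z"
proof
  assume "is_pole f z"
  hence "\<forall>\<^sub>F w in at z. M + 1 \<le> norm (f w)" by (rule pole_large)
  with assms have "\<forall>\<^sub>F w in at z. False" by eventually_elim auto
  thus False by simp
qed

text \<open>
  This is Riemann's theorem on removable singularities, in the form needed for a function that is already known to be meromorphic.
\<close>

lemma remove_sings_entire_if_bounded:
  assumes mero: "h meromorphic_on UNIV"
    and bdd: "\<And>z. \<exists>K. \<forall>\<^sub>F w in at z. norm (h w) \<le> K"
  shows "remove_sings h holomorphic_on UNIV"
proof -
  have "remove_sings h analytic_on {z}" for z
  proof -
    obtain K where K: "\<forall>\<^sub>F w in at z. norm (h w) \<le> K" using bdd by blast
    have ne: "not_essential h z" "isolated_singularity_at h z"
      using mero by (auto intro: meromorphic_on_not_essential meromorphic_on_isolated_singularity meromorphic_on_subset)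
    have "\<not> is_pole h z" using K by (rule bounded_not_pole)
    then obtain c where "h \<midarrow>z\<rightarrow> c" using ne by (auto simp: not_essential_def)
    thus ?thesis using ne by (intro remove_sings_analytic_at) auto
  qed
  hence "remove_sings h analytic_on UNIV" using analytic_on_analytic_at by blast
  thus ?thesis by (simp add: analytic_on_open)
qed

text \<open>
  The product \<open>(1 + |f|) (1 + |g|)\<close> is comparable with
  \<open>max(|n1|,|d1|) max(|n2|,|d2|) / |d1 d2|\<close> when \<open>f = n1/d1\<close> and \<open>g = n2/d2\<close> without common zeros. So the first bound says that
  \<open>h / (d1 * d2)\<close> is entire, and the second is the hypothesis of \<open>no_small_entire_function\<close> for this entire function, up to
  the finitely many functions that are required not to vanish at the origin; this is achieved by a translation.
\<close>

theorem small_meromorphic_function_vanishes: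
  fixes f g h :: "complex \<Rightarrow> complex" and S :: "complex set"
  assumes f: "f nicely_meromorphic_on UNIV" "\<not> f constant_on UNIV"
    and g: "g nicely_meromorphic_on UNIV" "\<not> g constant_on UNIV"
    and h: "h meromorphic_on UNIV" and S: "finite S"
    and bdd: "\<And>z. \<exists>K. \<forall>\<^sub>F w in at z. norm (h w) * ((1 + norm (f w)) * (1 + norm (g w))) \<le> K"
    and small: "\<forall>\<^sub>\<approx>z\<in>UNIV. norm (h z) * ((1 + norm (f z)) * (1 + norm (g z))) \<le> C * (1 + logderiv_sum S f z + logderiv_sum S g z) ^ N"
  shows "\<forall>\<^sub>\<approx>z\<in>UNIV. h z = 0"
proof (rule ccontr)
  assume "\<not> ?thesis"
  hence hnz: "\<forall>\<^sub>\<approx>z\<in>UNIV. h z \<noteq> 0"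
    using meromorphic_imp_constant_or_avoid[OF h, of 0] by auto
  define F where "F = (\<lambda>b. if b then f else g)"
  have F: "F b nicely_meromorphic_on UNIV" "\<not> F b constant_on UNIV" for b using f g by (auto simp: F_def)
  have "\<exists>n d. n holomorphic_on UNIV \<and> d holomorphic_on UNIV \<and> (\<forall>z. F b z = n z / d z) \<and>
     (\<forall>z. d z = 0 \<longleftrightarrow> is_pole (F b) z) \<and> (\<forall>z. n z \<noteq> 0 \<or> d z \<noteq> 0)" for b
    using meromorphic_quotient_of_entire[OF F(1)[of b]] by metis
  then obtain nm dn where nd: "\<And>b. nm b holomorphic_on UNIV" "\<And>b. dn b holomorphic_on UNIV" "\<And>b z. F b z = nm b z / dn b z"
     "\<And>b z. dn b z = 0 \<longleftrightarrow> is_pole (F b) z" "\<And>b z. nm b z \<noteq> 0 \<or> dn b z \<noteq> 0"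
    by metis
  define S' where "S' = insert 0 S"
  have S': "finite S'" "0 \<in> S'" "S \<subseteq> S'" using S by (auto simp: S'_def)
  define J where "J = (UNIV :: bool set) \<times> insert None (Some ` S')"
  have finJ: "finite J" using S' by (auto simp: J_def)
  have contd: "isCont (dn b) z" and contn: "isCont (nm b) z" for b z
    by (meson UNIV_I continuous_on_eq_continuous_at holomorphic_on_imp_continuous_on nd(1,2) open_UNIV)+
  define Y0 where "Y0 = (\<lambda>z. h z / (dn True z * dn False z))"
  have merod: "dn b meromorphic_on UNIV" for b
    using nd(2) by (simp add: analytic_on_imp_meromorphic_on analytic_on_open)
  have meroY0: "Y0 meromorphic_on UNIV" unfolding Y0_def by (intro meromorphic_intros h merod)
  define Y where "Y = remove_sings Y0"
  \<comment> \<open>\<open>|n| + |d|\<close> is bounded below near every point, since \<open>n\<close> and \<open>d\<close> have no common zero, and it equals \<open>|d| (1 + |n/d|)\<close>.\<close>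
  have dn_bound: "\<exists>m>0. \<forall>\<^sub>F w in at z. norm (1 / dn b w) \<le> (1 + norm (F b w)) / m" for b z
  proof -
    define \<phi> where "\<phi> = (\<lambda>w. norm (nm b w) + norm (dn b w))"
    have "0 < \<phi> z" using nd(5)[of b z] by (auto simp: \<phi>_def add_pos_nonneg add_nonneg_pos)
    moreover have "\<phi> \<midarrow>z\<rightarrow> \<phi> z" unfolding \<phi>_def using contd[of z b] contn[of z b] by (intro tendsto_intros) (auto simp: isCont_def)
    ultimately have "\<forall>\<^sub>F w in at z. \<phi> z / 2 < \<phi> w" by (intro order_tendstoD(1)) auto
    hence "\<forall>\<^sub>F w in at z. norm (1 / dn b w) \<le> (1 + norm (F b w)) / (\<phi> z / 2)"
    proof eventually_elim
      case (elim w)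
      show ?case
      proof (cases "dn b w = 0")
        case False
        have "\<phi> w = norm (dn b w) * (1 + norm (F b w))" using False by (simp add: \<phi>_def nd(3) norm_divide field_simps)
        hence "\<phi> z / 2 \<le> norm (dn b w) * (1 + norm (F b w))" using elim by linarith
        thus ?thesis using False \<open>0 < \<phi> z\<close> by (simp add: norm_divide field_simps)
      qed (use \<open>0 < \<phi> z\<close> in auto)
    qed
    thus ?thesis using \<open>0 < \<phi> z\<close> by (intro exI[of _ "\<phi> z / 2"]) auto
  qed
  have "\<exists>K. \<forall>\<^sub>F w in at z. norm (Y0 w) \<le> K" for z
  proof -
    obtain K where K: "\<forall>\<^sub>F w in at z. norm (h w) * ((1 + norm (f w)) * (1 + norm (g w))) \<le> K" using bdd by blast
    obtain m1 where m1: "m1 > 0" "\<forall>\<^sub>F w in at z. norm (1 / dn True w) \<le> (1 + norm (F True w)) / m1" using dn_bound by blast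
    obtain m2 where m2: "m2 > 0" "\<forall>\<^sub>F w in at z. norm (1 / dn False w) \<le> (1 + norm (F False w)) / m2" using dn_bound by blast
    from K m1(2) m2(2) have "\<forall>\<^sub>F w in at z. norm (Y0 w) \<le> K / (m1 * m2)"
    proof eventually_elim
      case (elim w)
      have "norm (Y0 w) = norm (h w) * (norm (1 / dn True w) * norm (1 / dn False w))"
        by (simp add: Y0_def norm_divide norm_mult)
      also have "\<dots> \<le> norm (h w) * ((1 + norm (F True w)) / m1 * ((1 + norm (F False w)) / m2))"
        using elim m1(1) by (intro mult_left_mono mult_mono) auto
      also have "\<dots> = norm (h w) * ((1 + norm (f w)) * (1 + norm (g w))) / (m1 * m2)" by (simp add: F_def)
      also have "\<dots> \<le> K / (m1 * m2)" using elim m1(1) m2(1) by (intro divide_right_mono) auto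
      finally show ?case .
    qed
    thus ?thesis by blast
  qed
  hence holY: "Y holomorphic_on UNIV" unfolding Y_def by (intro remove_sings_entire_if_bounded meroY0)
  have dn_cs: "\<forall>\<^sub>\<approx>z\<in>UNIV. dn b z \<noteq> 0" for b
  proof -
    have "F b meromorphic_on UNIV" using F(1) by (simp add: nicely_meromorphic_on_def)
    from meromorphic_on_imp_not_pole_cosparse[OF this] show ?thesis by (simp add: nd(4))
  qed
  have num_cs: "\<forall>\<^sub>\<approx>z\<in>UNIV. num_of nm dn (b, Some s) z \<noteq> 0" for b s
  proof -
    have "\<forall>\<^sub>\<approx>z\<in>UNIV. F b z \<noteq> s"
      by (rule avoids_value_cosparse[OF F])
    with dn_cs[of b] show ?thesis by eventually_elim (auto simp: nd(3) field_simps)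
  qed
  have Fhol: "F b holomorphic_on {z. dn b z \<noteq> 0}" for b
  proof -
    have "(\<lambda>z. nm b z / dn b z) holomorphic_on {z. dn b z \<noteq> 0}"
      by (intro holomorphic_intros holomorphic_on_subset[OF nd(1)] holomorphic_on_subset[OF nd(2)]) auto
    moreover have "F b = (\<lambda>z. nm b z / dn b z)" using nd(3) by blast
    ultimately show ?thesis by simp
  qed
  have opend: "open {z. dn b z \<noteq> 0}" for b
    by (intro open_Collect_neq continuous_intros holomorphic_on_imp_continuous_on nd(2))
  have derivF: "deriv (F b) z = num_of nm dn (b, None) z / (dn b z)\<^sup>2" if "dn b z \<noteq> 0" for b z
  proof -
    have "((\<lambda>z. nm b z / dn b z) has_field_derivative (deriv (nm b) z * dn b z - nm b z * deriv (dn b) z) / (dn b z * dn b z)) (at z)"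
      by (rule DERIV_divide) (use that nd(1,2) in \<open>auto intro: holomorphic_derivI\<close>)
    moreover have "F b = (\<lambda>z. nm b z / dn b z)" using nd(3) by blast
    ultimately show ?thesis by (simp add: DERIV_imp_deriv power2_eq_square)
  qed
  have W_cs: "\<forall>\<^sub>\<approx>z\<in>UNIV. num_of nm dn (b, None) z \<noteq> 0" for b
    using deriv_nonzero_cosparse[OF F[of b]] dn_cs[of b] by eventually_elim (use derivF in auto)
  have "\<forall>\<^sub>\<approx>z\<in>UNIV. \<forall>i\<in>J. num_of nm dn i z \<noteq> 0 \<and> den_of dn i z \<noteq> 0"
  proof (intro eventually_ball_finite[OF finJ] ballI)
    fix i assume "i \<in> J"
    obtain b o' where i: "i = (b, o')" by (cases i)
    show "\<forall>\<^sub>\<approx>z\<in>UNIV. num_of nm dn i z \<noteq> 0 \<and> den_of dn i z \<noteq> 0"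
    proof (cases o')
      case None
      show ?thesis using W_cs[of b] dn_cs[of b] unfolding i None by eventually_elim simp
    next
      case (Some s)
      show ?thesis using num_cs[of b s] dn_cs[of b] unfolding i Some by eventually_elim simp
    qed
  qed
  with hnz small eventually_remove_sings_eq[OF meroY0] dn_cs[of True] dn_cs[of False]
  have "\<forall>\<^sub>\<approx>z\<in>UNIV. (\<forall>i\<in>J. num_of nm dn i z \<noteq> 0 \<and> den_of dn i z \<noteq> 0) \<and> h z \<noteq> 0 \<and> Y z = Y0 z \<and> dn True z \<noteq> 0 \<and> dn False z \<noteq> 0 \<and>
     norm (h z) * ((1 + norm (f z)) * (1 + norm (g z))) \<le> C * (1 + logderiv_sum S f z + logderiv_sum S g z) ^ N"
    unfolding Y_def by eventually_elim blast
  then obtain E where E: "E sparse_in UNIV" and gen: "\<And>z. z \<notin> E \<Longrightarrow> (\<forall>i\<in>J. num_of nm dn i z \<noteq> 0 \<and> den_of dn i z \<noteq> 0) \<and> h z \<noteq> 0 \<and> Y z = Y0 z \<and> dn True z \<noteq> 0 \<and> dn False z \<noteq> 0 \<and>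
     norm (h z) * ((1 + norm (f z)) * (1 + norm (g z))) \<le> C * (1 + logderiv_sum S f z + logderiv_sum S g z) ^ N"
    unfolding eventually_cosparse by blast
  have cE: "countable E" using sparse_imp_countable[OF open_UNIV E] by simp
  have "uncountable (ball (0::complex) 1)" by (rule uncountable_ball) simp
  hence "\<not> ball (0::complex) 1 \<subseteq> E" using cE countable_subset by metis
  then obtain \<xi> where \<xi>: "\<xi> \<notin> E" by blast
  \<comment> \<open>A point \<open>\<xi>\<close> at which nothing degenerates becomes the origin.\<close>
  define nm' dn' where "nm' = (\<lambda>b z. nm b (\<xi> + z))" and "dn' = (\<lambda>b z. dn b (\<xi> + z))"
  define Y' where "Y' = (\<lambda>z. Y (\<xi> + z))"
  define D where "D = norm ` ((\<lambda>z. z - \<xi>) ` E)"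
  have trans: "(\<lambda>z. \<phi> (\<xi> + z)) holomorphic_on UNIV" if "\<phi> holomorphic_on UNIV" for \<phi> :: "complex \<Rightarrow> complex"
  proof -
    have "\<phi> \<circ> (\<lambda>z. \<xi> + z) holomorphic_on UNIV"
      by (intro holomorphic_on_compose holomorphic_intros holomorphic_on_subset[OF that]) auto
    thus ?thesis by (simp add: o_def)
  qed
  have num_of': "num_of nm' dn' i = (\<lambda>z. num_of nm dn i (\<xi> + z))" for i
  proof (rule ext)
    fix z
    obtain b o' where i: "i = (b, o')" by (cases i)
    show "num_of nm' dn' i z = num_of nm dn i (\<xi> + z)"
      unfolding i nm'_def dn'_def by (cases o') (simp_all add: deriv_translate)
  qed
  have den_of': "den_of dn' i = (\<lambda>z. den_of dn i (\<xi> + z))" for i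
  proof (rule ext)
    fix z
    obtain b o' where i: "i = (b, o')" by (cases i)
    show "den_of dn' i z = den_of dn i (\<xi> + z)"
      unfolding i dn'_def by (cases o') simp_all
  qed
  have logderiv_of': "logderiv_of nm' dn' i z = logderiv_of nm dn i (\<xi> + z)" for i z
    unfolding logderiv_of_def num_of' den_of' by (simp add: deriv_translate)
  have logderiv_of_eq: "logderiv_of nm dn (b, None) z = deriv (deriv (F b)) z / deriv (F b) z"
     "logderiv_of nm dn (b, Some s) z = deriv (F b) z / (F b z - s)"
    if z: "\<forall>i\<in>J. num_of nm dn i z \<noteq> 0 \<and> den_of dn i z \<noteq> 0" "s \<in> S'" for b s z
  proof -
    let ?U = "{z. dn b z \<noteq> 0}"
    have n0: "num_of nm dn (b, None) z \<noteq> 0" and ns: "num_of nm dn (b, Some s) z \<noteq> 0" and d: "dn b z \<noteq> 0"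
      using z by (force simp: J_def)+
    have eqs: "den_of dn (b, None) = (\<lambda>z. (dn b z)\<^sup>2)" "den_of dn (b, Some s) = dn b" by auto
    show "logderiv_of nm dn (b, None) z = deriv (deriv (F b)) z / deriv (F b) z"
      unfolding logderiv_of_def
    proof (rule logderiv_quotient[OF opend[of b]])
      show "deriv (F b) holomorphic_on ?U" by (intro holomorphic_deriv Fhol opend)
      show "den_of dn (b, None) holomorphic_on ?U" unfolding eqs by (intro holomorphic_intros holomorphic_on_subset[OF nd(2)]) auto
    qed (use derivF n0 d in auto)
    have "deriv (\<lambda>w. F b w - s) z = deriv (F b) z"
      using Fhol[of b] opend[of b] d by (subst deriv_diff) (auto intro: holomorphic_on_imp_differentiable_at)
    moreover have "logderiv_of nm dn (b, Some s) z = deriv (\<lambda>w. F b w - s) z / (F b z - s)"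
      unfolding logderiv_of_def
    proof (rule logderiv_quotient[OF opend[of b], of z "num_of nm dn (b, Some s)" "\<lambda>w. F b w - s"])
      show "(\<lambda>w. F b w - s) holomorphic_on ?U" by (intro holomorphic_intros Fhol)
      show "den_of dn (b, Some s) holomorphic_on ?U" unfolding eqs by (intro holomorphic_intros holomorphic_on_subset[OF nd(2)]) auto
    qed (use ns d in \<open>auto simp: nd(3) field_simps\<close>)
    ultimately show "logderiv_of nm dn (b, Some s) z = deriv (F b) z / (F b z - s)" by simp
  qed
  have sum_logderiv_of: "(\<Sum>i\<in>J. norm (logderiv_of nm dn i z)) = logderiv_sum S' f z + logderiv_sum S' g z"
    if z: "\<forall>i\<in>J. num_of nm dn i z \<noteq> 0 \<and> den_of dn i z \<noteq> 0" for z
  proof -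
    have "(\<Sum>i\<in>J. norm (logderiv_of nm dn i z)) = (\<Sum>b\<in>UNIV. \<Sum>o'\<in>insert None (Some ` S'). norm (logderiv_of nm dn (b, o') z))"
      unfolding J_def by (simp add: sum.cartesian_product case_prod_beta)
    also have "\<dots> = (\<Sum>b\<in>UNIV. logderiv_sum S' (F b) z)"
    proof (rule sum.cong[OF refl])
      fix b
      have "(\<Sum>o'\<in>insert None (Some ` S'). norm (logderiv_of nm dn (b, o') z)) = norm (logderiv_of nm dn (b, None) z) + (\<Sum>s\<in>S'. norm (logderiv_of nm dn (b, Some s) z))"
        using S'(1) by (subst sum.insert) (auto simp: sum.reindex)
      also have "\<dots> = logderiv_sum S' (F b) z" using logderiv_of_eq[OF z] S'(2) by (simp add: logderiv_sum_def)
      finally show "(\<Sum>o'\<in>insert None (Some ` S'). norm (logderiv_of nm dn (b, o') z)) = logderiv_sum S' (F b) z" .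
    qed
    also have "\<dots> = logderiv_sum S' f z + logderiv_sum S' g z" by (simp add: UNIV_bool F_def)
    finally show ?thesis .
  qed
  show False
  proof (rule no_small_entire_function[OF S'(1,2), of D nm' dn' Y' "\<bar>C\<bar>" N])
    show "countable D" unfolding D_def using cE by simp
    show "nm' b holomorphic_on UNIV" "dn' b holomorphic_on UNIV" for b unfolding nm'_def dn'_def by (intro trans nd)+
    show "Y' holomorphic_on UNIV" unfolding Y'_def by (intro trans holY)
    show "nm' b z \<noteq> 0 \<or> dn' b z \<noteq> 0" for b z unfolding nm'_def dn'_def by (rule nd(5))
    show "Y' 0 \<noteq> 0" using gen[OF \<xi>] by (simp add: Y'_def Y0_def)
    show "num_of nm' dn' i 0 \<noteq> 0 \<and> den_of dn' i 0 \<noteq> 0" if "i \<in> UNIV \<times> insert None (Some ` S')" for i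
      using gen[OF \<xi>] that unfolding num_of' den_of' J_def by force
    fix z :: complex assume z: "norm z \<notin> D"
    define w where "w = \<xi> + z"
    have "w \<notin> E" using z by (force simp: D_def w_def)
    note G = gen[OF this]
    have mx: "max (norm (nm b w)) (norm (dn b w)) \<le> norm (dn b w) * (1 + norm (F b w))" if "dn b w \<noteq> 0" for b
      using that by (simp add: nd(3) norm_divide field_simps)
    have "norm (Y' z) * (\<Prod>b\<in>UNIV. max (norm (nm' b z)) (norm (dn' b z)))
      = norm (Y w) * (max (norm (nm True w)) (norm (dn True w)) * max (norm (nm False w)) (norm (dn False w)))"
      by (simp add: UNIV_bool Y'_def nm'_def dn'_def w_def mult_ac)
    also have "\<dots> \<le> norm (Y w) * ((norm (dn True w) * (1 + norm (F True w))) * (norm (dn False w) * (1 + norm (F False w))))"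
      using mx[of True] mx[of False] G by (intro mult_left_mono mult_mono) (auto simp: le_max_iff_disj)
    also have "\<dots> = norm (h w) * ((1 + norm (f w)) * (1 + norm (g w)))"
      using G by (simp add: Y0_def norm_divide norm_mult F_def)
    also have "\<dots> \<le> C * (1 + logderiv_sum S f w + logderiv_sum S g w) ^ N" using G by blast
    also have "\<dots> \<le> \<bar>C\<bar> * (1 + logderiv_sum S' f w + logderiv_sum S' g w) ^ N"
      using logderiv_sum_mono[OF S'(1,3), of f w] logderiv_sum_mono[OF S'(1,3), of g w] logderiv_sum_nonneg[of S f w] logderiv_sum_nonneg[of S g w]
      by (intro mult_mono power_mono) auto
    also have "1 + logderiv_sum S' f w + logderiv_sum S' g w = 1 + (\<Sum>i\<in>J. norm (logderiv_of nm dn i w))" using sum_logderiv_of G by simp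
    also have "\<dots> = 1 + (\<Sum>i\<in>J. norm (logderiv_of nm' dn' i z))" by (simp add: logderiv_of' w_def)
    finally show "norm (Y' z) * (\<Prod>b\<in>UNIV. max (norm (nm' b z)) (norm (dn' b z)))
       \<le> \<bar>C\<bar> * (1 + (\<Sum>i\<in>UNIV \<times> insert None (Some ` S'). norm (logderiv_of nm' dn' i z))) ^ N"
      unfolding J_def .
  qed
qed

section \<open>A calculus of lower bounds for orders\<close>

text \<open>
  A one-sided substitute for \<open>zorder\<close>, which is undetermined for the zero function and whose behaviour under sums requires case
  distinctions. Lower bounds suffice for local boundedness, and they are stable under all operations without
  non-vanishing hypotheses.
\<close>

definition order_ge :: "(complex \<Rightarrow> complex) \<Rightarrow> complex \<Rightarrow> int \<Rightarrow> bool" where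
  "order_ge \<phi> z k \<longleftrightarrow> \<phi> \<in> O[at z](\<lambda>w. (w - z) powi k)"

lemma order_ge_cong:
  assumes "\<forall>\<^sub>F w in at z. \<phi> w = \<psi> w"
  shows "order_ge \<phi> z k \<longleftrightarrow> order_ge \<psi> z k"
  unfolding order_ge_def by (rule landau_o.big.in_cong[OF assms])

lemma order_ge_mult:
  assumes "order_ge \<phi> z j" "order_ge \<psi> z k"
  shows "order_ge (\<lambda>w. \<phi> w * \<psi> w) z (j + k)"
proof -
  have prod: "(\<lambda>w. \<phi> w * \<psi> w) \<in> O[at z](\<lambda>w. (w - z) powi j * (w - z) powi k)"
    using assms unfolding order_ge_def by (rule landau_o.big.mult)
  have eq: "\<forall>\<^sub>F w in at z. (w - z) powi j * (w - z) powi k = (w - z) powi (j + k)"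
    using eventually_neq_at_within[of z z] by eventually_elim (simp add: power_int_add)
  show ?thesis using prod unfolding order_ge_def landau_o.big.cong[OF eq] .
qed

lemma order_ge_add: "order_ge \<phi> z k \<Longrightarrow> order_ge \<psi> z k \<Longrightarrow> order_ge (\<lambda>w. \<phi> w + \<psi> w) z k"
  unfolding order_ge_def by (rule sum_in_bigo)

lemma order_ge_diff: "order_ge \<phi> z k \<Longrightarrow> order_ge \<psi> z k \<Longrightarrow> order_ge (\<lambda>w. \<phi> w - \<psi> w) z k"
  unfolding order_ge_def by (rule sum_in_bigo)

lemma order_ge_cmult: "order_ge \<phi> z k \<Longrightarrow> order_ge (\<lambda>w. c * \<phi> w) z k"
  unfolding order_ge_def by (cases "c = 0") auto

lemma order_ge_mono:
  assumes "order_ge \<phi> z k" "j \<le> k"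
  shows "order_ge \<phi> z j"
proof -
  have "\<forall>\<^sub>F w in at z. w \<noteq> z \<and> dist w z < 1"
    by (auto simp: eventually_at intro!: exI[of _ 1])
  hence "\<forall>\<^sub>F w in at z. norm ((w - z) powi k) \<le> 1 * norm ((w - z) powi j)"
    by eventually_elim (use assms(2) in \<open>auto simp: norm_power_int dist_norm intro!: power_int_decreasing\<close>)
  hence "(\<lambda>w. (w - z) powi k) \<in> O[at z](\<lambda>w. (w - z) powi j)" by (rule bigoI)
  thus ?thesis using assms(1) unfolding order_ge_def by (rule landau_o.big.trans[rotated])
qed

lemma order_ge_const [simp]: "order_ge (\<lambda>_. c) z 0"
  by (auto simp: order_ge_def)

lemma order_ge_power: "order_ge \<phi> z k \<Longrightarrow> order_ge (\<lambda>w. \<phi> w ^ j) z (int j * k)"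
proof (induction j)
  case (Suc j)
  hence "order_ge (\<lambda>w. \<phi> w * \<phi> w ^ j) z (k + int j * k)" by (intro order_ge_mult) auto
  thus ?case by (simp add: algebra_simps)
qed auto

lemma order_ge_analytic: "\<phi> analytic_on {z} \<Longrightarrow> order_ge \<phi> z 0"
proof -
  assume "\<phi> analytic_on {z}"
  hence "\<phi> \<midarrow>z\<rightarrow> \<phi> z" using analytic_at_imp_isCont isContD by blast
  hence "((\<lambda>w. norm (\<phi> w)) \<longlongrightarrow> norm (\<phi> z)) (at z)" by (rule tendsto_norm)
  hence "\<forall>\<^sub>F w in at z. norm (\<phi> w) < norm (\<phi> z) + 1" by (rule order_tendstoD) simp
  hence "\<forall>\<^sub>F w in at z. norm (\<phi> w) \<le> (norm (\<phi> z) + 1) * norm ((w - z) powi 0)" by eventually_elim simp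
  thus ?thesis unfolding order_ge_def by (rule bigoI)
qed

lemma order_ge_bounded: "order_ge \<phi> z 0 \<Longrightarrow> \<exists>K. \<forall>\<^sub>F w in at z. norm (\<phi> w) \<le> K"
  unfolding order_ge_def by (elim landau_o.bigE) auto

lemma order_ge_bound:
  assumes "order_ge \<psi> z k" "\<forall>\<^sub>F w in at z. norm (\<phi> w) \<le> K * norm (\<psi> w)"
  shows "order_ge \<phi> z k"
  using landau_o.big.trans[OF bigoI[OF assms(2)]] assms(1) unfolding order_ge_def by blast

lemma order_ge_powi: "order_ge (\<lambda>w. (w - z) powi k) z k"
  by (simp add: order_ge_def)

lemma local_factor:
  assumes "\<phi> meromorphic_on {z}" "\<exists>\<^sub>F w in at z. \<phi> w \<noteq> 0"
  obtains u r where "r > 0" "u holomorphic_on ball z r" "\<And>w. w \<in> ball z r \<Longrightarrow> u w \<noteq> 0"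
    "\<And>w. w \<in> ball z r - {z} \<Longrightarrow> \<phi> w = u w * (w - z) powi zorder \<phi> z"
proof -
  have "isolated_singularity_at \<phi> z" "not_essential \<phi> z" using assms(1) by (auto simp: meromorphic_at_iff)
  from zorder_exist[OF this assms(2)] obtain r where r: "zor_poly \<phi> z z \<noteq> 0" "r > 0" "zor_poly \<phi> z holomorphic_on cball z r"
    "\<And>w. w \<in> cball z r - {z} \<Longrightarrow> \<phi> w = zor_poly \<phi> z w * (w - z) powi zorder \<phi> z \<and> zor_poly \<phi> z w \<noteq> 0" by blast
  show ?thesis
  proof (rule that[of r "zor_poly \<phi> z"])
    show "zor_poly \<phi> z holomorphic_on ball z r" using r(3) ball_subset_cball holomorphic_on_subset by blast
    show "zor_poly \<phi> z w \<noteq> 0" if "w \<in> ball z r" for w using r(1) r(4)[of w] that by (cases "w = z") auto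
  qed (use r in auto)
qed

lemma eventually_ball_punctured: "r > 0 \<Longrightarrow> \<forall>\<^sub>F w in at z. w \<in> ball z r - {z}"
  by (rule eventually_at_in_open) auto

lemma order_ge_zorder:
  assumes "\<phi> meromorphic_on {z}" "\<exists>\<^sub>F w in at z. \<phi> w \<noteq> 0"
  shows "order_ge \<phi> z (zorder \<phi> z)" "order_ge (\<lambda>w. 1 / \<phi> w) z (- zorder \<phi> z)"
    "order_ge (deriv \<phi>) z (zorder \<phi> z - 1)" "order_ge (\<lambda>w. deriv \<phi> w / \<phi> w) z (-1)"
proof -
  obtain u r where u: "r > 0" "u holomorphic_on ball z r" "\<And>w. w \<in> ball z r \<Longrightarrow> u w \<noteq> 0"
    "\<And>w. w \<in> ball z r - {z} \<Longrightarrow> \<phi> w = u w * (w - z) powi zorder \<phi> z" using local_factor[OF assms] by metis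
  let ?k = "zorder \<phi> z"
  have ev: "\<forall>\<^sub>F w in at z. w \<in> ball z r - {z}" using u(1) by (rule eventually_ball_punctured)
  have au: "u analytic_on {z}" "u z \<noteq> 0" using u by (auto simp: analytic_at intro!: exI[of _ "ball z r"])
  have 1: "order_ge (\<lambda>w. u w * (w - z) powi ?k) z (0 + ?k)"
    by (intro order_ge_mult order_ge_analytic order_ge_powi au)
  have ev1: "\<forall>\<^sub>F w in at z. u w * (w - z) powi ?k = \<phi> w" using ev by eventually_elim (use u in auto)
  thus A: "order_ge \<phi> z ?k" using 1 order_ge_cong[OF ev1] by simp
  have 2: "order_ge (\<lambda>w. (1 / u w) * (w - z) powi (- ?k)) z (0 + (- ?k))"
    by (intro order_ge_mult order_ge_analytic order_ge_powi analytic_intros au) (use au in auto)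
  have ev2: "\<forall>\<^sub>F w in at z. (1 / u w) * (w - z) powi (- ?k) = 1 / \<phi> w"
    using ev by eventually_elim (use u in \<open>auto simp: power_int_minus field_simps\<close>)
  thus B: "order_ge (\<lambda>w. 1 / \<phi> w) z (- ?k)" using 2 order_ge_cong[OF ev2] by simp
  have dphi: "deriv \<phi> w = (deriv u w + of_int ?k * u w * (w - z) powi (-1)) * (w - z) powi ?k" if w: "w \<in> ball z r - {z}" for w
  proof -
    have "(u has_field_derivative deriv u w) (at w)" using u(2) w by (intro holomorphic_derivI) auto
    hence "((\<lambda>w. u w * (w - z) powi ?k) has_field_derivative
        deriv u w * (w - z) powi ?k + (of_int ?k * (w - z) powi (?k - 1)) * u w) (at w)"
      using w by (auto intro!: derivative_eq_intros)
    hence "(\<phi> has_field_derivative deriv u w * (w - z) powi ?k + (of_int ?k * (w - z) powi (?k - 1)) * u w) (at w)"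
      by (rule has_field_derivative_transform_within_open[of _ _ _ "ball z r - {z}"]) (use u w in auto)
    hence "deriv \<phi> w = deriv u w * (w - z) powi ?k + (of_int ?k * (w - z) powi (?k - 1)) * u w" by (rule DERIV_imp_deriv)
    also have "(w - z) powi (?k - 1) = (w - z) powi (-1) * (w - z) powi ?k" using w by (simp add: power_int_diff power_int_minus field_simps)
    finally show ?thesis by (simp add: algebra_simps)
  qed
  have du: "deriv u analytic_on {z}" using au(1) by (rule analytic_deriv)
  have "order_ge (\<lambda>w. of_int ?k * u w * (w - z) powi (-1)) z (0 + (-1))"
    by (intro order_ge_mult order_ge_analytic order_ge_powi analytic_intros au)
  hence q: "order_ge (\<lambda>w. deriv u w + of_int ?k * u w * (w - z) powi (-1)) z (-1)"
    by (intro order_ge_add order_ge_mono[OF order_ge_analytic[OF du]]) (simp_all del: power_int_minus1_right)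
  have 3: "order_ge (\<lambda>w. (deriv u w + of_int ?k * u w * (w - z) powi (-1)) * (w - z) powi ?k) z (-1 + ?k)"
    by (intro order_ge_mult q order_ge_powi)
  have ev3: "\<forall>\<^sub>F w in at z. (deriv u w + of_int ?k * u w * (w - z) powi (-1)) * (w - z) powi ?k = deriv \<phi> w"
    using ev by eventually_elim (use dphi in auto)
  show C: "order_ge (deriv \<phi>) z (?k - 1)" using 3 order_ge_cong[OF ev3] by simp
  show "order_ge (\<lambda>w. deriv \<phi> w / \<phi> w) z (-1)" using order_ge_mult[OF C B] by simp
qed

lemma zorder_ge_if_order_ge:
  assumes "\<phi> meromorphic_on {z}" "\<exists>\<^sub>F w in at z. \<phi> w \<noteq> 0" "order_ge \<phi> z k"
  shows "k \<le> zorder \<phi> z"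
proof (rule ccontr)
  assume "\<not> k \<le> zorder \<phi> z"
  hence "order_ge \<phi> z (zorder \<phi> z + 1)" using assms(3) by (auto intro: order_ge_mono)
  hence "order_ge (\<lambda>w. \<phi> w * (1 / \<phi> w)) z (zorder \<phi> z + 1 + (- zorder \<phi> z))"
    by (intro order_ge_mult order_ge_zorder assms)
  hence "order_ge (\<lambda>w. \<phi> w * (1 / \<phi> w)) z 1" by simp
  then obtain c where c: "c > 0" "\<forall>\<^sub>F w in at z. norm (\<phi> w * (1 / \<phi> w)) \<le> c * norm ((w - z) powi 1)"
    unfolding order_ge_def by (elim landau_o.bigE)
  have "\<forall>\<^sub>F w in at z. w \<noteq> z \<and> dist w z < 1 / c" using c by (auto simp: eventually_at intro!: exI[of _ "1/c"])
  with c(2) have "\<forall>\<^sub>F w in at z. \<phi> w = 0"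
  proof eventually_elim
    case (elim w)
    have "c * norm (w - z) < 1" using elim c(1) by (simp add: dist_norm field_simps)
    thus ?case using elim by (cases "\<phi> w = 0") auto
  qed
  thus False using assms(2) by (simp add: frequently_def)
qed

text \<open>
  The first hypothesis of the vanishing principle follows from orders: \<open>h\<close> must vanish at least to the order of the poles of \<open>f\<close> and \<open>g\<close> together.
\<close>

lemma product_locally_bounded:
  assumes "order_ge h z (p + q)" "order_ge f z (- p)" "order_ge g z (- q)" "0 \<le> p" "0 \<le> q"
  shows "\<exists>K. \<forall>\<^sub>F w in at z. norm (h w) * ((1 + norm (f w)) * (1 + norm (g w))) \<le> K"
proof -
  have "order_ge h z 0" using assms by (auto intro: order_ge_mono)
  moreover have "order_ge (\<lambda>w. h w * f w) z 0" using order_ge_mult[OF assms(1,2)] assms by (auto intro: order_ge_mono)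
  moreover have "order_ge (\<lambda>w. h w * g w) z 0" using order_ge_mult[OF assms(1,3)] assms by (auto intro: order_ge_mono)
  moreover have "order_ge (\<lambda>w. h w * f w * g w) z 0" using order_ge_mult[OF order_ge_mult[OF assms(1,2)] assms(3)] by simp
  ultimately obtain K1 K2 K3 K4 where K: "\<forall>\<^sub>F w in at z. norm (h w) \<le> K1" "\<forall>\<^sub>F w in at z. norm (h w * f w) \<le> K2"
    "\<forall>\<^sub>F w in at z. norm (h w * g w) \<le> K3" "\<forall>\<^sub>F w in at z. norm (h w * f w * g w) \<le> K4"
    using order_ge_bounded by meson
  have "\<forall>\<^sub>F w in at z. norm (h w) * ((1 + norm (f w)) * (1 + norm (g w))) \<le> K1 + K2 + K3 + K4"
    using K by eventually_elim (simp add: norm_mult algebra_simps)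
  thus ?thesis by blast
qed

section \<open>Polynomials with two critical points\<close>

text \<open>
  A point can be close to at most one element of a finite set; from all others its distance is comparable with \<open>1 + |w|\<close>, also for large \<open>w\<close>.
\<close>

lemma closest_point:
  fixes S :: "complex set"
  assumes S: "finite S" "S \<noteq> {}"
  obtains c where "0 < c" "\<And>w. \<exists>s\<in>S. \<forall>t\<in>S - {s}. c * (1 + norm w) \<le> norm (w - t)"
proof -
  define M where "M = Max (norm ` S)"
  have M: "norm s \<le> M" if "s \<in> S" for s using S that by (auto simp: M_def)
  have M0: "0 \<le> M" using M S by (meson all_not_in_conv norm_ge_zero order.trans)
  define X where "X = insert 1 ((\<lambda>(s, t). dist s t) ` {(s, t). s \<in> S \<and> t \<in> S \<and> s \<noteq> t})"
  define d where "d = Min X"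
  have "finite {(s, t). s \<in> S \<and> t \<in> S \<and> s \<noteq> t}"
    by (rule finite_subset[of _ "S \<times> S"]) (use S in auto)
  hence fin: "finite X" unfolding X_def by simp
  have d1: "d > 0" unfolding d_def using fin by (subst Min_gr_iff) (auto simp: X_def)
  have d2: "d \<le> dist s t" if "s \<in> S" "t \<in> S" "s \<noteq> t" for s t
    unfolding d_def using fin that by (intro Min_le) (auto simp: X_def)
  note d = d1 d2
  define c where "c = 1 / (1 + 2 * (1 + M) / d)"
  have den: "1 + 2 * (1 + M) / d \<ge> 1" using d M0 by simp
  show ?thesis
  proof (rule that[of c])
    show "0 < c" using den by (auto simp: c_def)
    fix w :: complex
    define s where "s = arg_min_on (\<lambda>s. norm (w - s)) S"
    have s: "s \<in> S" "\<And>t. t \<in> S \<Longrightarrow> norm (w - s) \<le> norm (w - t)"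
      using arg_min_if_finite[OF S, of "\<lambda>s. norm (w - s)"] unfolding s_def by force+
    have "c * (1 + norm w) \<le> norm (w - t)" if t: "t \<in> S - {s}" for t
    proof -
      have "d \<le> norm (w - s) + norm (w - t)"
        using d(2)[of s t] s(1) t norm_triangle_ineq4[of "w - t" "w - s"] by (auto simp: dist_norm norm_minus_commute add.commute)
      hence "d \<le> 2 * norm (w - t)" using s(2)[of t] t by auto
      hence *: "1 \<le> 2 * norm (w - t) / d" using d(1) by simp
      have "1 + norm w \<le> norm (w - t) + (1 + M) * 1"
        using norm_triangle_ineq2[of w t] M[of t] t by simp
      also have "\<dots> \<le> norm (w - t) + (1 + M) * (2 * norm (w - t) / d)" using * M0 by (intro add_left_mono mult_left_mono) auto
      also have "\<dots> = norm (w - t) * (1 + 2 * (1 + M) / d)" by (simp add: algebra_simps)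
      finally show ?thesis using den by (simp add: c_def divide_le_eq)
    qed
    thus "\<exists>s\<in>S. \<forall>t\<in>S - {s}. c * (1 + norm w) \<le> norm (w - t)" using s(1) by blast
  qed
qed

lemma prod_roots_lower_bound:
  fixes S :: "complex set"
  assumes S: "finite S" "S \<noteq> {}"
  obtains c where "0 < c" "\<And>w. \<exists>s\<in>S. c * norm (w - s) * (1 + norm w) ^ (card S - 1) \<le> (\<Prod>t\<in>S. norm (w - t))"
proof -
  obtain c where c: "0 < c" "\<And>w. \<exists>s\<in>S. \<forall>t\<in>S - {s}. c * (1 + norm w) \<le> norm (w - t)"
    using closest_point[OF S] by metis
  show ?thesis
  proof (rule that[of "c ^ (card S - 1)"])
    fix w :: complex
    obtain s where s: "s \<in> S" "\<And>t. t \<in> S - {s} \<Longrightarrow> c * (1 + norm w) \<le> norm (w - t)" using c(2) by blast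
    have "(\<Prod>t\<in>S - {s}. c * (1 + norm w)) \<le> (\<Prod>t\<in>S - {s}. norm (w - t))"
      using s(2) c(1) by (intro prod_mono) auto
    hence "(c * (1 + norm w)) ^ (card S - 1) \<le> (\<Prod>t\<in>S - {s}. norm (w - t))" using S s(1) by simp
    hence "norm (w - s) * (c * (1 + norm w)) ^ (card S - 1) \<le> norm (w - s) * (\<Prod>t\<in>S - {s}. norm (w - t))"
      by (rule mult_left_mono) simp
    also have "\<dots> = (\<Prod>t\<in>S. norm (w - t))" using S s(1) by (simp add: prod.remove)
    finally show "\<exists>s\<in>S. c ^ (card S - 1) * norm (w - s) * (1 + norm w) ^ (card S - 1) \<le> (\<Prod>t\<in>S. norm (w - t))"
      using s(1) by (intro bexI[of _ s]) (auto simp: power_mult_distrib mult_ac)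
  qed (use c(1) in auto)
qed

lemma poly_upper_bound:
  fixes p :: "complex poly"
  obtains C where "0 < C" "\<And>w. norm (poly p w) \<le> C * (1 + norm w) ^ degree p"
proof (rule that[of "1 + (\<Sum>i\<le>degree p. norm (coeff p i))"])
  show "0 < 1 + (\<Sum>i\<le>degree p. norm (coeff p i))" by (intro add_pos_nonneg sum_nonneg) auto
  fix w
  have "norm (poly p w) \<le> (\<Sum>i\<le>degree p. norm (coeff p i * w ^ i))" unfolding poly_altdef by (rule norm_sum)
  also have "\<dots> \<le> (\<Sum>i\<le>degree p. norm (coeff p i) * (1 + norm w) ^ degree p)"
  proof (rule sum_mono)
    fix i assume "i \<in> {..degree p}"
    have "norm w ^ i \<le> (1 + norm w) ^ i" by (intro power_mono) auto
    also have "\<dots> \<le> (1 + norm w) ^ degree p" using \<open>i \<in> _\<close> by (intro power_increasing) auto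
    finally show "norm (coeff p i * w ^ i) \<le> norm (coeff p i) * (1 + norm w) ^ degree p"
      by (simp add: norm_mult norm_power mult_left_mono)
  qed
  also have "\<dots> = (\<Sum>i\<le>degree p. norm (coeff p i)) * (1 + norm w) ^ degree p" by (simp add: sum_distrib_right)
  also have "\<dots> \<le> (1 + (\<Sum>i\<le>degree p. norm (coeff p i))) * (1 + norm w) ^ degree p" by (intro mult_right_mono) auto
  finally show "norm (poly p w) \<le> (1 + (\<Sum>i\<le>degree p. norm (coeff p i))) * (1 + norm w) ^ degree p" .
qed

text \<open>
  The roles of \<open>(a, n)\<close> and \<open>(b, m)\<close> are interchangeable; \<open>swap\<close> interprets the locale a second time in the opposite order, and
  so every statement about \<open>a\<close> is also available for \<open>b\<close>.
\<close>

locale two_critical_points =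
  fixes a b :: complex and n m :: nat and p :: "complex poly"
  assumes pderiv_p: "pderiv p = [:-a, 1:] ^ n * [:-b, 1:] ^ m" and ab: "a \<noteq> b" and nm: "1 \<le> n" "1 \<le> m"
begin

lemma swap: "two_critical_points b a m n p"
  by unfold_locales (use pderiv_p ab nm in \<open>auto simp: mult.commute\<close>)

lemma poly_pderiv_p: "poly (pderiv p) w = (w - a) ^ n * (w - b) ^ m"
  by (simp add: pderiv_p)

lemma degree_p: "degree p = n + m + 1"
proof -
  have "degree (pderiv p) = n + m"
    unfolding pderiv_p by (subst degree_mult_eq) (auto simp: degree_power_eq)
  thus ?thesis using degree_pderiv[of p] nm by simp
qed

lemma minus_const: "p - [:v:] \<noteq> 0" "degree (p - [:v:]) = n + m + 1" "pderiv (p - [:v:]) = pderiv p"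
proof -
  have "pderiv p \<noteq> 0" by (simp add: pderiv_p)
  moreover show "pderiv (p - [:v:]) = pderiv p" by (simp add: pderiv_diff pderiv_pCons)
  ultimately show "p - [:v:] \<noteq> 0" by force
  have eq: "p - [:v:] = p + [:- v:]" by (intro poly_eqI) (simp add: coeff_pCons split: nat.split)
  show "degree (p - [:v:]) = n + m + 1" unfolding eq using degree_add_eq_left[of "[:- v:]" p] degree_p by simp
qed

lemma order_at_a: "order a (p - [:poly p a:]) = n + 1"
proof -
  have "order a (pderiv p) = n"
    unfolding pderiv_p using ab
    by (subst order_mult) (auto simp: order_power_n_n order_0I)
  moreover have "order a (p - [:poly p a:]) = Suc (order a (pderiv (p - [:poly p a:])))"
    by (rule order_pderiv) (use minus_const in auto)
  ultimately show ?thesis by (simp add: minus_const)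
qed

lemma factor_at_a:
  obtains R where "\<And>w. poly p w - poly p a = (w - a) ^ (n + 1) * poly R w" "poly R a \<noteq> 0" "degree R = m"
proof -
  obtain R where R: "p - [:poly p a:] = [:-a, 1:] ^ (n + 1) * R" "\<not> [:-a, 1:] dvd R"
    using order_decomp[OF minus_const(1)[of "poly p a"], of a] order_at_a by metis
  have "R \<noteq> 0" using R(2) by auto
  hence "degree (p - [:poly p a:]) = (n + 1) + degree R"
    unfolding R(1) by (subst degree_mult_eq) (auto simp: degree_power_eq simp del: power_Suc)
  hence "degree R = m" using minus_const by simp
  moreover have "poly R a \<noteq> 0" using R(2) by (simp add: poly_eq_0_iff_dvd)
  moreover have "poly p w - poly p a = (w - a) ^ (n + 1) * poly R w" for w
    using arg_cong[OF R(1), of "\<lambda>q. poly q w"] by (simp del: power_Suc)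
  ultimately show ?thesis using that by blast
qed

text \<open>
  If the values agreed, \<open>p - p(a)\<close> would have a zero of order \<open>n + 1\<close> at \<open>a\<close> and one of order \<open>m + 1\<close> at \<open>b\<close>, which exceeds
  its degree \<open>n + m + 1\<close>.
\<close>

lemma critical_values_distinct: "poly p a \<noteq> poly p b"
proof
  assume eq: "poly p a = poly p b"
  interpret s: two_critical_points b a m n p by (rule swap)
  let ?q = "p - [:poly p a:]"
  obtain R where R: "\<And>w. poly p w - poly p a = (w - a) ^ (n + 1) * poly R w" "degree R = m"
    using factor_at_a by metis
  have "poly ?q = poly ([:-a, 1:] ^ (n + 1) * R)" by (rule ext) (simp add: R(1) del: power_Suc)
  hence qeq: "?q = [:-a, 1:] ^ (n + 1) * R" by (simp only: poly_eq_poly_eq_iff)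
  have q0: "?q \<noteq> 0" by (rule minus_const)
  hence R0: "R \<noteq> 0" using qeq by auto
  have "order b ?q = order b ([:-a, 1:] ^ (n + 1)) + order b R"
    using order_mult[of "[:-a, 1:] ^ (n + 1)" R b] q0 unfolding qeq by blast
  also have "order b ([:-a, 1:] ^ (n + 1)) = 0" using ab by (intro order_0I) auto
  finally have "order b R = m + 1" using s.order_at_a eq by simp
  thus False using order_degree[OF R0, of b] R(2) by simp
qed

lemma noncritical_value:
  assumes v: "v \<noteq> poly p a" "v \<noteq> poly p b"
  shows "finite {w. poly p w = v}" "card {w. poly p w = v} = n + m + 1"
    "poly p w - v = lead_coeff p * (\<Prod>s | poly p s = v. w - s)"
proof -
  let ?q = "p - [:v:]"
  have roots: "{w. poly ?q w = 0} = {w. poly p w = v}" by auto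
  have sqf: "rsquarefree ?q"
    unfolding rsquarefree_roots minus_const(3) poly_pderiv_p using v nm by auto
  show "finite {w. poly p w = v}" using poly_roots_finite[OF minus_const(1)[of v]] roots by simp
  have dec: "smult (lead_coeff ?q) (\<Prod>z|poly ?q z = 0. [:-z, 1:]) = ?q"
    using complex_poly_decompose_rsquarefree[OF sqf] .
  have lc: "lead_coeff ?q = lead_coeff p"
    unfolding minus_const(2) degree_p by (simp add: coeff_pCons)
  have "degree ?q = degree (\<Prod>z|poly ?q z = 0. [:-z, 1:])"
    using dec minus_const(1)[of v] by (metis degree_smult_eq leading_coeff_0_iff)
  also have "\<dots> = card {w. poly p w = v}" unfolding roots by (subst degree_prod_eq_sum_degree) auto
  finally show "card {w. poly p w = v} = n + m + 1" using minus_const(2) by simp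
  have "poly ?q w = lead_coeff ?q * (\<Prod>s|poly ?q s = 0. w - s)"
    by (subst dec[symmetric]) (simp add: poly_prod)
  thus "poly p w - v = lead_coeff p * (\<Prod>s | poly p s = v. w - s)" unfolding lc by simp
qed

lemma lead_coeff_nonzero: "lead_coeff p \<noteq> 0"
proof -
  have "p \<noteq> 0" using degree_p by force
  thus ?thesis by simp
qed

text \<open>
  For a non-critical value the zeros of \<open>p - v\<close> are simple, so that one linear factor may be small while
  the \<open>n + m\<close> others have size \<open>1 + |w|\<close>.
\<close>

lemma noncritical_lower_bound:
  assumes v: "v \<noteq> poly p a" "v \<noteq> poly p b"
  obtains c where "0 < c" "\<And>w. \<exists>s. poly p s = v \<and> c * norm (w - s) * (1 + norm w) ^ (n + m) \<le> norm (poly p w - v)"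
proof -
  note nv = noncritical_value[OF v]
  have ne: "{w. poly p w = v} \<noteq> {}" using nv(2) by force
  obtain c where c: "0 < c" "\<And>w. \<exists>s\<in>{w. poly p w = v}. c * norm (w - s) * (1 + norm w) ^ (card {w. poly p w = v} - 1) \<le> (\<Prod>t\<in>{w. poly p w = v}. norm (w - t))"
    using prod_roots_lower_bound[OF nv(1) ne] by metis
  have l: "norm (lead_coeff p) > 0" using lead_coeff_nonzero by simp
  show ?thesis
  proof (rule that[of "norm (lead_coeff p) * c"])
    fix w
    obtain s where s: "poly p s = v" "c * norm (w - s) * (1 + norm w) ^ (n + m) \<le> (\<Prod>t\<in>{w. poly p w = v}. norm (w - t))"
      using c(2)[of w] nv(2) by auto
    have "norm (lead_coeff p) * (c * norm (w - s) * (1 + norm w) ^ (n + m)) \<le> norm (lead_coeff p) * (\<Prod>t\<in>{w. poly p w = v}. norm (w - t))"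
      using s(2) by (rule mult_left_mono) simp
    also have "\<dots> = norm (poly p w - v)" unfolding nv(3) by (simp add: norm_mult prod_norm)
    finally show "\<exists>s. poly p s = v \<and> norm (lead_coeff p) * c * norm (w - s) * (1 + norm w) ^ (n + m) \<le> norm (poly p w - v)"
      using s(1) by (auto simp: mult.assoc)
  qed (use l c(1) in auto)
qed

lemma growth_lower_bound:
  obtains C where "1 \<le> C" "\<And>w. (1 + norm w) ^ (n + m + 1) \<le> C * (1 + norm (poly p w))"
proof -
  obtain v where v: "v \<noteq> poly p a" "v \<noteq> poly p b"
    using ex_new_if_finite[of "{poly p a, poly p b}"] infinite_UNIV_char_0 by auto
  obtain c where c: "0 < c" "\<And>w. \<exists>s. poly p s = v \<and> c * norm (w - s) * (1 + norm w) ^ (n + m) \<le> norm (poly p w - v)"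
    using noncritical_lower_bound[OF v] by metis
  define M where "M = 1 + Max (insert 0 (norm ` {w. poly p w = v}))"
  have M: "1 + norm s \<le> M" if "poly p s = v" for s
    using that noncritical_value(1)[OF v] by (simp add: M_def)
  have M1: "1 \<le> M" using noncritical_value(1)[OF v] by (simp add: M_def)
  define C where "C = (2 * M) ^ (n + m + 1) + 2 * (1 + norm v) / c"
  show ?thesis
  proof (rule that[of C])
    show "1 \<le> C" unfolding C_def using M1 c(1) by (intro add_increasing2 one_le_power) auto
    fix w
    obtain s where s: "poly p s = v" "c * norm (w - s) * (1 + norm w) ^ (n + m) \<le> norm (poly p w - v)" using c(2) by blast
    let ?X = "1 + norm w"
    show "?X ^ (n + m + 1) \<le> C * (1 + norm (poly p w))"
    proof (cases "?X \<le> 2 * M")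
      case True
      hence "?X ^ (n + m + 1) \<le> (2 * M) ^ (n + m + 1) * 1"
        using power_mono[OF True, of "n + m + 1"] by simp
      also have "\<dots> \<le> C * (1 + norm (poly p w))"
        using M1 c(1) by (intro mult_mono) (auto simp: C_def)
      finally show ?thesis .
    next
      case False
      have "?X \<le> norm (w - s) + M" using norm_triangle_ineq2[of w s] M[OF s(1)] by simp
      hence "?X \<le> 2 * norm (w - s)" using False by simp
      hence "?X * ?X ^ (n + m) \<le> (2 * norm (w - s)) * ?X ^ (n + m)" by (intro mult_right_mono) auto
      also have "\<dots> = 2 / c * (c * norm (w - s) * ?X ^ (n + m))" using c(1) by simp
      also have "\<dots> \<le> 2 / c * norm (poly p w - v)" using s(2) c(1) by (intro mult_left_mono) auto
      also have "\<dots> \<le> 2 / c * ((1 + norm v) * (1 + norm (poly p w)))"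
      proof (intro mult_left_mono)
        have "norm (poly p w - v) \<le> norm (poly p w) + norm v" by (rule norm_triangle_ineq4)
        also have "\<dots> \<le> (1 + norm v) * (1 + norm (poly p w))" by (simp add: algebra_simps)
        finally show "norm (poly p w - v) \<le> (1 + norm v) * (1 + norm (poly p w))" .
      qed (use c(1) in auto)
      also have "\<dots> = 2 * (1 + norm v) / c * (1 + norm (poly p w))" by simp
      also have "\<dots> \<le> C * (1 + norm (poly p w))" unfolding C_def using M1 by (intro mult_right_mono) auto
      finally show ?thesis by simp
    qed
  qed
qed

text \<open>
  Both sides of \<open>p(x) = K p(y)\<close> grow like the same power of \<open>1 + |x|\<close> and \<open>1 + |y|\<close>.
\<close>

lemma comparable_size:
  obtains C where "1 \<le> C" "\<And>x y. poly p x = K * poly p y \<Longrightarrow> 1 + norm x \<le> C * (1 + norm y)"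
proof -
  obtain C1 where C1: "1 \<le> C1" "\<And>w. (1 + norm w) ^ (n + m + 1) \<le> C1 * (1 + norm (poly p w))" using growth_lower_bound by metis
  obtain C2 where C2: "0 < C2" "\<And>w. norm (poly p w) \<le> C2 * (1 + norm w) ^ degree p" using poly_upper_bound[of p] by metis
  define C where "C = C1 * (1 + norm K * C2)"
  have CC: "1 \<le> C" unfolding C_def using C1 C2 mult_mono[of 1 C1 1 "1 + norm K * C2"] by simp
  show ?thesis
  proof (rule that[OF CC])
    fix x y assume eq: "poly p x = K * poly p y"
    let ?Y = "1 + norm y" and ?k = "n + m + 1"
    have Y: "1 \<le> ?Y ^ ?k" by (rule one_le_power) simp
    have "(1 + norm x) ^ ?k \<le> C1 * (1 + norm K * norm (poly p y))" using C1(2)[of x] eq by (simp add: norm_mult)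
    also have "\<dots> \<le> C1 * (?Y ^ ?k + norm K * (C2 * ?Y ^ ?k))"
      using C1(1) Y C2(2)[of y] degree_p by (intro mult_left_mono add_mono) auto
    also have "\<dots> = C * ?Y ^ ?k" by (simp add: C_def algebra_simps)
    also have "\<dots> \<le> C ^ ?k * ?Y ^ ?k" using CC Y power_increasing[of 1 ?k C] by (intro mult_right_mono) auto
    also have "\<dots> = (C * ?Y) ^ ?k" by (simp add: power_mult_distrib)
    finally show "1 + norm x \<le> C * ?Y" 
      using power_le_imp_le_base[of "1 + norm x" "n + m" "C * ?Y"] CC by simp
  qed
qed

end

section \<open>Proportional compositions with different critical values\<close>

lemma cosparse_imp_at: "\<forall>\<^sub>\<approx>z\<in>UNIV. R z \<Longrightarrow> \<forall>\<^sub>F w in at z. R w"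
  by (rule eventually_cosparse_imp_eventually_at) auto

lemma nicely_meromorphic_at:
  assumes "f nicely_meromorphic_on UNIV"
  shows "f meromorphic_on {z}" "f meromorphic_on UNIV"
  using assms by (auto simp: nicely_meromorphic_on_def intro: meromorphic_on_subset)

lemma frequently_nonzero:
  assumes "f nicely_meromorphic_on UNIV" "\<not> f constant_on UNIV"
  shows "\<exists>\<^sub>F w in at z. f w \<noteq> s"
  using cosparse_imp_at[OF avoids_value_cosparse[OF assms, of s], of z] by (simp add: eventually_frequently)

lemma nicely_meromorphic_eqI:
  assumes f: "f nicely_meromorphic_on UNIV" and g: "g nicely_meromorphic_on UNIV"
    and eq: "\<forall>\<^sub>\<approx>z\<in>UNIV. f z = g z"
  shows "f = g"
proof
  fix z
  have ev: "\<forall>\<^sub>F w in at z. f w = g w" using eq by (rule cosparse_imp_at)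
  have iff: "is_pole f z \<longleftrightarrow> is_pole g z" using ev by (rule is_pole_cong) simp
  show "f z = g z"
  proof (cases "is_pole f z")
    case True
    thus ?thesis using is_pole_zero_at_nicely_mero[OF f] is_pole_zero_at_nicely_mero[OF g] iff by auto
  next
    case False
    have "f \<midarrow>z\<rightarrow> f z" "g \<midarrow>z\<rightarrow> g z" using f g False iff by (auto simp: nicely_meromorphic_on_def)
    moreover have "g \<midarrow>z\<rightarrow> f z" using \<open>f \<midarrow>z\<rightarrow> f z\<close> ev by (rule Lim_transform_eventually)
    ultimately show ?thesis using LIM_unique by blast
  qed
qed

lemma order_ge_inverse_shift:
  assumes "f meromorphic_on {z}" "\<exists>\<^sub>F w in at z. f w \<noteq> 0" "is_pole f z"
  shows "order_ge (\<lambda>w. 1 / (f w - s)) z (- zorder f z)"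
proof (rule order_ge_bound[OF order_ge_zorder(2)[OF assms(1,2)]])
  show "\<forall>\<^sub>F w in at z. norm (1 / (f w - s)) \<le> 2 * norm (1 / f w)"
    using pole_large[OF assms(3), of "2 * norm s + 1"]
  proof eventually_elim
    case (elim w)
    have "norm (f w) / 2 \<le> norm (f w - s)" using elim norm_triangle_ineq2[of "f w" s] by simp
    moreover have "0 < norm (f w) / 2" using elim norm_ge_zero[of s] by linarith
    ultimately have "1 / norm (f w - s) \<le> 1 / (norm (f w) / 2)" by (intro frac_le) auto
    thus ?case by (simp add: norm_divide)
  qed
qed

lemma order_ge_shift:
  assumes "order_ge f z k" "k \<le> 0"
  shows "order_ge (\<lambda>w. f w - s) z k"
  using assms by (intro order_ge_diff order_ge_mono[OF order_ge_const]) auto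

lemma order_ge_deriv:
  assumes "f meromorphic_on {z}" "\<exists>\<^sub>F w in at z. f w \<noteq> 0" "order_ge f z k"
  shows "order_ge (deriv f) z (k - 1)"
  using zorder_ge_if_order_ge[OF assms] by (intro order_ge_mono[OF order_ge_zorder(3)[OF assms(1,2)]]) auto

lemma order_ge_dominated_at_pole:
  assumes f: "f meromorphic_on {z}" "\<exists>\<^sub>F w in at z. f w \<noteq> 0" "is_pole f z"
    and le: "\<forall>\<^sub>F w in at z. 1 + norm (g w) \<le> C * (1 + norm (f w))" and C: "1 \<le> C"
  shows "order_ge g z (zorder f z)"
proof (rule order_ge_bound[OF order_ge_zorder(1)[OF f(1,2)]])
  show "\<forall>\<^sub>F w in at z. norm (g w) \<le> (2 * C) * norm (f w)"
    using pole_large[OF f(3), of 1] le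
  proof eventually_elim
    case (elim w)
    have "C * (1 + norm (f w)) \<le> C * (2 * norm (f w))" using elim C by (intro mult_left_mono) auto
    thus ?case using elim by simp
  qed
qed

lemma dominated_at_regular_point:
  assumes f: "f nicely_meromorphic_on UNIV" "\<not> is_pole f z"
    and g: "g nicely_meromorphic_on UNIV"
    and le: "\<forall>\<^sub>F w in at z. 1 + norm (g w) \<le> C * (1 + norm (f w))" and C: "1 \<le> C"
  shows "\<not> is_pole g z" "f analytic_on {z}" "g analytic_on {z}"
proof -
  show fa: "f analytic_on {z}" using nicely_meromorphic_on_imp_analytic_at[OF f(1) _ f(2)] by simp
  obtain M where M: "\<forall>\<^sub>F w in at z. norm (f w) \<le> M" using order_ge_bounded[OF order_ge_analytic[OF fa]] by blast
  have "\<forall>\<^sub>F w in at z. norm (g w) \<le> C * (1 + M)"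
    using M le
  proof eventually_elim
    case (elim w)
    have "C * (1 + norm (f w)) \<le> C * (1 + M)" using elim C by (intro mult_left_mono) auto
    thus ?case using elim by simp
  qed
  thus gp: "\<not> is_pole g z" by (rule bounded_not_pole)
  show "g analytic_on {z}" using nicely_meromorphic_on_imp_analytic_at[OF g _ gp] by simp
qed

lemma deriv_le_logderiv_sum:
  assumes "finite S" "s \<in> S"
  shows "norm (deriv f z) \<le> logderiv_sum S f z * norm (f z - s) \<or> f z = s"
proof (cases "f z = s")
  case False
  have "norm (deriv f z / (f z - s)) \<le> (\<Sum>s\<in>S. norm (deriv f z / (f z - s)))"
    using assms by (intro member_le_sum) auto
  also have "\<dots> \<le> logderiv_sum S f z" by (simp add: logderiv_sum_def)
  finally show ?thesis using False by (simp add: norm_divide field_simps)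
qed simp

lemma analytic_eventually_eq_at:
  assumes "f analytic_on {z}" "g analytic_on {z}" "\<forall>\<^sub>F w in at z. f w = g w"
  shows "f z = (g z :: complex)"
proof -
  have "f \<midarrow>z\<rightarrow> f z" "g \<midarrow>z\<rightarrow> g z" using assms(1,2) by (auto dest: analytic_at_imp_isCont isContD)
  moreover have "g \<midarrow>z\<rightarrow> f z" using \<open>f \<midarrow>z\<rightarrow> f z\<close> assms(3) by (rule Lim_transform_eventually)
  ultimately show ?thesis using LIM_unique by blast
qed

lemma poly_analytic: "f analytic_on A \<Longrightarrow> (\<lambda>w. poly p (f w)) analytic_on A"
  by (induction p) (auto intro!: analytic_intros)

lemma analytic_at_imp_deriv: "f analytic_on {z} \<Longrightarrow> (f has_field_derivative deriv f z) (at z)"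
  by (auto simp: analytic_at intro: holomorphic_derivI)

lemma deriv_poly_compose:
  assumes "f analytic_on {z}"
  shows "deriv (\<lambda>w. poly p (f w)) z = poly (pderiv p) (f z) * deriv f z"
  using DERIV_chain2[OF poly_DERIV analytic_at_imp_deriv[OF assms]] by (rule DERIV_imp_deriv)

lemma deriv_minus_const_near:
  assumes "f analytic_on {z}"
  shows "\<forall>\<^sub>F w in at z. deriv (\<lambda>w. f w - c) w = deriv f w"
proof -
  obtain r where r: "r > 0" "f holomorphic_on ball z r" using assms by (auto simp: analytic_at_ball)
  show ?thesis using eventually_ball_punctured[OF r(1), of z]
  proof eventually_elim
    case (elim w)
    have "f field_differentiable at w" using r elim by (auto intro: holomorphic_on_imp_differentiable_at)
    thus ?case by (subst deriv_diff) auto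
  qed
qed

text \<open>
  How the factor \<open>(1 + |f|)(1 + |g|)\<close> of the vanishing principle is absorbed: an estimate of \<open>q\<close> with one factor \<open>X = 1 + |f|\<close> to spare
  yields, after raising it to the fourth power, more than the two factors required. The square would be enough for this purpose; the larger exponent
  is needed for the orders at the poles.
\<close>

lemma fourth_power_bound:
  fixes q X Y C C' L :: real
  assumes "q * X \<le> C * L" "Y \<le> C' * X" "0 \<le> q" "1 \<le> X" "0 \<le> C'"
  shows "q ^ 4 * (X * Y) \<le> C ^ 4 * C' * L ^ 4"
proof -
  have "q ^ 4 * (X * Y) \<le> q ^ 4 * (X * (C' * X))" using assms by (intro mult_left_mono) auto
  also have "\<dots> = q ^ 4 * X\<^sup>2 * C'" by (simp add: power2_eq_square)
  also have "\<dots> \<le> q ^ 4 * X ^ 4 * C'"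
    using assms power_increasing[of 2 4 X] by (intro mult_right_mono mult_left_mono) auto
  also have "\<dots> = (q * X) ^ 4 * C'" by (simp add: power_mult_distrib)
  also have "\<dots> \<le> (C * L) ^ 4 * C'" using assms by (intro mult_right_mono power_mono) auto
  finally show ?thesis by (simp add: power_mult_distrib mult_ac)
qed

context two_critical_points
begin

lemma differentiate_relation:
  assumes f: "f nicely_meromorphic_on UNIV" and g: "g nicely_meromorphic_on UNIV"
    and rel: "\<forall>\<^sub>\<approx>z\<in>UNIV. poly p (g z) = K * poly p (f z)"
  shows "\<forall>\<^sub>\<approx>z\<in>UNIV. (g z - a) ^ n * (g z - b) ^ m * deriv g z = K * ((f z - a) ^ n * (f z - b) ^ m * deriv f z)"
proof -
  have "\<forall>\<^sub>\<approx>z\<in>UNIV. f analytic_on {z} \<and> g analytic_on {z} \<and> poly p (g z) = K * poly p (f z)"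
    using meromorphic_on_imp_analytic_cosparse[OF nicely_meromorphic_at(2)[OF f]]
      meromorphic_on_imp_analytic_cosparse[OF nicely_meromorphic_at(2)[OF g]] rel
    by eventually_elim blast
  then obtain E where E: "E sparse_in UNIV" "\<And>z. z \<notin> E \<Longrightarrow> f analytic_on {z} \<and> g analytic_on {z} \<and> poly p (g z) = K * poly p (f z)"
    unfolding eventually_cosparse by blast
  have op: "open (- E)" using sparse_in_UNIV_imp_closed[OF E(1)] by auto
  have "(g z - a) ^ n * (g z - b) ^ m * deriv g z = K * ((f z - a) ^ n * (f z - b) ^ m * deriv f z)" if z: "z \<notin> E" for z
  proof -
    have "((\<lambda>w. K * poly p (f w)) has_field_derivative K * (poly (pderiv p) (f z) * deriv f z)) (at z)"
      using DERIV_cmult[OF DERIV_chain2[OF poly_DERIV analytic_at_imp_deriv]] E(2)[OF z] by blast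
    hence "((\<lambda>w. poly p (g w)) has_field_derivative K * (poly (pderiv p) (f z) * deriv f z)) (at z)"
      by (rule has_field_derivative_transform_within_open[OF _ op]) (use z E(2) in auto)
    hence "deriv (\<lambda>w. poly p (g w)) z = K * (poly (pderiv p) (f z) * deriv f z)" by (rule DERIV_imp_deriv)
    thus ?thesis using deriv_poly_compose[of g z p] E(2)[OF z] by (simp add: poly_pderiv_p)
  qed
  thus ?thesis unfolding eventually_cosparse by (auto intro: sparse_in_subset2[OF E(1)])
qed

text \<open>
  If \<open>p(g) = K p(f)\<close> and \<open>K p(a)\<close> is not a critical value, then \<open>g\<close> is close to one of the simple roots \<open>t\<close> of
  \<open>p - K p(a)\<close> whenever \<open>f\<close> is close to \<open>a\<close>, and more precisely \<open>|g - t| (1 + |f|)\<close> is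
  bounded by a multiple of \<open>|f - a|^n\<close>. Combined with \<open>|g'| = |g'/(g - t)| |g - t|\<close>, this shows that
  \<open>g'/(f - a)^n\<close> times \<open>1 + |f|\<close> is bounded by logarithmic derivatives. This function has no poles
  where \<open>f = a\<close>, as one sees by differentiating the relation. At a pole of \<open>f\<close> of order \<open>q\<close> a pole of \<open>g\<close> has at most this
  order, and the function vanishes at least to the order \<open>n q - q - 1\<close>, which is positive when \<open>n\<close> and \<open>q\<close> are at least 2. The vanishing principle gives \<open>g' = 0\<close>.
\<close>

lemma no_relation_at_noncritical_value:
  assumes f: "f nicely_meromorphic_on UNIV" "\<not> f constant_on UNIV"
    and g: "g nicely_meromorphic_on UNIV" "\<not> g constant_on UNIV"
    and poles: "\<And>z. is_pole f z \<Longrightarrow> zorder f z \<le> -2"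
    and rel: "\<forall>\<^sub>\<approx>z\<in>UNIV. poly p (g z) = K * poly p (f z)" and K: "K \<noteq> 0"
    and v: "K * poly p a \<noteq> poly p a" "K * poly p a \<noteq> poly p b" and n2: "2 \<le> n"
  shows False
proof -
  define v where "v = K * poly p a"
  define T where "T = {w. poly p w = v}"
  have vv: "v \<noteq> poly p a" "v \<noteq> poly p b" using v by (auto simp: v_def)
  have T: "finite T" unfolding T_def by (rule noncritical_value(1)[OF vv])
  obtain C1 where C1: "1 \<le> C1" "\<And>x y. poly p x = K * poly p y \<Longrightarrow> 1 + norm x \<le> C1 * (1 + norm y)" using comparable_size[of K] by metis
  obtain C2 where C2: "1 \<le> C2" "\<And>x y. poly p x = (1/K) * poly p y \<Longrightarrow> 1 + norm x \<le> C2 * (1 + norm y)" using comparable_size[of "1/K"] by metis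
  obtain c where c: "0 < c" "\<And>w. \<exists>s. poly p s = v \<and> c * norm (w - s) * (1 + norm w) ^ (n + m) \<le> norm (poly p w - v)"
    using noncritical_lower_bound[OF vv] by metis
  obtain R where R: "\<And>w. poly p w - poly p a = (w - a) ^ (n + 1) * poly R w" "degree R = m" using factor_at_a by metis
  obtain C3 where C3: "0 < C3" "\<And>w. norm (poly R w) \<le> C3 * (1 + norm w) ^ degree R" using poly_upper_bound[of R] by metis
  have size: "\<forall>\<^sub>\<approx>z\<in>UNIV. 1 + norm (g z) \<le> C1 * (1 + norm (f z))"
    using rel by eventually_elim (rule C1(2))
  define h where "h = (\<lambda>z. (deriv g z * (1 / (f z - a)) ^ n) ^ 4)"
  define C where "C = norm K * C3 * (1 + norm a) * C2 ^ (n + m) / c"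
  have Cpos: "0 \<le> C" using C3 C2 c by (simp add: C_def)
  \<comment> \<open>The distance of \<open>p(y)\<close> to \<open>v\<close> is \<open>|K| |p(x) - p(a)|\<close>, which is bounded by a multiple of
      \<open>|x - a|^n (1 + |x|)^(m + 1)\<close>; on the other side it is at least a multiple of
      \<open>|y - t| (1 + |y|)^(n + m)\<close>. The remaining power \<open>n - 1 \<ge> 1\<close> of \<open>1 + |x|\<close> is the gain.\<close>
  have ineq: "\<exists>t\<in>T. norm (y - t) * (1 + norm x) \<le> C * norm (x - a) ^ n" if xy: "poly p y = K * poly p x" for x y
  proof -
    let ?X = "1 + norm x" and ?Y = "1 + norm y"
    obtain t where t: "poly p t = v" "c * norm (y - t) * ?Y ^ (n + m) \<le> norm (poly p y - v)" using c(2) by blast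
    have XY: "?X \<le> C2 * ?Y" using C2(2)[of x y] xy K by simp
    have X1: "1 \<le> ?X" by simp
    have "norm (poly p y - v) = norm K * norm (poly p x - poly p a)"
      by (simp add: xy v_def right_diff_distrib[symmetric] norm_mult)
    also have "\<dots> = norm K * (norm (x - a) ^ n * norm (x - a) * norm (poly R x))"
      unfolding R(1) by (simp add: norm_mult norm_power mult_ac)
    also have "\<dots> \<le> norm K * (norm (x - a) ^ n * ((1 + norm a) * ?X) * (C3 * ?X ^ m))"
    proof (intro mult_left_mono mult_mono)
      have "norm (x - a) \<le> norm x + norm a" by (rule norm_triangle_ineq4)
      also have "\<dots> \<le> (1 + norm a) * ?X" by (simp add: algebra_simps)
      finally show "norm (x - a) \<le> (1 + norm a) * ?X" .
      show "norm (poly R x) \<le> C3 * ?X ^ m" using C3(2) R(2) by simp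
    qed (use X1 in \<open>auto intro!: mult_nonneg_nonneg\<close>)
    finally have u: "c * norm (y - t) * ?Y ^ (n + m) \<le> norm K * (norm (x - a) ^ n * ((1 + norm a) * ?X) * (C3 * ?X ^ m))"
      using t(2) by linarith
    have "c * norm (y - t) * ?X ^ (n + m) \<le> c * norm (y - t) * (C2 * ?Y) ^ (n + m)"
      using XY c(1) by (intro mult_left_mono power_mono) auto
    also have "\<dots> = C2 ^ (n + m) * (c * norm (y - t) * ?Y ^ (n + m))" by (simp add: power_mult_distrib)
    also have "\<dots> \<le> C2 ^ (n + m) * (norm K * (norm (x - a) ^ n * ((1 + norm a) * ?X) * (C3 * ?X ^ m)))"
      using u C2(1) by (intro mult_left_mono) auto
    also have "\<dots> = c * C * norm (x - a) ^ n * ?X ^ (m + 1)" using c(1) by (simp add: C_def)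
    finally have "c * norm (y - t) * ?X ^ (n + m) \<le> c * C * norm (x - a) ^ n * ?X ^ (m + 1)" .
    moreover have "?X ^ (n + m) = ?X ^ (n - 1) * ?X ^ (m + 1)" using n2 by (simp add: power_add[symmetric] del: power_Suc)
    ultimately have "(c * norm (y - t) * ?X ^ (n - 1)) * ?X ^ (m + 1) \<le> (c * C * norm (x - a) ^ n) * ?X ^ (m + 1)"
      by (simp only: mult.assoc)
    hence "c * norm (y - t) * ?X ^ (n - 1) \<le> c * C * norm (x - a) ^ n"
      using X1 by (subst (asm) mult_le_cancel_right) (auto simp: not_less)
    hence "c * (norm (y - t) * ?X ^ (n - 1)) \<le> c * (C * norm (x - a) ^ n)" by (simp only: mult.assoc)
    hence "norm (y - t) * ?X ^ (n - 1) \<le> C * norm (x - a) ^ n" using c(1) by simp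
    moreover have "norm (y - t) * ?X ^ 1 \<le> norm (y - t) * ?X ^ (n - 1)"
      using X1 n2 by (intro mult_left_mono power_increasing) auto
    ultimately show ?thesis using t(1) by (intro bexI[of _ t]) (auto simp: T_def)
  qed
  have "\<forall>\<^sub>\<approx>z\<in>UNIV. h z = 0"
  proof (rule small_meromorphic_function_vanishes[OF f g _ T, of h "C ^ 4 * C1" 4])
    show "h meromorphic_on UNIV" unfolding h_def
      by (intro meromorphic_intros nicely_meromorphic_at f g)
    have "\<forall>\<^sub>\<approx>z\<in>UNIV. f z \<noteq> a" by (rule avoids_value_cosparse[OF f])
    moreover have "\<forall>\<^sub>\<approx>z\<in>UNIV. \<forall>t\<in>T. g z \<noteq> t"
      by (intro eventually_ball_finite[OF T] ballI avoids_value_cosparse[OF g])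
    ultimately show "\<forall>\<^sub>\<approx>z\<in>UNIV. norm (h z) * ((1 + norm (f z)) * (1 + norm (g z))) \<le> C ^ 4 * C1 * (1 + logderiv_sum T f z + logderiv_sum T g z) ^ 4"
      using rel size
    proof eventually_elim
      case (elim z)
      let ?X = "1 + norm (f z)" and ?L = "1 + logderiv_sum T f z + logderiv_sum T g z"
      obtain t where t: "t \<in> T" "norm (g z - t) * ?X \<le> C * norm (f z - a) ^ n" using ineq[OF elim(3)] by blast
      have fa: "0 < norm (f z - a) ^ n" using elim by simp
      have L: "logderiv_sum T g z \<le> ?L" "0 \<le> ?L" using logderiv_sum_nonneg[of T f z] logderiv_sum_nonneg[of T g z] by auto
      have "norm (deriv g z) \<le> logderiv_sum T g z * norm (g z - t)" using deriv_le_logderiv_sum[OF T t(1), of g z] elim t(1) by auto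
      also have "\<dots> \<le> ?L * norm (g z - t)" using L by (intro mult_right_mono) auto
      finally have "norm (deriv g z) * ?X \<le> ?L * norm (g z - t) * ?X" by (rule mult_right_mono) simp
      also have "\<dots> = ?L * (norm (g z - t) * ?X)" by simp
      also have "\<dots> \<le> ?L * (C * norm (f z - a) ^ n)" using t(2) L by (intro mult_left_mono) auto
      finally have "norm (deriv g z) / norm (f z - a) ^ n * ?X \<le> C * ?L" using fa by (simp add: field_simps)
      moreover have "norm (deriv g z * (1 / (f z - a)) ^ n) = norm (deriv g z) / norm (f z - a) ^ n"
        by (simp add: norm_mult norm_power norm_divide power_one_over field_simps)
      ultimately have 1: "norm (deriv g z * (1 / (f z - a)) ^ n) * ?X \<le> C * ?L" by simp
      from fourth_power_bound[OF 1 elim(4)] show ?case using C1 by (simp add: h_def norm_power)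
    qed
    fix z
    have size_at: "\<forall>\<^sub>F w in at z. 1 + norm (g w) \<le> C1 * (1 + norm (f w))" using size by (rule cosparse_imp_at)
    note fm = nicely_meromorphic_at(1)[OF f(1), of z] frequently_nonzero[OF f, where z = z and s = 0]
    note gm = nicely_meromorphic_at(1)[OF g(1), of z] frequently_nonzero[OF g, where z = z and s = 0]
    show "\<exists>K. \<forall>\<^sub>F w in at z. norm (h w) * ((1 + norm (f w)) * (1 + norm (g w))) \<le> K"
    proof (cases "is_pole f z")
      case True
      define q where "q = - zorder f z"
      have q: "2 \<le> q" using poles[OF True] by (simp add: q_def)
      have of: "order_ge f z (- q)" using order_ge_zorder(1)[OF fm] by (simp add: q_def)
      have og: "order_ge g z (- q)" using order_ge_dominated_at_pole[OF fm True size_at C1(1)] by (simp add: q_def)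
      have "order_ge h z (int 4 * ((- q - 1) + int n * q))"
        unfolding h_def
        by (intro order_ge_power order_ge_mult order_ge_deriv gm og) (use order_ge_inverse_shift[OF fm True, of a] in \<open>simp add: q_def\<close>)
      \<comment> \<open>For \<open>n = 2\<close> this reads \<open>2 * q \<le> 4 * (q - 1)\<close>; it holds exactly when \<open>q \<ge> 2\<close>.\<close>
      moreover have "q + q \<le> int 4 * ((- q - 1) + int n * q)"
      proof -
        have "2 * q \<le> int n * q" using n2 q by (intro mult_right_mono) auto
        moreover have "int 4 * ((- q - 1) + int n * q) = 4 * (int n * q) - 4 * q - 4" by simp
        ultimately show ?thesis using q by linarith
      qed
      ultimately have "order_ge h z (q + q)" by (rule order_ge_mono)
      thus ?thesis using of og q by (intro product_locally_bounded[of h z q q]) auto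
    next
      case False
      note reg = dominated_at_regular_point[OF f(1) False g(1) size_at C1(1)]
      have dg: "deriv g analytic_on {z}" and df: "deriv f analytic_on {z}" using reg by (auto intro: analytic_deriv)
      have o: "order_ge (\<lambda>w. deriv g w * (1 / (f w - a)) ^ n) z 0"
      proof (cases "f z = a")
        case fz: True
        have "poly p (g z) = K * poly p (f z)"
          by (rule analytic_eventually_eq_at) (use reg cosparse_imp_at[OF rel] in \<open>auto intro!: analytic_intros poly_analytic\<close>)
        hence "poly p (g z) = v" by (simp add: fz v_def)
        hence gz: "g z \<noteq> a" "g z \<noteq> b" using vv by auto
        have "(\<lambda>w. K * (f w - b) ^ m * deriv f w / ((g w - a) ^ n * (g w - b) ^ m)) analytic_on {z}"
          by (intro analytic_intros reg df) (use gz in auto)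
        hence "order_ge (\<lambda>w. K * (f w - b) ^ m * deriv f w / ((g w - a) ^ n * (g w - b) ^ m)) z 0" by (rule order_ge_analytic)
        moreover have ev: "\<forall>\<^sub>\<approx>w\<in>UNIV. K * (f w - b) ^ m * deriv f w / ((g w - a) ^ n * (g w - b) ^ m) = deriv g w * (1 / (f w - a)) ^ n"
          using differentiate_relation[OF f(1) g(1) rel] avoids_value_cosparse[OF f, of a]
            avoids_value_cosparse[OF g, of a] avoids_value_cosparse[OF g, of b]
        proof eventually_elim
          case (elim w)
          have nz: "(f w - a) ^ n \<noteq> 0" "(g w - a) ^ n * (g w - b) ^ m \<noteq> 0" using elim by auto
          have "K * (f w - b) ^ m * deriv f w / ((g w - a) ^ n * (g w - b) ^ m) = deriv g w / (f w - a) ^ n"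
            using elim(1) nz by (simp add: frac_eq_eq mult_ac)
          thus ?case by (simp add: power_one_over)
        qed
        ultimately show ?thesis using order_ge_cong[OF cosparse_imp_at[OF ev]] by blast
      next
        case fz: False
        have "(\<lambda>w. deriv g w * (1 / (f w - a)) ^ n) analytic_on {z}"
          by (intro analytic_intros reg dg) (use fz in auto)
        thus ?thesis by (rule order_ge_analytic)
      qed
      have "order_ge h z (int 4 * 0)" unfolding h_def by (intro order_ge_power o)
      thus ?thesis using order_ge_analytic[OF reg(2)] order_ge_analytic[OF reg(3)]
        by (intro product_locally_bounded[of h z 0 0]) auto
    qed
  qed
  with avoids_value_cosparse[OF f, of a] deriv_nonzero_cosparse[OF g] have "\<forall>\<^sub>\<approx>z\<in>(UNIV::complex set). False"
    by eventually_elim (auto simp: h_def)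
  thus False using not_cosparse_False by blast
qed

end

section \<open>Compositions that coincide\<close>

lemma far_point:
  fixes s :: complex and e :: real
  assumes "0 < e"
  obtains c where "0 < c" "\<And>w. e \<le> norm (w - s) \<Longrightarrow> c * (1 + norm w) \<le> norm (w - s)"
proof (rule that[of "e / (1 + norm s + e)"])
  have pos: "0 < 1 + norm s + e" using assms norm_ge_zero[of s] by linarith
  thus "0 < e / (1 + norm s + e)" using assms by simp
  fix w assume w: "e \<le> norm (w - s)"
  have "norm w \<le> norm (w - s) + norm s" using norm_triangle_ineq[of "w - s" s] by simp
  hence "e * (1 + norm w) \<le> e * (1 + norm s) + e * norm (w - s)" using assms mult_left_mono[of "1 + norm w" "1 + norm s + norm (w - s)" e] by (simp add: algebra_simps)
  also have "\<dots> \<le> norm (w - s) * (1 + norm s) + e * norm (w - s)" using w by (intro add_right_mono mult_right_mono) auto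
  also have "\<dots> = norm (w - s) * (1 + norm s + e)" by (simp add: algebra_simps)
  finally show "e / (1 + norm s + e) * (1 + norm w) \<le> norm (w - s)" using pos by (simp add: field_simps)
qed

context two_critical_points
begin

text \<open>
  Near a critical point the equation \<open>p(x) = p(y)\<close> makes \<open>x - a\<close> and \<open>y - a\<close> comparable, since their powers with exponent \<open>n + 1\<close>
  are. Hence \<open>|x - y|^N\<close> is at most a multiple of \<open>|y - a|^n\<close>, that is of \<open>|p'(y)|\<close>.
\<close>

lemma both_near_a:
  assumes N: "n \<le> N"
  obtains e C where "0 < e" "0 < C" "\<And>w. norm (w - a) < e \<Longrightarrow> norm (poly p w - poly p a) < norm (poly p a - poly p b) / 2"
    "\<And>x y. poly p x = poly p y \<Longrightarrow> norm (x - a) < e \<Longrightarrow> norm (y - a) < e \<Longrightarrow>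
       norm (x - y) ^ N * (1 + norm x)\<^sup>2 \<le> C * (norm (y - a) ^ n * norm (y - b) ^ m)"
proof -
  obtain R where R: "\<And>w. poly p w - poly p a = (w - a) ^ (n + 1) * poly R w" "poly R a \<noteq> 0" using factor_at_a by metis
  have "isCont (poly p) a" "isCont (poly R) a" by (auto intro: poly_isCont)
  hence "\<exists>d>0. \<forall>x. dist x a < d \<longrightarrow> dist (poly p x) (poly p a) < norm (poly p a - poly p b) / 2"
    "\<exists>d>0. \<forall>x. dist x a < d \<longrightarrow> dist (poly R x) (poly R a) < norm (poly R a) / 2"
    using critical_values_distinct R(2) unfolding continuous_at_eps_delta by (meson half_gt_zero zero_less_norm_iff right_minus_eq)+
  then obtain d1 d2 where d: "d1 > 0" "d2 > 0" "\<And>x. norm (x - a) < d1 \<Longrightarrow> norm (poly p x - poly p a) < norm (poly p a - poly p b) / 2"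
    "\<And>x. norm (x - a) < d2 \<Longrightarrow> norm (poly R x - poly R a) < norm (poly R a) / 2"
    unfolding dist_norm by blast
  define e where "e = min (min d1 d2) (min 1 (norm (a - b) / 2))"
  have e: "0 < e" "e \<le> d1" "e \<le> d2" "e \<le> 1" "e \<le> norm (a - b) / 2" using d(1,2) ab by (auto simp: e_def)
  have Rb: "norm (poly R a) / 2 \<le> norm (poly R w)" "norm (poly R w) \<le> 2 * norm (poly R a)" if "norm (w - a) < e" for w
  proof -
    have "norm (poly R w - poly R a) < norm (poly R a) / 2" using d(4)[of w] that e by simp
    thus "norm (poly R a) / 2 \<le> norm (poly R w)" "norm (poly R w) \<le> 2 * norm (poly R a)"
      using norm_triangle_ineq2[of "poly R a" "poly R w"] norm_triangle_ineq2[of "poly R w" "poly R a"] norm_ge_zero[of "poly R a"]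
      by (auto simp: norm_minus_commute)
  qed
  define C where "C = 5 ^ N * (2 + norm a)\<^sup>2 / (norm (a - b) / 2) ^ m"
  have ab': "0 < norm (a - b) / 2" using ab by simp
  show ?thesis
  proof (rule that[of e C])
    show "0 < e" by (rule e)
    show "0 < C" unfolding C_def using ab' by (intro divide_pos_pos mult_pos_pos zero_less_power) (auto intro: add_pos_nonneg)
    show "norm (poly p w - poly p a) < norm (poly p a - poly p b) / 2" if "norm (w - a) < e" for w
      using d(3)[of w] that e by simp
    fix x y assume eq: "poly p x = poly p y" and x: "norm (x - a) < e" and y: "norm (y - a) < e"
    have Ra: "0 < norm (poly R a)" using R(2) by simp
    have "norm (x - a) ^ (n + 1) * (norm (poly R a) / 2) \<le> norm (x - a) ^ (n + 1) * norm (poly R x)"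
      using Rb(1)[OF x] by (intro mult_left_mono) auto
    also have "\<dots> = norm (poly p x - poly p a)" unfolding R(1) by (simp only: norm_mult norm_power)
    also have "\<dots> = norm (poly p y - poly p a)" using eq by simp
    also have "\<dots> = norm (y - a) ^ (n + 1) * norm (poly R y)" unfolding R(1) by (simp only: norm_mult norm_power)
    also have "\<dots> \<le> norm (y - a) ^ (n + 1) * (2 * norm (poly R a))" using Rb(2)[OF y] by (intro mult_left_mono) auto
    finally have "norm (x - a) ^ (n + 1) * (norm (poly R a) / 2) \<le> norm (y - a) ^ (n + 1) * (2 * norm (poly R a))" .
    hence "norm (x - a) ^ (n + 1) \<le> 4 * norm (y - a) ^ (n + 1)" using Ra by (simp add: field_simps)
    also have "\<dots> \<le> 4 ^ (n + 1) * norm (y - a) ^ (n + 1)" using power_increasing[of 1 "n + 1" "4::real"] by (intro mult_right_mono) auto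
    finally have "norm (x - a) ^ Suc n \<le> (4 * norm (y - a)) ^ Suc n"
      unfolding power_mult_distrib by (simp del: power_Suc)
    hence "norm (x - a) \<le> 4 * norm (y - a)" by (rule power_le_imp_le_base) simp
    hence xy: "norm (x - y) \<le> 5 * norm (y - a)" using norm_triangle_ineq4[of "x - a" "y - a"] by simp
    have y1: "norm (y - a) \<le> 1" using y e by simp
    have xb: "1 + norm x \<le> 2 + norm a" using norm_triangle_ineq[of "x - a" a] x e by simp
    have "norm (a - b) / 2 \<le> norm (y - b)"
      using norm_triangle_ineq4[of "y - b" "y - a"] y e(5) by simp
    hence yb: "(norm (a - b) / 2) ^ m \<le> norm (y - b) ^ m" using ab' by (intro power_mono) auto
    have "norm (x - y) ^ N * (1 + norm x)\<^sup>2 \<le> (5 * norm (y - a)) ^ N * (2 + norm a)\<^sup>2"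
      using xy xb by (intro mult_mono power_mono) auto
    also have "\<dots> = 5 ^ N * (2 + norm a)\<^sup>2 * norm (y - a) ^ N" by (simp add: power_mult_distrib)
    also have "\<dots> \<le> 5 ^ N * (2 + norm a)\<^sup>2 * norm (y - a) ^ n"
      using y1 N by (intro mult_left_mono power_decreasing) auto
    also have "\<dots> = C * (norm (y - a) ^ n * (norm (a - b) / 2) ^ m)" using ab' by (simp add: C_def)
    also have "\<dots> \<le> C * (norm (y - a) ^ n * norm (y - b) ^ m)"
      using yb \<open>0 < C\<close> by (intro mult_left_mono) auto
    finally show "norm (x - y) ^ N * (1 + norm x)\<^sup>2 \<le> C * (norm (y - a) ^ n * norm (y - b) ^ m)" .
  qed
qed

text \<open>
  On the curve \<open>p(x) = p(y)\<close> the quantity \<open>|x - y|^N (1 + |x|)\<^sup>2\<close> is bounded by a multiple of \<open>|p'(y)|\<close> or of \<open>|p'(x)|\<close>. When one of the points is far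
  from both critical points, this is a comparison of degrees, \<open>N + 2 \<le> n + m\<close>. Otherwise both points are near the same
  critical point, because the two critical values differ.
\<close>

lemma curve_estimate:
  assumes n2: "2 \<le> n" "2 \<le> m" and N: "N = max n m"
  obtains C where "0 < C" "\<And>x y. poly p x = poly p y \<Longrightarrow>
      norm (x - y) ^ N * (1 + norm x)\<^sup>2 \<le> C * (norm (y - a) ^ n * norm (y - b) ^ m) \<or>
      norm (x - y) ^ N * (1 + norm x)\<^sup>2 \<le> C * (norm (x - a) ^ n * norm (x - b) ^ m)"
proof -
  interpret s: two_critical_points b a m n p by (rule swap)
  obtain C0 where C0: "1 \<le> C0" "\<And>x y. poly p x = 1 * poly p y \<Longrightarrow> 1 + norm x \<le> C0 * (1 + norm y)" using comparable_size[of 1] by metis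
  have NN: "n \<le> N" "m \<le> N" "N + 2 \<le> n + m" using N n2 by auto
  obtain e1 C1 where A: "0 < e1" "0 < C1" "\<And>w. norm (w - a) < e1 \<Longrightarrow> norm (poly p w - poly p a) < norm (poly p a - poly p b) / 2"
    "\<And>x y. poly p x = poly p y \<Longrightarrow> norm (x - a) < e1 \<Longrightarrow> norm (y - a) < e1 \<Longrightarrow>
       norm (x - y) ^ N * (1 + norm x)\<^sup>2 \<le> C1 * (norm (y - a) ^ n * norm (y - b) ^ m)" using both_near_a[OF NN(1)] by metis
  obtain e2 C2 where B: "0 < e2" "0 < C2" "\<And>w. norm (w - b) < e2 \<Longrightarrow> norm (poly p w - poly p b) < norm (poly p b - poly p a) / 2"
    "\<And>x y. poly p x = poly p y \<Longrightarrow> norm (x - b) < e2 \<Longrightarrow> norm (y - b) < e2 \<Longrightarrow>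
       norm (x - y) ^ N * (1 + norm x)\<^sup>2 \<le> C2 * (norm (y - b) ^ m * norm (y - a) ^ n)" using s.both_near_a[OF NN(2)] by metis
  obtain ca where ca: "0 < ca" "\<And>w. e1 \<le> norm (w - a) \<Longrightarrow> ca * (1 + norm w) \<le> norm (w - a)" using far_point[OF A(1)] by metis
  obtain cb where cb: "0 < cb" "\<And>w. e2 \<le> norm (w - b) \<Longrightarrow> cb * (1 + norm w) \<le> norm (w - b)" using far_point[OF B(1)] by metis
  define C3 where "C3 = (1 + C0) ^ N * C0\<^sup>2 / (ca ^ n * cb ^ m)"
  have C3: "0 < C3" unfolding C3_def using ca cb C0 by simp
  have far: "norm (x - y) ^ N * (1 + norm x)\<^sup>2 \<le> C3 * (norm (w - a) ^ n * norm (w - b) ^ m)"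
    if w: "e1 \<le> norm (w - a)" "e2 \<le> norm (w - b)" and x: "1 + norm x \<le> C0 * (1 + norm w)" and xy: "norm (x - y) \<le> (1 + C0) * (1 + norm w)" for x y w :: complex
  proof -
    let ?W = "1 + norm w"
    have "norm (x - y) ^ N * (1 + norm x)\<^sup>2 \<le> ((1 + C0) * ?W) ^ N * (C0 * ?W)\<^sup>2"
      using x xy C0(1) by (intro mult_mono power_mono) auto
    also have "\<dots> = (1 + C0) ^ N * C0\<^sup>2 * ?W ^ (N + 2)" by (simp add: power_mult_distrib power_add power2_eq_square)
    also have "\<dots> \<le> (1 + C0) ^ N * C0\<^sup>2 * ?W ^ (n + m)" using NN C0 by (intro mult_left_mono power_increasing) auto
    also have "\<dots> = C3 * ((ca * ?W) ^ n * (cb * ?W) ^ m)" using ca cb by (simp add: C3_def power_mult_distrib power_add)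
    also have "\<dots> \<le> C3 * (norm (w - a) ^ n * norm (w - b) ^ m)"
      using C3 ca cb w by (intro mult_left_mono mult_mono power_mono) auto
    finally show ?thesis .
  qed
  define C where "C = C1 + C2 + C3"
  have Cs: "0 < C" "C1 \<le> C" "C2 \<le> C" "C3 \<le> C" using A B C3 by (auto simp: C_def)
  show ?thesis
  proof (rule that[OF Cs(1)])
    fix x y assume eq: "poly p x = poly p y"
    have xle: "1 + norm x \<le> C0 * (1 + norm y)" and yle: "1 + norm y \<le> C0 * (1 + norm x)" using C0(2)[of x y] C0(2)[of y x] eq by auto
    have tri: "norm (x - y) \<le> norm x + norm y" by (rule norm_triangle_ineq4)
    have up: "C' * (norm (w - a) ^ n * norm (w - b) ^ m) \<le> C * (norm (w - a) ^ n * norm (w - b) ^ m)" if "C' \<le> C" for C' w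
      using that by (intro mult_right_mono) auto
    show "norm (x - y) ^ N * (1 + norm x)\<^sup>2 \<le> C * (norm (y - a) ^ n * norm (y - b) ^ m) \<or>
      norm (x - y) ^ N * (1 + norm x)\<^sup>2 \<le> C * (norm (x - a) ^ n * norm (x - b) ^ m)"
    proof (cases "(e1 \<le> norm (y - a) \<and> e2 \<le> norm (y - b)) \<or> (e1 \<le> norm (x - a) \<and> e2 \<le> norm (x - b))")
      case True
      thus ?thesis
      proof
        assume w: "e1 \<le> norm (y - a) \<and> e2 \<le> norm (y - b)"
        have "norm (x - y) \<le> (1 + C0) * (1 + norm y)" using tri xle by (simp add: algebra_simps)
        from far[of y x y] w xle this up[OF Cs(4), of y] show ?thesis by auto
      next
        assume w: "e1 \<le> norm (x - a) \<and> e2 \<le> norm (x - b)"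
        have "norm (x - y) \<le> (1 + C0) * (1 + norm x)" using tri yle by (simp add: algebra_simps)
        moreover have "1 + norm x \<le> C0 * (1 + norm x)" using C0(1) mult_right_mono[of 1 C0 "1 + norm x"] by simp
        ultimately show ?thesis using far[of x x y] w up[OF Cs(4), of x] by auto
      qed
    next
      case False
      have no: "\<not> (norm (u - a) < e1 \<and> norm (u' - b) < e2)" if "poly p u = poly p u'" for u u'
      proof
        assume "norm (u - a) < e1 \<and> norm (u' - b) < e2"
        hence "norm (poly p u - poly p a) < norm (poly p a - poly p b) / 2" "norm (poly p u' - poly p b) < norm (poly p a - poly p b) / 2"
          using A(3)[of u] B(3)[of u'] by (auto simp: norm_minus_commute)
        moreover have "norm (poly p a - poly p b) \<le> norm (poly p u - poly p a) + norm (poly p u' - poly p b)"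
          using norm_triangle_ineq4[of "poly p u' - poly p b" "poly p u - poly p a"] that by simp
        ultimately show False by linarith
      qed
      have "norm (x - a) < e1 \<and> norm (y - a) < e1 \<or> norm (x - b) < e2 \<and> norm (y - b) < e2"
        using False no[of x y] no[of y x] eq by auto
      thus ?thesis
        using A(4)[OF eq] B(4)[OF eq] up[OF Cs(2), of y] up[OF Cs(3), of y] by (auto simp: mult.commute[of "norm (y - b) ^ m"])
    qed
  qed
qed

text \<open>
  From \<open>p(g) = p(f)\<close> it follows that \<open>(f - a)^(n + 1)\<close> equals \<open>(g - a)^(n + 1)\<close> up to a non-vanishing factor, and so \<open>f - a\<close>
  vanishes at least to the order \<open>j\<close> of \<open>g - a\<close>.
\<close>

lemma orders_at_common_critical_point:
  assumes f: "f analytic_on {z}" "f z = a" "\<exists>\<^sub>F w in at z. f w \<noteq> a"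
    and g: "g analytic_on {z}" "g z = a" "\<exists>\<^sub>F w in at z. g w \<noteq> a"
    and eq: "\<forall>\<^sub>F w in at z. poly p (g w) = poly p (f w)"
  obtains j where "1 \<le> j" "order_ge (\<lambda>w. f w - a) z j" "order_ge (\<lambda>w. g w - a) z j" "order_ge (\<lambda>w. 1 / (g w - a)) z (- j)" "order_ge (deriv f) z (j - 1)"
proof -
  obtain R where R: "\<And>w. poly p w - poly p a = (w - a) ^ (n + 1) * poly R w" "poly R a \<noteq> 0" using factor_at_a by metis
  let ?f = "\<lambda>w. f w - a" and ?g = "\<lambda>w. g w - a"
  have fa: "?f analytic_on {z}" "?f meromorphic_on {z}" "\<exists>\<^sub>F w in at z. ?f w \<noteq> 0"
    and ga: "?g analytic_on {z}" "?g meromorphic_on {z}" "\<exists>\<^sub>F w in at z. ?g w \<noteq> 0"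
    using f g by (auto intro!: analytic_intros analytic_on_imp_meromorphic_on)
  define j where "j = zorder ?g z"
  have "0 < j" unfolding j_def using zorder_pos_iff'[OF ga(1,3)] g(2) by simp
  hence j: "1 \<le> j" by simp
  have Rf: "(\<lambda>w. poly R (f w)) analytic_on {z}" "(\<lambda>w. poly R (g w)) analytic_on {z}" using f g by (auto intro: poly_analytic)
  have "(\<lambda>w. poly R (f w)) \<midarrow>z\<rightarrow> poly R (f z)" using Rf(1) analytic_at_imp_isCont isContD by blast
  hence evR: "\<forall>\<^sub>F w in at z. poly R (f w) \<noteq> 0" using R(2) f(2) by (intro tendsto_imp_eventually_ne) auto
  have "order_ge (\<lambda>w. ?g w ^ (n + 1) * (poly R (g w) / poly R (f w))) z (int (n + 1) * j + 0)"
    by (intro order_ge_mult order_ge_power order_ge_analytic analytic_intros Rf) (use order_ge_zorder(1)[OF ga(2,3)] R(2) f(2) in \<open>auto simp: j_def\<close>)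
  moreover have "\<forall>\<^sub>F w in at z. ?g w ^ (n + 1) * (poly R (g w) / poly R (f w)) = ?f w ^ (n + 1)"
    using evR eq
  proof eventually_elim
    case (elim w)
    have "?g w ^ (n + 1) * poly R (g w) = ?f w ^ (n + 1) * poly R (f w)" using R(1)[of "g w"] R(1)[of "f w"] elim by simp
    thus ?case using elim(1) by (simp add: field_simps)
  qed
  ultimately have "order_ge (\<lambda>w. ?f w ^ (n + 1)) z (int (n + 1) * j)" using order_ge_cong by fastforce
  moreover have "(\<lambda>w. ?f w ^ (n + 1)) meromorphic_on {z}" by (intro meromorphic_intros fa)
  moreover have "\<exists>\<^sub>F w in at z. ?f w ^ (n + 1) \<noteq> 0" using fa(3) by (rule frequently_elim1) auto
  ultimately have "int (n + 1) * j \<le> zorder (\<lambda>w. ?f w ^ (n + 1)) z" by (rule zorder_ge_if_order_ge[rotated 2])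
  also have "\<dots> = int (n + 1) * zorder ?f z" by (rule zorder_power[OF fa(2,3)])
  finally have "j \<le> zorder ?f z" by (simp add: mult_le_cancel_left)
  hence of: "order_ge ?f z j" by (intro order_ge_mono[OF order_ge_zorder(1)[OF fa(2,3)]])
  have "order_ge (deriv f) z (j - 1)" using order_ge_deriv[OF fa(2,3) of] order_ge_cong[OF deriv_minus_const_near[OF f(1)]] by simp
  thus ?thesis using that[OF j of] order_ge_zorder(1,2)[OF ga(2,3)] by (simp add: j_def)
qed

text \<open>
  By differentiating \<open>p(f) = p(g)\<close>, the function \<open>\<kappa> = f'/p'(g)\<close> equals \<open>g'/p'(f)\<close>, and one may use whichever of the two
  denominators \<open>curve_estimate\<close> provides. The factor \<open>(f - g)^N\<close> removes the poles of \<open>\<kappa>\<close> at common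
  \<open>a\<close>-points and common \<open>b\<close>-points of \<open>f\<close> and \<open>g\<close>; elsewhere one of the two expressions for \<open>\<kappa>\<close> is regular. At a pole of order \<open>q\<close> the
  product vanishes to the order \<open>(n + m - N - 1) q - 1 \<ge> q - 1\<close>. If \<open>f\<close> and \<open>g\<close> were different,
  the product would not be zero, contrary to the vanishing principle.
\<close>

theorem uniqueness_polynomial:
  assumes f: "f nicely_meromorphic_on UNIV" "\<not> f constant_on UNIV"
    and g: "g nicely_meromorphic_on UNIV" "\<not> g constant_on UNIV"
    and poles: "\<And>z. is_pole f z \<Longrightarrow> zorder f z \<le> -2"
    and rel: "\<forall>\<^sub>\<approx>z\<in>UNIV. poly p (g z) = poly p (f z)" and n2: "2 \<le> n" "2 \<le> m"
  shows "f = g"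
proof (rule ccontr)
  assume neq: "f \<noteq> g"
  interpret s: two_critical_points b a m n p by (rule swap)
  define N where "N = max n m"
  have NN: "n \<le> N" "m \<le> N" "N + 2 \<le> n + m" using n2 by (auto simp: N_def)
  obtain C0 where C0: "1 \<le> C0" "\<And>x y. poly p x = 1 * poly p y \<Longrightarrow> 1 + norm x \<le> C0 * (1 + norm y)" using comparable_size[of 1] by metis
  obtain C where C: "0 < C" "\<And>x y. poly p x = poly p y \<Longrightarrow>
      norm (x - y) ^ N * (1 + norm x)\<^sup>2 \<le> C * (norm (y - a) ^ n * norm (y - b) ^ m) \<or>
      norm (x - y) ^ N * (1 + norm x)\<^sup>2 \<le> C * (norm (x - a) ^ n * norm (x - b) ^ m)"
    using curve_estimate[OF n2 N_def] by metis
  have rel1: "\<forall>\<^sub>\<approx>z\<in>UNIV. poly p (g z) = 1 * poly p (f z)" using rel by simp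
  have drel: "\<forall>\<^sub>\<approx>z\<in>UNIV. (g z - a) ^ n * (g z - b) ^ m * deriv g z = (f z - a) ^ n * (f z - b) ^ m * deriv f z"
    using differentiate_relation[OF f(1) g(1) rel1] by simp
  have size: "\<forall>\<^sub>\<approx>z\<in>UNIV. 1 + norm (g z) \<le> C0 * (1 + norm (f z))" using rel1 by eventually_elim (rule C0(2))
  have size': "\<forall>\<^sub>\<approx>z\<in>UNIV. 1 + norm (f z) \<le> C0 * (1 + norm (g z))" using rel by eventually_elim (rule C0(2), simp)
  have fg: "\<forall>\<^sub>\<approx>z\<in>UNIV. f z - g z \<noteq> 0"
  proof -
    have "(\<lambda>z. f z - g z) meromorphic_on UNIV" by (intro meromorphic_intros nicely_meromorphic_at f g)
    from meromorphic_imp_constant_or_avoid[OF this, of 0]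
    show ?thesis using nicely_meromorphic_eqI[OF f(1) g(1)] neq by auto
  qed
  define \<kappa> where "\<kappa> = (\<lambda>z. deriv f z * (1 / (g z - a)) ^ n * (1 / (g z - b)) ^ m)"
  define h where "h = (\<lambda>z. ((f z - g z) ^ N * \<kappa> z) ^ 4)"
  have avoid: "\<forall>\<^sub>\<approx>z\<in>UNIV. f z \<noteq> a \<and> f z \<noteq> b \<and> g z \<noteq> a \<and> g z \<noteq> b"
    using avoids_value_cosparse[OF f, of a] avoids_value_cosparse[OF f, of b]
      avoids_value_cosparse[OF g, of a] avoids_value_cosparse[OF g, of b] by eventually_elim simp
  have \<kappa>_alt: "\<forall>\<^sub>\<approx>z\<in>UNIV. \<kappa> z = deriv g z * (1 / (f z - a)) ^ n * (1 / (f z - b)) ^ m"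
    using avoid drel
  proof eventually_elim
    case (elim z)
    have "(g z - a) ^ n * (g z - b) ^ m \<noteq> 0" "(f z - a) ^ n * (f z - b) ^ m \<noteq> 0" using elim by auto
    hence "deriv f z / ((g z - a) ^ n * (g z - b) ^ m) = deriv g z / ((f z - a) ^ n * (f z - b) ^ m)"
      using elim(2) by (simp add: frac_eq_eq mult_ac)
    thus ?case by (simp add: \<kappa>_def power_one_over)
  qed
  define C' where "C' = (1 + norm a) * C0 * C"
  have "\<forall>\<^sub>\<approx>z\<in>UNIV. h z = 0"
  proof (rule small_meromorphic_function_vanishes[OF f g, of h "{a}" "C' ^ 4 * C0" 4])
    show "h meromorphic_on UNIV" unfolding h_def \<kappa>_def by (intro meromorphic_intros nicely_meromorphic_at f g)
    show "\<forall>\<^sub>\<approx>z\<in>UNIV. norm (h z) * ((1 + norm (f z)) * (1 + norm (g z))) \<le> C' ^ 4 * C0 * (1 + logderiv_sum {a} f z + logderiv_sum {a} g z) ^ 4"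
      using rel size avoid \<kappa>_alt
    proof eventually_elim
      case (elim z)
      let ?X = "1 + norm (f z)" and ?L = "1 + logderiv_sum {a} f z + logderiv_sum {a} g z" and ?d = "norm (f z - g z) ^ N"
      have L: "logderiv_sum {a} f z \<le> ?L" "logderiv_sum {a} g z \<le> ?L" "0 \<le> ?L" using logderiv_sum_nonneg[of "{a}" f z] logderiv_sum_nonneg[of "{a}" g z] by auto
      have na: "norm (w - a) \<le> (1 + norm a) * (1 + norm w)" for w
      proof -
        have "norm (w - a) \<le> norm w + norm a" by (rule norm_triangle_ineq4)
        moreover have "(1 + norm a) * (1 + norm w) = 1 + norm a + norm w + norm a * norm w" by (simp add: algebra_simps)
        moreover have "0 \<le> norm a * norm w" by simp
        ultimately show ?thesis by linarith
      qed
      have df: "norm (deriv f z) \<le> (1 + norm a) * C0 * ?L * ?X"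
      proof -
        have "norm (deriv f z) \<le> logderiv_sum {a} f z * norm (f z - a)" using deriv_le_logderiv_sum[of "{a}" a f z] elim by auto
        also have "\<dots> \<le> ?L * ((1 + norm a) * ?X)" using L na logderiv_sum_nonneg by (intro mult_mono) auto
        also have "\<dots> \<le> ?L * ((1 + norm a) * (C0 * ?X))" using L C0(1) mult_right_mono[of 1 C0 ?X] by (intro mult_left_mono) auto
        finally show ?thesis by (simp add: mult_ac)
      qed
      have dg: "norm (deriv g z) \<le> (1 + norm a) * C0 * ?L * ?X"
      proof -
        have "norm (deriv g z) \<le> logderiv_sum {a} g z * norm (g z - a)" using deriv_le_logderiv_sum[of "{a}" a g z] elim by auto
        also have "\<dots> \<le> ?L * ((1 + norm a) * (1 + norm (g z)))" using L na logderiv_sum_nonneg by (intro mult_mono) auto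
        also have "\<dots> \<le> ?L * ((1 + norm a) * (C0 * ?X))" using L elim(2) by (intro mult_left_mono) auto
        finally show ?thesis by (simp add: mult_ac)
      qed
      have core: "?d * (D * ?X) \<le> C' * ?L"
        if D: "D = u / q" "0 < q" "?d * ?X\<^sup>2 \<le> C * q" "u \<le> (1 + norm a) * C0 * ?L * ?X" for D u q
      proof -
        have "?d * (D * ?X) = u * (?d * ?X) / q" by (simp add: D(1))
        also have "\<dots> \<le> ((1 + norm a) * C0 * ?L * ?X) * (?d * ?X) / q"
          using D by (intro divide_right_mono mult_right_mono) auto
        also have "\<dots> = (1 + norm a) * C0 * ?L * (?d * ?X\<^sup>2) / q" by (simp add: power2_eq_square)
        also have "\<dots> \<le> (1 + norm a) * C0 * ?L * (C * q) / q"
          using D L C0 by (intro divide_right_mono mult_left_mono) auto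
        also have "\<dots> = C' * ?L" using D(2) by (simp add: C'_def)
        finally show ?thesis .
      qed
      have "?d * (norm (\<kappa> z) * ?X) \<le> C' * ?L"
        using C(2)[OF elim(1)[symmetric]]
      proof
        assume a: "?d * ?X\<^sup>2 \<le> C * (norm (g z - a) ^ n * norm (g z - b) ^ m)"
        have "norm (\<kappa> z) = norm (deriv f z) / (norm (g z - a) ^ n * norm (g z - b) ^ m)"
          by (simp add: \<kappa>_def norm_mult norm_power norm_divide power_one_over)
        moreover have "0 < norm (g z - a) ^ n * norm (g z - b) ^ m" using elim by simp
        ultimately show ?thesis using a df by (rule core)
      next
        assume a: "?d * ?X\<^sup>2 \<le> C * (norm (f z - a) ^ n * norm (f z - b) ^ m)"
        have "norm (\<kappa> z) = norm (deriv g z) / (norm (f z - a) ^ n * norm (f z - b) ^ m)"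
          by (simp add: elim(4) norm_mult norm_power norm_divide power_one_over)
        moreover have "0 < norm (f z - a) ^ n * norm (f z - b) ^ m" using elim by simp
        ultimately show ?thesis using a dg by (rule core)
      qed
      hence "norm ((f z - g z) ^ N * \<kappa> z) * ?X \<le> C' * ?L" by (simp add: norm_mult norm_power mult.assoc)
      from fourth_power_bound[OF this elim(2)] show ?case using C0 by (simp add: h_def norm_power)
    qed
    fix z
    have size_at: "\<forall>\<^sub>F w in at z. 1 + norm (g w) \<le> C0 * (1 + norm (f w))" using size by (rule cosparse_imp_at)
    have size_at': "\<forall>\<^sub>F w in at z. 1 + norm (f w) \<le> C0 * (1 + norm (g w))" using size' by (rule cosparse_imp_at)
    note fm = nicely_meromorphic_at(1)[OF f(1), of z] frequently_nonzero[OF f, where z = z and s = 0]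
    note gm = nicely_meromorphic_at(1)[OF g(1), of z] frequently_nonzero[OF g, where z = z and s = 0]
    show "\<exists>K. \<forall>\<^sub>F w in at z. norm (h w) * ((1 + norm (f w)) * (1 + norm (g w))) \<le> K"
    proof (cases "is_pole f z")
      case True
      have gpole: "is_pole g z"
        using dominated_at_regular_point(1)[OF g(1) _ f(1) size_at' C0(1)] True by blast
      define q where "q = - zorder f z"
      have q: "2 \<le> q" using poles[OF True] by (simp add: q_def)
      have of: "order_ge f z (- q)" using order_ge_zorder(1)[OF fm] by (simp add: q_def)
      have og: "order_ge g z (- q)" using order_ge_dominated_at_pole[OF fm True size_at C0(1)] by (simp add: q_def)
      have "zorder g z \<le> - q"
        using zorder_ge_if_order_ge[OF fm order_ge_dominated_at_pole[OF gm gpole size_at' C0(1)]] by (simp add: q_def)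
      hence inv: "order_ge (\<lambda>w. 1 / (g w - t)) z q" for t
        by (intro order_ge_mono[OF order_ge_inverse_shift[OF gm gpole]]) auto
      have "order_ge h z (int 4 * (int N * (- q) + ((- q - 1) + int n * q + int m * q)))"
        unfolding h_def \<kappa>_def
        by (intro order_ge_power order_ge_mult order_ge_deriv order_ge_diff fm of og inv)
      moreover have "q + q \<le> int 4 * (int N * (- q) + ((- q - 1) + int n * q + int m * q))"
      proof -
        \<comment> \<open>The claim reduces to \<open>2 * q \<le> 4 * (q - 1)\<close>, hence again to \<open>q \<ge> 2\<close>.\<close>
        have "(int N + 2) * q \<le> (int n + int m) * q" using NN(3) q by (intro mult_right_mono) auto
        hence "int N * q + 2 * q \<le> int n * q + int m * q" by (simp add: distrib_right)
        thus ?thesis using q by simp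
      qed
      ultimately have "order_ge h z (q + q)" by (rule order_ge_mono)
      thus ?thesis using of og q by (intro product_locally_bounded[of h z q q]) auto
    next
      case False
      note reg = dominated_at_regular_point[OF f(1) False g(1) size_at C0(1)]
      have dg: "deriv g analytic_on {z}" and df: "deriv f analytic_on {z}" using reg by (auto intro: analytic_deriv)
      have eqz: "poly p (g z) = poly p (f z)"
        by (rule analytic_eventually_eq_at) (use reg cosparse_imp_at[OF rel] in \<open>auto intro!: analytic_intros poly_analytic\<close>)
      have o: "order_ge (\<lambda>w. (f w - g w) ^ N * \<kappa> w) z 0"
      proof -
        consider (1) "g z \<noteq> a" "g z \<noteq> b" | (2) "f z \<noteq> a" "f z \<noteq> b" | (3) "f z = a" "g z = a" | (4) "f z = b" "g z = b"
          using eqz critical_values_distinct by metis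
        thus ?thesis
        proof cases
          case 1
          have "(\<lambda>w. (f w - g w) ^ N * \<kappa> w) analytic_on {z}"
            unfolding \<kappa>_def by (intro analytic_intros reg df) (use 1 in auto)
          thus ?thesis by (rule order_ge_analytic)
        next
          case 2
          have "(\<lambda>w. (f w - g w) ^ N * (deriv g w * (1 / (f w - a)) ^ n * (1 / (f w - b)) ^ m)) analytic_on {z}"
            by (intro analytic_intros reg dg) (use 2 in auto)
          hence "order_ge (\<lambda>w. (f w - g w) ^ N * (deriv g w * (1 / (f w - a)) ^ n * (1 / (f w - b)) ^ m)) z 0" by (rule order_ge_analytic)
          moreover have ev: "\<forall>\<^sub>F w in at z. (f w - g w) ^ N * (deriv g w * (1 / (f w - a)) ^ n * (1 / (f w - b)) ^ m) = (f w - g w) ^ N * \<kappa> w"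
            using cosparse_imp_at[OF \<kappa>_alt, of z] by eventually_elim simp
          ultimately show ?thesis using order_ge_cong[OF ev] by blast
        next
          case 3
          obtain j where j: "1 \<le> j" "order_ge (\<lambda>w. f w - a) z j" "order_ge (\<lambda>w. g w - a) z j" "order_ge (\<lambda>w. 1 / (g w - a)) z (- j)" "order_ge (deriv f) z (j - 1)"
            using orders_at_common_critical_point[OF reg(2) 3(1) frequently_nonzero[OF f] reg(3) 3(2) frequently_nonzero[OF g] cosparse_imp_at[OF rel]] by metis
          have "order_ge (\<lambda>w. (f w - a) - (g w - a)) z j" by (intro order_ge_diff j)
          hence d: "order_ge (\<lambda>w. f w - g w) z j" by simp
          have "(\<lambda>w. 1 / (g w - b)) analytic_on {z}" by (intro analytic_intros reg) (use 3 ab in auto)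
          hence "order_ge (\<lambda>w. (f w - g w) ^ N * \<kappa> w) z (int N * j + ((j - 1) + int n * (- j) + int m * 0))"
            unfolding \<kappa>_def by (intro order_ge_mult order_ge_power d j order_ge_analytic)
          moreover have "0 \<le> int N * j + ((j - 1) + int n * (- j) + int m * 0)"
          proof -
            have "int n * j \<le> int N * j" using NN j by (intro mult_right_mono) auto
            thus ?thesis using j(1) unfolding mult_minus_right mult_zero_right by linarith
          qed
          ultimately show ?thesis by (rule order_ge_mono)
        next
          case 4
          obtain j where j: "1 \<le> j" "order_ge (\<lambda>w. f w - b) z j" "order_ge (\<lambda>w. g w - b) z j" "order_ge (\<lambda>w. 1 / (g w - b)) z (- j)" "order_ge (deriv f) z (j - 1)"
            using s.orders_at_common_critical_point[OF reg(2) 4(1) frequently_nonzero[OF f] reg(3) 4(2) frequently_nonzero[OF g] cosparse_imp_at[OF rel]] by metis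
          have "order_ge (\<lambda>w. (f w - b) - (g w - b)) z j" by (intro order_ge_diff j)
          hence d: "order_ge (\<lambda>w. f w - g w) z j" by simp
          have "(\<lambda>w. 1 / (g w - a)) analytic_on {z}" by (intro analytic_intros reg) (use 4 ab in auto)
          hence "order_ge (\<lambda>w. (f w - g w) ^ N * \<kappa> w) z (int N * j + ((j - 1) + int n * 0 + int m * (- j)))"
            unfolding \<kappa>_def by (intro order_ge_mult order_ge_power d j order_ge_analytic)
          moreover have "0 \<le> int N * j + ((j - 1) + int n * 0 + int m * (- j))"
          proof -
            have "int m * j \<le> int N * j" using NN j by (intro mult_right_mono) auto
            thus ?thesis using j(1) unfolding mult_minus_right mult_zero_right by linarith
          qed
          ultimately show ?thesis by (rule order_ge_mono)
        qed
      qed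
      have "order_ge h z (int 4 * 0)" unfolding h_def by (intro order_ge_power o)
      thus ?thesis using order_ge_analytic[OF reg(2)] order_ge_analytic[OF reg(3)]
        by (intro product_locally_bounded[of h z 0 0]) auto
    qed
  qed auto
  with avoid fg deriv_nonzero_cosparse[OF f] have "\<forall>\<^sub>\<approx>z\<in>(UNIV::complex set). False"
    by eventually_elim (auto simp: h_def \<kappa>_def)
  thus False using not_cosparse_False by blast
qed

end

section \<open>The pre-Schwarzian derivatives of the reciprocal compositions\<close>

lemma poly_meromorphic: "f meromorphic_on A \<Longrightarrow> (\<lambda>w. poly p (f w)) meromorphic_on A"
  by (induction p) (auto intro!: meromorphic_intros)

lemma logderiv_factor:
  assumes "r > 0" "u holomorphic_on ball z r" "\<And>w. w \<in> ball z r \<Longrightarrow> u w \<noteq> 0"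
    and \<Phi>: "\<And>w. w \<in> ball z r - {z} \<Longrightarrow> \<Phi> w = u w * (w - z) powi k" and w: "w \<in> ball z r - {z}"
  shows "deriv \<Phi> w = (deriv u w * (w - z) + of_int k * u w) * (w - z) powi (k - 1)"
    "deriv \<Phi> w / \<Phi> w = of_int k / (w - z) + deriv u w / u w"
proof -
  have wz: "w - z \<noteq> 0" using w by auto
  have e: "(w - z) powi k = (w - z) * (w - z) powi (k - 1)" using wz by (simp add: power_int_diff)
  have "(u has_field_derivative deriv u w) (at w)" using assms(2) w by (intro holomorphic_derivI) auto
  hence "((\<lambda>w. u w * (w - z) powi k) has_field_derivative
        deriv u w * (w - z) powi k + (of_int k * (w - z) powi (k - 1)) * u w) (at w)"
    using wz by (auto intro!: derivative_eq_intros)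
  hence "(\<Phi> has_field_derivative deriv u w * (w - z) powi k + (of_int k * (w - z) powi (k - 1)) * u w) (at w)"
    by (rule has_field_derivative_transform_within_open[of _ _ _ "ball z r - {z}"]) (use \<Phi> w in auto)
  hence "deriv \<Phi> w = deriv u w * (w - z) powi k + (of_int k * (w - z) powi (k - 1)) * u w" by (rule DERIV_imp_deriv)
  thus d: "deriv \<Phi> w = (deriv u w * (w - z) + of_int k * u w) * (w - z) powi (k - 1)"
    unfolding e by (simp add: algebra_simps)
  have u0: "u w \<noteq> 0" "(w - z) powi (k - 1) \<noteq> 0" using assms(3) w wz by auto
  show "deriv \<Phi> w / \<Phi> w = of_int k / (w - z) + deriv u w / u w"
    unfolding d \<Phi>[OF w] e using u0 wz by (simp add: field_simps)
qed

lemma order_ge_analytic_zero: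
  assumes "\<phi> analytic_on {z}" "\<phi> z = 0"
  shows "order_ge \<phi> z 1"
proof (cases "\<exists>\<^sub>F w in at z. \<phi> w \<noteq> 0")
  case True
  have "0 < zorder \<phi> z" using zorder_pos_iff'[OF assms(1) True] assms(2) by simp
  thus ?thesis using order_ge_zorder(1)[OF analytic_on_imp_meromorphic_on[OF assms(1)] True] by (auto intro: order_ge_mono)
next
  case False
  hence "\<forall>\<^sub>F w in at z. \<phi> w = 0" by (simp add: frequently_def)
  thus ?thesis using order_ge_cong[of \<phi> "\<lambda>_. 0" z 1] by (simp add: order_ge_def)
qed

context two_critical_points
begin

text \<open>
  For \<open>F = p(f)\<close> this is the logarithmic derivative of \<open>(1/F)' = - F'/F\<^sup>2\<close>, so the pre-Schwarzian derivative of \<open>1/F\<close>.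
  It determines \<open>1/F\<close> up to an affine map.
\<close>

definition pre_schwarzian :: "(complex \<Rightarrow> complex) \<Rightarrow> complex \<Rightarrow> complex" where
  "pre_schwarzian f z = deriv (deriv (\<lambda>w. poly p (f w))) z / deriv (\<lambda>w. poly p (f w)) z
     - 2 * (deriv (\<lambda>w. poly p (f w)) z / poly p (f z))"

text \<open>
  Up to powers this is \<open>F'\<close> for \<open>F = p(f)\<close>. It vanishes at all poles of \<open>pre_schwarzian f\<close> except the zeros and poles of \<open>F\<close>.
\<close>

definition weight :: "(complex \<Rightarrow> complex) \<Rightarrow> complex \<Rightarrow> complex" where
  "weight f z = deriv f z * (f z - a) * (f z - b)"

lemma composite_nonzero:
  assumes f: "f nicely_meromorphic_on UNIV" "\<not> f constant_on UNIV"
  shows "\<forall>\<^sub>\<approx>z\<in>UNIV. poly p (f z) \<noteq> 0" "\<forall>\<^sub>\<approx>z\<in>UNIV. deriv (\<lambda>w. poly p (f w)) z \<noteq> 0"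
    "\<forall>\<^sub>\<approx>z\<in>UNIV. f analytic_on {z}"
proof -
  have p0: "p \<noteq> 0" using degree_p by force
  have "\<forall>\<^sub>\<approx>z\<in>UNIV. \<forall>s\<in>{s. poly p s = 0}. f z \<noteq> s"
    by (intro eventually_ball_finite poly_roots_finite p0 ballI avoids_value_cosparse[OF f])
  thus "\<forall>\<^sub>\<approx>z\<in>UNIV. poly p (f z) \<noteq> 0" by eventually_elim auto
  show an: "\<forall>\<^sub>\<approx>z\<in>UNIV. f analytic_on {z}"
    by (rule meromorphic_on_imp_analytic_cosparse[OF nicely_meromorphic_at(2)[OF f(1)]])
  show "\<forall>\<^sub>\<approx>z\<in>UNIV. deriv (\<lambda>w. poly p (f w)) z \<noteq> 0"
    using an deriv_nonzero_cosparse[OF f] avoids_value_cosparse[OF f, of a] avoids_value_cosparse[OF f, of b]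
    by eventually_elim (simp add: deriv_poly_compose poly_pderiv_p)
qed

lemma composite_meromorphic:
  assumes f: "f nicely_meromorphic_on UNIV"
  shows "(\<lambda>w. poly p (f w)) meromorphic_on A"
  using poly_meromorphic[OF nicely_meromorphic_at(2)[OF f]] by (rule meromorphic_on_subset) simp

lemma weight_pre_schwarzian_meromorphic:
  assumes f: "f nicely_meromorphic_on UNIV"
  shows "weight f meromorphic_on UNIV" "pre_schwarzian f meromorphic_on UNIV"
proof -
  have F: "(\<lambda>w. poly p (f w)) meromorphic_on UNIV" by (rule composite_meromorphic[OF f])
  show "weight f meromorphic_on UNIV"
    unfolding weight_def by (intro meromorphic_intros nicely_meromorphic_at(2)[OF f])
  show "pre_schwarzian f meromorphic_on UNIV"
    unfolding pre_schwarzian_def by (intro meromorphic_intros F)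
qed

lemma pre_schwarzian_order:
  assumes f: "f nicely_meromorphic_on UNIV" "\<not> f constant_on UNIV"
  shows "order_ge (pre_schwarzian f) z (-1)"
proof -
  let ?F = "\<lambda>w. poly p (f w)"
  have F: "?F meromorphic_on {z}" "\<exists>\<^sub>F w in at z. ?F w \<noteq> 0"
    using composite_meromorphic[OF f(1)] cosparse_imp_at[OF composite_nonzero(1)[OF f]] by (auto simp: eventually_frequently)
  have F': "deriv ?F meromorphic_on {z}" "\<exists>\<^sub>F w in at z. deriv ?F w \<noteq> 0"
    using meromorphic_on_deriv[OF F(1)] cosparse_imp_at[OF composite_nonzero(2)[OF f]] by (auto simp: eventually_frequently)
  show ?thesis unfolding pre_schwarzian_def
    by (intro order_ge_diff order_ge_cmult order_ge_zorder(4) F F')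
qed

lemma pre_schwarzian_analytic:
  assumes f: "f analytic_on {z}" and "poly p (f z) \<noteq> 0" "weight f z \<noteq> 0"
  shows "pre_schwarzian f analytic_on {z}"
proof -
  have F: "(\<lambda>w. poly p (f w)) analytic_on {z}" by (rule poly_analytic[OF f])
  have "deriv (\<lambda>w. poly p (f w)) z \<noteq> 0"
    using assms(3) by (simp add: deriv_poly_compose[OF f] poly_pderiv_p weight_def)
  thus ?thesis unfolding pre_schwarzian_def
    by (intro analytic_intros F analytic_deriv) (use assms(2) in auto)
qed

text \<open>
  The logarithmic derivative of \<open>F' = (f - a)^n (f - b)^m f'\<close> is a combination of logarithmic derivatives of \<open>f\<close>. The quotient \<open>F'/F\<close> is
  \<open>p'(f) f'/p(f)\<close>; here the closest root \<open>s\<close> of \<open>p\<close> leaves a multiple of \<open>|f'/(f - s)|\<close>, since the other factors of \<open>p(f)\<close> balance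
  the degree \<open>n + m\<close> of \<open>p'\<close>.
\<close>

lemma pre_schwarzian_bound:
  assumes f: "f nicely_meromorphic_on UNIV" "\<not> f constant_on UNIV"
    and v: "poly p a \<noteq> 0" "poly p b \<noteq> 0"
  obtains C where "0 \<le> C" "\<forall>\<^sub>\<approx>z\<in>UNIV. norm (pre_schwarzian f z) \<le> C * logderiv_sum ({s. poly p s = 0} \<union> {a, b}) f z"
proof -
  define T where "T = {s. poly p s = 0} \<union> {a, b}"
  have p0: "p \<noteq> 0" using degree_p by force
  have T: "finite T" using poly_roots_finite[OF p0] by (simp add: T_def)
  obtain c where c: "0 < c" "\<And>w. \<exists>s. poly p s = 0 \<and> c * norm (w - s) * (1 + norm w) ^ (n + m) \<le> norm (poly p w - 0)"
    using noncritical_lower_bound[of 0] v by metis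
  have "degree (pderiv p) = n + m" using degree_p by (simp add: degree_pderiv)
  then obtain C1 where C1: "0 < C1" "\<And>w. norm (poly (pderiv p) w) \<le> C1 * (1 + norm w) ^ (n + m)" using poly_upper_bound[of "pderiv p"] by metis
  have "\<forall>\<^sub>\<approx>z\<in>UNIV. f analytic_on {z} \<and> deriv f z \<noteq> 0 \<and> f z \<noteq> a \<and> f z \<noteq> b \<and> poly p (f z) \<noteq> 0"
    using composite_nonzero[OF f] deriv_nonzero_cosparse[OF f] avoids_value_cosparse[OF f, of a] avoids_value_cosparse[OF f, of b]
    by eventually_elim blast
  hence "\<forall>\<^sub>\<approx>z\<in>UNIV. norm (pre_schwarzian f z) \<le> (1 + n + m + 2 * (C1 / c)) * logderiv_sum T f z"
  proof -
    assume "\<forall>\<^sub>\<approx>z\<in>UNIV. f analytic_on {z} \<and> deriv f z \<noteq> 0 \<and> f z \<noteq> a \<and> f z \<noteq> b \<and> poly p (f z) \<noteq> 0"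
    then obtain E where E: "E sparse_in UNIV" "\<And>z. z \<notin> E \<Longrightarrow> f analytic_on {z} \<and> deriv f z \<noteq> 0 \<and> f z \<noteq> a \<and> f z \<noteq> b \<and> poly p (f z) \<noteq> 0"
      unfolding eventually_cosparse by blast
    have op: "open (- E)" using sparse_in_UNIV_imp_closed[OF E(1)] by auto
    have "norm (pre_schwarzian f z) \<le> (1 + n + m + 2 * (C1 / c)) * logderiv_sum T f z" if z: "z \<notin> E" for z
    proof -
      note Ez = E(2)[OF z]
      let ?F = "\<lambda>w. poly p (f w)" and ?L = "logderiv_sum T f z"
      have dF: "deriv ?F w = (f w - a) ^ n * (f w - b) ^ m * deriv f w" if "w \<notin> E" for w
        using deriv_poly_compose[of f w p] E(2)[OF that] by (simp add: poly_pderiv_p)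
      have df: "(f has_field_derivative deriv f z) (at z)" "(deriv f has_field_derivative deriv (deriv f) z) (at z)"
        using Ez by (auto intro: analytic_at_imp_deriv analytic_deriv)
      have "((\<lambda>w. (f w - a) ^ n * (f w - b) ^ m * deriv f w) has_field_derivative
          ((of_nat n * (deriv f z * (f z - a) ^ (n - 1))) * (f z - b) ^ m + (of_nat m * (deriv f z * (f z - b) ^ (m - 1))) * (f z - a) ^ n) * deriv f z
            + deriv (deriv f) z * ((f z - a) ^ n * (f z - b) ^ m)) (at z)"
        by (auto intro!: derivative_eq_intros df)
      hence "(deriv ?F has_field_derivative
          ((of_nat n * (deriv f z * (f z - a) ^ (n - 1))) * (f z - b) ^ m + (of_nat m * (deriv f z * (f z - b) ^ (m - 1))) * (f z - a) ^ n) * deriv f z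
            + deriv (deriv f) z * ((f z - a) ^ n * (f z - b) ^ m)) (at z)"
        by (rule has_field_derivative_transform_within_open[OF _ op]) (use z dF in auto)
      hence ddF: "deriv (deriv ?F) z = ((of_nat n * (deriv f z * (f z - a) ^ (n - 1))) * (f z - b) ^ m + (of_nat m * (deriv f z * (f z - b) ^ (m - 1))) * (f z - a) ^ n) * deriv f z
            + deriv (deriv f) z * ((f z - a) ^ n * (f z - b) ^ m)" by (rule DERIV_imp_deriv)
      have pn: "(f z - a) ^ n = (f z - a) ^ (n - 1) * (f z - a)" "(f z - b) ^ m = (f z - b) ^ (m - 1) * (f z - b)"
        using nm by (auto simp: power_Suc2[symmetric] simp del: power_Suc)
      have 1: "deriv (deriv ?F) z / deriv ?F z = of_nat n * (deriv f z / (f z - a)) + of_nat m * (deriv f z / (f z - b)) + deriv (deriv f) z / deriv f z"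
      proof -
        have id: "((N * (d * A')) * (B' * B) + (M * (d * B')) * (A' * A)) * d + d2 * ((A' * A) * (B' * B))
            = ((A' * A) * (B' * B) * d) * (N * (d / A) + M * (d / B) + d2 / d)"
          if "A \<noteq> 0" "B \<noteq> 0" "d \<noteq> 0" for A A' B B' d d2 N M :: complex using that by (simp add: field_simps)
        have "deriv ?F z \<noteq> 0" using dF[OF z] Ez by simp
        thus ?thesis unfolding ddF dF[OF z] pn using Ez
          by (subst id) auto
      qed
      have la: "norm (deriv f z / (f z - s)) \<le> ?L" if "s \<in> T" for s
      proof -
        have "norm (deriv f z / (f z - s)) \<le> (\<Sum>s\<in>T. norm (deriv f z / (f z - s)))"
          using T that by (intro member_le_sum) auto
        thus ?thesis by (simp add: logderiv_sum_def add_increasing2)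
      qed
      have ld2: "norm (deriv (deriv f) z / deriv f z) \<le> ?L" unfolding logderiv_sum_def by (simp add: add_increasing sum_nonneg)
      have 2: "norm (deriv ?F z / ?F z) \<le> (C1 / c) * ?L"
      proof -
        obtain s where s: "poly p s = 0" "c * norm (f z - s) * (1 + norm (f z)) ^ (n + m) \<le> norm (?F z)" using c(2)[of "f z"] by auto
        have sT: "s \<in> T" using s(1) by (simp add: T_def)
        have fs: "0 < norm (f z - s)" using Ez s(1) by auto
        have X0: "1 + norm (f z) \<noteq> 0" using norm_ge_zero[of "f z"] by linarith
        have X: "0 < (1 + norm (f z)) ^ (n + m)" by (intro zero_less_power add_pos_nonneg) auto
        have "norm (deriv ?F z / ?F z) = norm (poly (pderiv p) (f z)) * norm (deriv f z) / norm (?F z)"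
          using deriv_poly_compose[of f z p] Ez by (simp add: norm_mult norm_divide)
        also have "\<dots> \<le> (C1 * (1 + norm (f z)) ^ (n + m)) * norm (deriv f z) / (c * norm (f z - s) * (1 + norm (f z)) ^ (n + m))"
          using C1 s(2) c(1) fs X by (intro frac_le mult_right_mono mult_nonneg_nonneg mult_pos_pos) auto
        also have "\<dots> = (C1 / c) * norm (deriv f z / (f z - s))"
          using X0 by (simp add: norm_divide)
        also have "\<dots> \<le> (C1 / c) * ?L" using la[OF sT] C1 c by (intro mult_left_mono) auto
        finally show ?thesis .
      qed
      have "norm (pre_schwarzian f z) \<le> norm (deriv (deriv ?F) z / deriv ?F z) + norm (2 * (deriv ?F z / ?F z))"
        unfolding pre_schwarzian_def by (rule norm_triangle_ineq4)
      also have "norm (deriv (deriv ?F) z / deriv ?F z) \<le> n * norm (deriv f z / (f z - a)) + m * norm (deriv f z / (f z - b)) + norm (deriv (deriv f) z / deriv f z)"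
        unfolding 1 by (intro order.trans[OF norm_triangle_ineq] add_mono) (simp_all only: norm_mult norm_of_nat order.refl)
      also have "\<dots> \<le> n * ?L + m * ?L + ?L"
        using la[of a] la[of b] ld2 by (intro add_mono mult_left_mono) (auto simp: T_def)
      also have "norm (2 * (deriv ?F z / ?F z)) \<le> 2 * ((C1 / c) * ?L)" unfolding norm_mult[of 2] using 2 by simp
      finally show ?thesis by (simp add: algebra_simps)
    qed
    thus ?thesis unfolding eventually_cosparse by (auto intro: sparse_in_subset2[OF E(1)])
  qed
  thus ?thesis using C1 c(1) unfolding T_def by (intro that[of "1 + n + m + 2 * (C1 / c)"]) auto
qed

text \<open>
  Write \<open>F = u(w) (w - z)^j\<close>. The residue of the pre-Schwarzian at \<open>z\<close> is \<open>(j - 1) - 2 * j = - (j + 1)\<close>, which depends only on the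
  multiplicity. If \<open>j = 1\<close>, then \<open>F' = \<psi>\<close> with \<open>\<psi>'/\<psi> = 2 u'/u\<close> at \<open>z\<close>, so the constant term vanishes as well.
  The multiplicity of \<open>F\<close> is that of \<open>f - f z\<close>, because the zeros of \<open>p\<close> are simple.
\<close>

lemma pre_schwarzian_at_zero:
  assumes f: "f nicely_meromorphic_on UNIV" "\<not> f constant_on UNIV" and an: "f analytic_on {z}"
    and v: "poly p a \<noteq> 0" "poly p b \<noteq> 0" and fz: "poly p (f z) = 0"
  defines "j \<equiv> zorder (\<lambda>w. f w - f z) z"
  shows "1 \<le> j" "order_ge (weight f) z (j - 1)" "order_ge (\<lambda>w. 1 / poly p (f w)) z (- j)"
    "\<exists>A. A analytic_on {z} \<and> (\<forall>\<^sub>F w in at z. pre_schwarzian f w = - of_int (j + 1) / (w - z) + A w) \<and> (j = 1 \<longrightarrow> A z = 0)"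
proof -
  let ?F = "\<lambda>w. poly p (f w)" and ?f = "\<lambda>w. f w - f z"
  have fa: "?f analytic_on {z}" "?f meromorphic_on {z}" "\<exists>\<^sub>F w in at z. ?f w \<noteq> 0"
    using an frequently_nonzero[OF f, where z = z and s = "f z"] by (auto intro!: analytic_intros analytic_on_imp_meromorphic_on)
  have "0 < j" unfolding j_def using zorder_pos_iff'[OF fa(1,3)] by simp
  thus j: "1 \<le> j" by simp
  have "order_ge (deriv ?f) z (j - 1)" unfolding j_def by (rule order_ge_zorder(3)[OF fa(2,3)])
  hence df: "order_ge (deriv f) z (j - 1)" using order_ge_cong[OF deriv_minus_const_near[OF an]] by simp
  have "order_ge (\<lambda>w. deriv f w * (f w - a) * (f w - b)) z ((j - 1) + 0 + 0)"
    by (intro order_ge_mult df order_ge_analytic analytic_intros an)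
  thus "order_ge (weight f) z (j - 1)" by (simp add: weight_def[abs_def])
  have Fm: "?F meromorphic_on {z}" "\<exists>\<^sub>F w in at z. ?F w \<noteq> 0"
    using composite_meromorphic[OF f(1)] cosparse_imp_at[OF composite_nonzero(1)[OF f]] by (auto simp: eventually_frequently)
  \<comment> \<open>\<open>p = (X - f z) * R\<close> with \<open>R (f z) = p'(f z) \<noteq> 0\<close>.\<close>
  have zF: "zorder ?F z = j"
  proof -
    obtain R where R: "p = [:- f z, 1:] * R" using fz by (auto simp: poly_eq_0_iff_dvd elim: dvdE)
    have "pderiv p = [:- f z, 1:] * pderiv R + R * pderiv [:- f z, 1:]" by (subst R) (rule pderiv_mult)
    hence "poly (pderiv p) (f z) = poly R (f z)" by (simp add: pderiv_pCons)
    moreover have "f z \<noteq> a" "f z \<noteq> b" using v fz by auto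
    hence "poly (pderiv p) (f z) \<noteq> 0" by (simp add: poly_pderiv_p)
    ultimately have R0: "poly R (f z) \<noteq> 0" by metis
    have Ra: "(\<lambda>w. poly R (f w)) analytic_on {z}" by (rule poly_analytic[OF an])
    have "\<forall>\<^sub>F w in at z. poly R (f w) \<noteq> 0"
      using R0 analytic_at_imp_isCont[OF Ra] by (intro tendsto_imp_eventually_ne) (auto dest: isContD)
    hence Rf: "\<exists>\<^sub>F w in at z. poly R (f w) \<noteq> 0" by (simp add: eventually_frequently)
    have "?F = (\<lambda>w. ?f w * poly R (f w))" by (subst R) (simp add: algebra_simps)
    hence "zorder ?F z = j + zorder (\<lambda>w. poly R (f w)) z"
      unfolding j_def using zorder_mult[OF fa(2,3) analytic_on_imp_meromorphic_on[OF Ra] Rf] by simp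
    also have "zorder (\<lambda>w. poly R (f w)) z = 0" using zorder_eq_0_iff[OF Ra Rf] R0 by simp
    finally show ?thesis by simp
  qed
  show "order_ge (\<lambda>w. 1 / ?F w) z (- j)" using order_ge_zorder(2)[OF Fm] zF by simp
  obtain u r where u: "r > 0" "u holomorphic_on ball z r" "\<And>w. w \<in> ball z r \<Longrightarrow> u w \<noteq> 0"
    "\<And>w. w \<in> ball z r - {z} \<Longrightarrow> ?F w = u w * (w - z) powi j" using local_factor[OF Fm] zF by metis
  define \<psi> where "\<psi> = (\<lambda>w. deriv u w * (w - z) + of_int j * u w)"
  have du: "deriv u holomorphic_on ball z r" by (intro holomorphic_deriv u) auto
  have h\<psi>: "\<psi> holomorphic_on ball z r" unfolding \<psi>_def by (intro holomorphic_intros du u)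
  have \<psi>z: "\<psi> z \<noteq> 0" using u(1) u(3)[of z] j by (simp add: \<psi>_def)
  have "isCont \<psi> z" using h\<psi> u(1) by (meson centre_in_ball continuous_on_eq_continuous_at holomorphic_on_imp_continuous_on open_ball)
  then obtain d where d: "d > 0" "\<And>w. dist z w < d \<Longrightarrow> \<psi> w \<noteq> 0" using continuous_at_avoid[of z \<psi> 0] \<psi>z by auto
  define r' where "r' = min r d"
  have r': "r' > 0" "ball z r' \<subseteq> ball z r" using u(1) d(1) by (auto simp: r'_def)
  have \<psi>: "\<psi> holomorphic_on ball z r'" "\<And>w. w \<in> ball z r' \<Longrightarrow> \<psi> w \<noteq> 0"
    using h\<psi> r'(2) holomorphic_on_subset d(2) by (auto simp: r'_def)
  have dF: "deriv ?F w = \<psi> w * (w - z) powi (j - 1)" if "w \<in> ball z r' - {z}" for w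
    using logderiv_factor(1)[OF u, of w] that r'(2) by (auto simp: \<psi>_def)
  define A where "A = (\<lambda>w. deriv \<psi> w / \<psi> w - 2 * (deriv u w / u w))"
  have ua: "u analytic_on {z}" "\<psi> analytic_on {z}" using u(1,2) h\<psi> by (auto simp: analytic_at_ball)
  have "A analytic_on {z}" unfolding A_def
    by (intro analytic_intros ua analytic_deriv) (use u(1,3) \<psi>z in auto)
  moreover have "\<forall>\<^sub>F w in at z. pre_schwarzian f w = - of_int (j + 1) / (w - z) + A w"
    using eventually_ball_punctured[OF r'(1), of z]
  proof eventually_elim
    case (elim w)
    have w2: "w \<in> ball z r - {z}" using elim r'(2) by auto
    have "deriv (deriv ?F) w / deriv ?F w = of_int (j - 1) / (w - z) + deriv \<psi> w / \<psi> w"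
      by (rule logderiv_factor(2)[OF r'(1) \<psi> dF elim])
    moreover have "deriv ?F w / ?F w = of_int j / (w - z) + deriv u w / u w" by (rule logderiv_factor(2)[OF u w2])
    moreover have "of_int (j - 1) / (w - z) - 2 * (of_int j / (w - z)) = - of_int (j + 1) / (w - z)"
      by (simp add: diff_divide_distrib add_divide_distrib)
    ultimately show ?case unfolding pre_schwarzian_def A_def by (simp only: right_diff_distrib distrib_left) (simp add: algebra_simps)
  qed
  moreover have "A z = 0" if "j = 1"
  proof -
    have "(deriv u has_field_derivative deriv (deriv u) z) (at z)" "(u has_field_derivative deriv u z) (at z)"
      using u du by (auto intro: holomorphic_derivI)
    hence "(\<psi> has_field_derivative (deriv u z * 1 + deriv (deriv u) z * (z - z)) + of_int j * deriv u z) (at z)"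
      unfolding \<psi>_def by (auto intro!: derivative_eq_intros)
    hence "deriv \<psi> z = 2 * deriv u z" using that by (simp add: DERIV_imp_deriv)
    moreover have "\<psi> z = u z" using that by (simp add: \<psi>_def)
    ultimately show ?thesis by (simp add: A_def)
  qed
  ultimately show "\<exists>A. A analytic_on {z} \<and> (\<forall>\<^sub>F w in at z. pre_schwarzian f w = - of_int (j + 1) / (w - z) + A w) \<and> (j = 1 \<longrightarrow> A z = 0)"
    by blast
qed

lemma weight_at_pole:
  assumes f: "f nicely_meromorphic_on UNIV" "\<not> f constant_on UNIV" and pole: "is_pole f z"
  defines "q \<equiv> - zorder f z"
  assumes q: "1 \<le> q"
  shows "order_ge (weight f) z (- 3 * q - 1)" "order_ge (\<lambda>w. 1 / poly p (f w)) z (int (n + m + 1) * q)"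
proof -
  note fm = nicely_meromorphic_at(1)[OF f(1), of z] frequently_nonzero[OF f, where z = z and s = 0]
  have of: "order_ge f z (- q)" using order_ge_zorder(1)[OF fm] by (simp add: q_def)
  have "order_ge (\<lambda>w. deriv f w * (f w - a) * (f w - b)) z ((- q - 1) + (- q) + (- q))"
    by (intro order_ge_mult order_ge_deriv fm of order_ge_shift) (use q in auto)
  thus "order_ge (weight f) z (- 3 * q - 1)" by (simp add: weight_def[abs_def])
  obtain C where C: "1 \<le> C" "\<And>w. (1 + norm w) ^ (n + m + 1) \<le> C * (1 + norm (poly p w))" using growth_lower_bound by metis
  have "order_ge (\<lambda>w. (1 / f w) ^ (n + m + 1)) z (int (n + m + 1) * q)"
    using order_ge_power[OF order_ge_zorder(2)[OF fm], of "n + m + 1"] by (simp add: q_def)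
  moreover have "\<forall>\<^sub>F w in at z. norm (1 / poly p (f w)) \<le> (2 * C) * norm ((1 / f w) ^ (n + m + 1))"
    using pole_large[OF pole, of "2 * C"]
  proof eventually_elim
    case (elim w)
    let ?k = "n + m + 1"
    have x1: "1 \<le> norm (f w)" using elim C by simp
    have "norm (f w) ^ 1 \<le> norm (f w) ^ ?k" using x1 by (intro power_increasing) auto
    hence x2: "2 * C \<le> norm (f w) ^ ?k" using elim by simp
    have "norm (f w) ^ ?k \<le> (1 + norm (f w)) ^ ?k" by (intro power_mono) auto
    also have "\<dots> \<le> C * (1 + norm (poly p (f w)))" by (rule C(2))
    also have "\<dots> \<le> norm (f w) ^ ?k / 2 + C * norm (poly p (f w))" using x2 by (simp add: distrib_left del: power_Suc)
    finally have *: "norm (f w) ^ ?k \<le> 2 * C * norm (poly p (f w))" by simp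
    have "0 < norm (f w) ^ ?k" using x1 by (intro zero_less_power) linarith
    moreover from this * have "0 < norm (poly p (f w))" using C(1)
      by (metis less_le_trans linorder_not_less mult_zero_right norm_le_zero_iff norm_zero zero_less_norm_iff)
    ultimately have "1 / norm (poly p (f w)) \<le> 2 * C / norm (f w) ^ ?k" using * by (simp add: field_simps)
    thus ?case by (simp add: norm_divide norm_power power_one_over del: power_Suc)
  qed
  ultimately show "order_ge (\<lambda>w. 1 / poly p (f w)) z (int (n + m + 1) * q)" by (rule order_ge_bound)
qed

text \<open>
  With the closest root \<open>s\<close> of \<open>p\<close>, the weight is at most \<open>L |f - s|\<close> times a multiple of \<open>(1 + |f|)\<^sup>2\<close>, and \<open>|p(f)|\<close> is at least a multiple of
  \<open>|f - s| (1 + |f|)^(n + m)\<close>. In the fourth power of the weight two of the four factors \<open>|f - s|\<close> match those of \<open>p(f)\<^sup>2\<close>, the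
  other two are estimated by \<open>1 + |f|\<close>. This leaves the degree \<open>8 + 2 + 1 = 11\<close> on the left, against \<open>2 (n + m)\<close>
  on the right.
\<close>

lemma weight_bound:
  assumes v: "poly p a \<noteq> 0" "poly p b \<noteq> 0" and deg: "7 \<le> n + m"
  obtains C where "0 \<le> C" "\<And>f z L. (\<And>s. poly p s = 0 \<Longrightarrow> norm (deriv f z) \<le> L * norm (f z - s)) \<Longrightarrow> 0 \<le> L \<Longrightarrow> poly p (f z) \<noteq> 0 \<Longrightarrow>
      norm (weight f z) ^ 4 * (1 + norm (f z)) \<le> C * L ^ 4 * norm (poly p (f z)) ^ 2"
proof -
  obtain c where c: "0 < c" "\<And>w. \<exists>s. poly p s = 0 \<and> c * norm (w - s) * (1 + norm w) ^ (n + m) \<le> norm (poly p w - 0)"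
    using noncritical_lower_bound[of 0] v by metis
  have p0: "p \<noteq> 0" using degree_p by force
  define M where "M = 1 + (\<Sum>s\<in>{s. poly p s = 0} \<union> {a, b}. norm s)"
  have M: "norm (w - s) \<le> M * (1 + norm w)" if "s \<in> {s. poly p s = 0} \<union> {a, b}" for s w
  proof -
    have "norm s \<le> (\<Sum>s\<in>{s. poly p s = 0} \<union> {a, b}. norm s)"
      using that poly_roots_finite[OF p0] by (intro member_le_sum) auto
    hence s: "norm s \<le> M - 1" by (simp add: M_def)
    hence M1: "0 \<le> M - 1" by (meson norm_ge_zero order.trans)
    have "norm (w - s) \<le> norm w + norm s" by (rule norm_triangle_ineq4)
    also have "\<dots> \<le> norm w + (M - 1)" using s by simp
    also have "\<dots> \<le> M * (1 + norm w)" using mult_nonneg_nonneg[OF M1 norm_ge_zero[of w]] by (simp add: algebra_simps)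
    finally show ?thesis .
  qed
  have M1: "1 \<le> M" unfolding M_def by (simp add: sum_nonneg)
  define C where "C = M ^ 10 / c\<^sup>2"
  show ?thesis
  proof (rule that[of C])
    show "0 \<le> C" unfolding C_def using M1 by simp
    fix f z and L :: real assume df: "\<And>s. poly p s = 0 \<Longrightarrow> norm (deriv f z) \<le> L * norm (f z - s)" and L: "0 \<le> L" and F: "poly p (f z) \<noteq> 0"
    let ?X = "1 + norm (f z)"
    have X1: "1 \<le> ?X" by simp
    obtain s where s: "poly p s = 0" "c * norm (f z - s) * ?X ^ (n + m) \<le> norm (poly p (f z))" using c(2)[of "f z"] by auto
    have "norm (weight f z) \<le> (L * norm (f z - s)) * (M * ?X) * (M * ?X)"
      unfolding weight_def norm_mult using df[OF s(1)] M[of a "f z"] M[of b "f z"] L M1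
      by (intro mult_mono) (auto intro!: mult_nonneg_nonneg)
    hence "norm (weight f z) ^ 4 * ?X \<le> ((L * norm (f z - s)) * (M * ?X) * (M * ?X)) ^ 4 * ?X"
      by (intro mult_right_mono power_mono) auto
    also have "\<dots> = L ^ 4 * M ^ 8 * ?X ^ 9 * norm (f z - s) ^ 2 * norm (f z - s) ^ 2"
      by (simp add: power_mult_distrib power_numeral_reduce mult_ac)
    also have "\<dots> \<le> L ^ 4 * M ^ 8 * ?X ^ 9 * norm (f z - s) ^ 2 * (M * ?X) ^ 2"
      using M[of s "f z"] s(1) L M1 by (intro mult_left_mono power_mono) auto
    also have "\<dots> = L ^ 4 * M ^ 10 * norm (f z - s) ^ 2 * ?X ^ 11"
      by (simp add: power_mult_distrib power_numeral_reduce mult_ac)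
    also have "\<dots> \<le> L ^ 4 * M ^ 10 * norm (f z - s) ^ 2 * ?X ^ (2 * (n + m))"
      using deg X1 L M1 by (intro mult_left_mono power_increasing) auto
    also have "\<dots> = C * L ^ 4 * (c * norm (f z - s) * ?X ^ (n + m)) ^ 2"
      using c(1) by (simp add: C_def power_mult_distrib power_mult[symmetric] mult.commute[of 2])
    also have "\<dots> \<le> C * L ^ 4 * norm (poly p (f z)) ^ 2"
      using s(2) c(1) L \<open>0 \<le> C\<close> by (intro mult_left_mono power_mono) auto
    finally show "norm (weight f z) ^ 4 * ?X \<le> C * L ^ 4 * norm (poly p (f z)) ^ 2" .
  qed
qed

text \<open>
  The auxiliary function is the fourth power of the weighted difference \<open>H\<close> of the pre-Schwarzians, divided by
  \<open>F\<^sup>2 G\<^sup>2\<close>. It has to be shown that it has no poles. \<open>H\<close> has at most simple poles. Where \<open>F\<close> and \<open>G\<close> do not vanish and are finite, these are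
  zeros of one of the weights. At a common zero of multiplicity \<open>j\<close> the weights contribute
  \<open>8 (j - 1)\<close> zeros against \<open>4 j\<close> poles from the denominator, and the polar parts of \<open>H\<close> cancel; this suffices for
  \<open>j \<ge> 2\<close>, and for \<open>j = 1\<close> the additional zero of \<open>H\<close> makes up for the deficit of 4. At poles of \<open>f\<close> and \<open>g\<close> of orders \<open>q\<close> and
  \<open>q'\<close> the order is at least \<open>2 k (q + q') - 12 (q + q') - 12\<close> with \<open>k = n + m + 1 \<ge> 8\<close>, hence at least \<open>q + q'\<close> when
  \<open>q\<close> and \<open>q'\<close> are at least 2. The exponent 12 of the bound is made up of a fourth power for each weight and one for \<open>H\<close>.
\<close>

lemma pre_schwarzians_agree:
  assumes f: "f nicely_meromorphic_on UNIV" "\<not> f constant_on UNIV"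
    and g: "g nicely_meromorphic_on UNIV" "\<not> g constant_on UNIV"
    and poles: "\<And>z. is_pole f z \<Longrightarrow> zorder f z \<le> -2" "\<And>z. is_pole g z \<Longrightarrow> zorder g z \<le> -2" "\<And>z. is_pole f z \<longleftrightarrow> is_pole g z"
    and zeros: "\<And>z. \<not> is_pole f z \<Longrightarrow> poly p (f z) = 0 \<longleftrightarrow> poly p (g z) = 0"
      "\<And>z. \<not> is_pole f z \<Longrightarrow> poly p (f z) = 0 \<Longrightarrow> zorder (\<lambda>w. f w - f z) z = zorder (\<lambda>w. g w - g z) z"
    and v: "poly p a \<noteq> 0" "poly p b \<noteq> 0" and deg: "7 \<le> n + m"
  shows "\<forall>\<^sub>\<approx>z\<in>UNIV. pre_schwarzian f z = pre_schwarzian g z"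
proof -
  define T where "T = {s. poly p s = 0} \<union> {a, b}"
  have p0: "p \<noteq> 0" using degree_p by force
  have T: "finite T" using poly_roots_finite[OF p0] by (simp add: T_def)
  let ?H = "\<lambda>z. pre_schwarzian f z - pre_schwarzian g z"
  define h where "h = (\<lambda>z. (weight f z * weight g z * ?H z) ^ 4 * ((1 / poly p (f z)) ^ 2 * (1 / poly p (g z)) ^ 2))"
  obtain Cf where Cf: "0 \<le> Cf" "\<forall>\<^sub>\<approx>z\<in>UNIV. norm (pre_schwarzian f z) \<le> Cf * logderiv_sum T f z" using pre_schwarzian_bound[OF f v] unfolding T_def by metis
  obtain Cg where Cg: "0 \<le> Cg" "\<forall>\<^sub>\<approx>z\<in>UNIV. norm (pre_schwarzian g z) \<le> Cg * logderiv_sum T g z" using pre_schwarzian_bound[OF g v] unfolding T_def by metis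
  obtain C where C: "0 \<le> C" "\<And>f z L. (\<And>s. poly p s = 0 \<Longrightarrow> norm (deriv f z) \<le> L * norm (f z - s)) \<Longrightarrow> 0 \<le> L \<Longrightarrow> poly p (f z) \<noteq> 0 \<Longrightarrow>
      norm (weight f z) ^ 4 * (1 + norm (f z)) \<le> C * L ^ 4 * norm (poly p (f z)) ^ 2" using weight_bound[OF v deg] by blast
  have "\<forall>\<^sub>\<approx>z\<in>UNIV. h z = 0"
  proof (rule small_meromorphic_function_vanishes[OF f g _ T, of h "C * C * (Cf + Cg) ^ 4" 12])
    show "h meromorphic_on UNIV" unfolding h_def
      by (intro meromorphic_intros weight_pre_schwarzian_meromorphic composite_meromorphic f(1) g(1))
    show "\<forall>\<^sub>\<approx>z\<in>UNIV. norm (h z) * ((1 + norm (f z)) * (1 + norm (g z))) \<le> C * C * (Cf + Cg) ^ 4 * (1 + logderiv_sum T f z + logderiv_sum T g z) ^ 12"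
      using composite_nonzero(1)[OF f] composite_nonzero(1)[OF g] Cf(2) Cg(2)
    proof eventually_elim
      case (elim z)
      let ?L = "1 + logderiv_sum T f z + logderiv_sum T g z"
      have L: "0 \<le> ?L" "logderiv_sum T f z \<le> ?L" "logderiv_sum T g z \<le> ?L" using logderiv_sum_nonneg[of T f z] logderiv_sum_nonneg[of T g z] by auto
      have df: "norm (deriv f z) \<le> ?L * norm (f z - s)" if "poly p s = 0" for s
      proof -
        have "norm (deriv f z) \<le> logderiv_sum T f z * norm (f z - s)" using deriv_le_logderiv_sum[OF T, of s f z] that elim(1) by (auto simp: T_def)
        also have "\<dots> \<le> ?L * norm (f z - s)" using L by (intro mult_right_mono) auto
        finally show ?thesis .
      qed
      have dg: "norm (deriv g z) \<le> ?L * norm (g z - s)" if "poly p s = 0" for s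
      proof -
        have "norm (deriv g z) \<le> logderiv_sum T g z * norm (g z - s)" using deriv_le_logderiv_sum[OF T, of s g z] that elim(2) by (auto simp: T_def)
        also have "\<dots> \<le> ?L * norm (g z - s)" using L by (intro mult_right_mono) auto
        finally show ?thesis .
      qed
      let ?pf = "norm (poly p (f z))" and ?pg = "norm (poly p (g z))" and ?X = "1 + norm (f z)" and ?Y = "1 + norm (g z)"
      have Af: "norm (weight f z) ^ 4 * ?X / ?pf\<^sup>2 \<le> C * ?L ^ 4" using C(2)[OF df L(1) elim(1)] elim(1) by (simp add: divide_le_eq)
      have Ag: "norm (weight g z) ^ 4 * ?Y / ?pg\<^sup>2 \<le> C * ?L ^ 4" using C(2)[OF dg L(1) elim(2)] elim(2) by (simp add: divide_le_eq)
      have "norm (?H z) \<le> norm (pre_schwarzian f z) + norm (pre_schwarzian g z)" by (rule norm_triangle_ineq4)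
      also have "\<dots> \<le> Cf * ?L + Cg * ?L" using elim(3,4) L Cf(1) Cg(1) mult_left_mono[OF L(2) Cf(1)] mult_left_mono[OF L(3) Cg(1)] by linarith
      finally have H: "norm (?H z) \<le> (Cf + Cg) * ?L" by (simp add: distrib_right)
      have "norm (h z) * (?X * ?Y) = (norm (weight f z) ^ 4 * ?X / ?pf\<^sup>2) * (norm (weight g z) ^ 4 * ?Y / ?pg\<^sup>2) * norm (?H z) ^ 4"
      proof -
        have id: "((s * t * x) ^ 4 * ((1 / u) ^ 2 * (1 / v) ^ 2)) * (X * Y) = (s ^ 4 * X / u\<^sup>2) * (t ^ 4 * Y / v\<^sup>2) * x ^ 4"
          for s t x u v X Y :: real by (simp add: power_mult_distrib power_divide)
        show ?thesis unfolding h_def norm_mult norm_power norm_divide norm_one by (rule id)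
      qed
      also have "\<dots> \<le> (C * ?L ^ 4) * (C * ?L ^ 4) * ((Cf + Cg) * ?L) ^ 4"
        using Af Ag H C(1) L by (intro mult_mono power_mono) auto
      also have "\<dots> = C * C * (Cf + Cg) ^ 4 * ?L ^ 12" by (simp add: power_mult_distrib power_add[symmetric] power_numeral_reduce mult_ac)
      finally show ?case .
    qed
    fix z
    note fm = nicely_meromorphic_at(1)[OF f(1), of z] frequently_nonzero[OF f, where z = z and s = 0]
    note gm = nicely_meromorphic_at(1)[OF g(1), of z] frequently_nonzero[OF g, where z = z and s = 0]
    have H1: "order_ge ?H z (-1)" by (intro order_ge_diff pre_schwarzian_order f g)
    show "\<exists>K. \<forall>\<^sub>F w in at z. norm (h w) * ((1 + norm (f w)) * (1 + norm (g w))) \<le> K"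
    proof (cases "is_pole f z")
      case True
      hence gp: "is_pole g z" using poles(3) by blast
      define q q' where "q = - zorder f z" and "q' = - zorder g z"
      have q: "2 \<le> q" "2 \<le> q'" using poles(1)[OF True] poles(2)[OF gp] by (auto simp: q_def q'_def)
      have of: "order_ge f z (- q)" "order_ge g z (- q')" using order_ge_zorder(1)[OF fm] order_ge_zorder(1)[OF gm] by (simp_all add: q_def q'_def)
      have sf: "order_ge (weight f) z (- 3 * q - 1)" "order_ge (\<lambda>w. 1 / poly p (f w)) z (int (n + m + 1) * q)"
        using weight_at_pole[OF f True] q unfolding q_def by auto
      have sg: "order_ge (weight g) z (- 3 * q' - 1)" "order_ge (\<lambda>w. 1 / poly p (g w)) z (int (n + m + 1) * q')"
        using weight_at_pole[OF g gp] q unfolding q'_def by auto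
      have k: "8 * q \<le> int (n + m + 1) * q" "8 * q' \<le> int (n + m + 1) * q'" using deg q by (auto intro!: mult_right_mono)
      have "order_ge h z (int 4 * (((- 3 * q - 1) + (- 3 * q' - 1)) + (-1)) + (int 2 * (int (n + m + 1) * q) + int 2 * (int (n + m + 1) * q')))"
        unfolding h_def by (intro order_ge_mult order_ge_power sf sg H1)
      moreover have "q + q' \<le> int 4 * (((- 3 * q - 1) + (- 3 * q' - 1)) + (-1)) + (int 2 * (int (n + m + 1) * q) + int 2 * (int (n + m + 1) * q'))"
      proof -
        have "int 4 * (((- 3 * q - 1) + (- 3 * q' - 1)) + (-1)) + (int 2 * (int (n + m + 1) * q) + int 2 * (int (n + m + 1) * q'))
          = 2 * (int (n + m + 1) * q) + 2 * (int (n + m + 1) * q') - 12 * q - 12 * q' - 12" by simp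
        thus ?thesis using k q by linarith
      qed
      ultimately have "order_ge h z (q + q')" by (rule order_ge_mono)
      thus ?thesis using of q by (intro product_locally_bounded[of h z q q']) auto
    next
      case False
      hence gp: "\<not> is_pole g z" using poles(3) by blast
      have an: "f analytic_on {z}" "g analytic_on {z}"
        using nicely_meromorphic_on_imp_analytic_at[OF f(1) _ False] nicely_meromorphic_on_imp_analytic_at[OF g(1) _ gp] by auto
      have "order_ge h z 0"
      proof (cases "poly p (f z) = 0")
        case zf: True
        have zg: "poly p (g z) = 0" using zeros(1)[OF False] zf by blast
        define j where "j = zorder (\<lambda>w. f w - f z) z"
        have jg: "zorder (\<lambda>w. g w - g z) z = j" using zeros(2)[OF False zf] by (simp add: j_def)
        note tf = pre_schwarzian_at_zero[OF f an(1) v zf, folded j_def]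
        note tg = pre_schwarzian_at_zero[OF g an(2) v zg, unfolded jg]
        obtain A where A: "A analytic_on {z}" "\<forall>\<^sub>F w in at z. pre_schwarzian f w = - of_int (j + 1) / (w - z) + A w" "j = 1 \<longrightarrow> A z = 0"
          using tf(4) by blast
        obtain B where B: "B analytic_on {z}" "\<forall>\<^sub>F w in at z. pre_schwarzian g w = - of_int (j + 1) / (w - z) + B w" "j = 1 \<longrightarrow> B z = 0"
          using tg(4) by blast
        have ev: "\<forall>\<^sub>F w in at z. A w - B w = ?H w" using A(2) B(2) by eventually_elim simp
        have AB: "(\<lambda>w. A w - B w) analytic_on {z}" by (intro analytic_intros A B)
        \<comment> \<open>\<open>e\<close> is the order to which \<open>H\<close> is known to vanish: only for simple zeros do the constant terms cancel too.\<close>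
        define e where "e = (if j = 1 then 1 else 0 :: int)"
        have "order_ge (\<lambda>w. A w - B w) z e"
          using order_ge_analytic[OF AB] order_ge_analytic_zero[OF AB] A(3) B(3) by (auto simp: e_def)
        hence He: "order_ge ?H z e" using order_ge_cong[OF ev] by blast
        have "order_ge h z (int 4 * (((j - 1) + (j - 1)) + e) + (int 2 * (- j) + int 2 * (- j)))"
          unfolding h_def by (intro order_ge_mult order_ge_power tf tg He)
        moreover have "0 \<le> int 4 * (((j - 1) + (j - 1)) + e) + (int 2 * (- j) + int 2 * (- j))"
          using tf(1) by (auto simp: e_def)
        ultimately show ?thesis by (rule order_ge_mono)
      next
        case zf: False
        have zg: "poly p (g z) \<noteq> 0" using zeros(1)[OF False] zf by blast
        have inv: "(\<lambda>w. 1 / poly p (f w)) analytic_on {z}" "(\<lambda>w. 1 / poly p (g w)) analytic_on {z}"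
          by (intro analytic_intros poly_analytic an; use zf zg in auto)+
        have sl: "weight f analytic_on {z}" "weight g analytic_on {z}"
          unfolding weight_def by (intro analytic_intros an analytic_deriv)+
        have "order_ge (\<lambda>w. weight f w * weight g w * ?H w) z 0"
        proof (cases "weight f z = 0 \<or> weight g z = 0")
          case True
          have "order_ge (\<lambda>w. weight f w * weight g w) z 1"
            by (rule order_ge_analytic_zero) (use True sl in \<open>auto intro: analytic_intros\<close>)
          from order_ge_mult[OF this H1] show ?thesis by simp
        next
          case False
          have "pre_schwarzian f analytic_on {z}" "pre_schwarzian g analytic_on {z}"
            using False pre_schwarzian_analytic[OF an(1) zf] pre_schwarzian_analytic[OF an(2) zg] by auto
          hence "(\<lambda>w. weight f w * weight g w * ?H w) analytic_on {z}"
            by (intro analytic_intros sl)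
          thus ?thesis by (rule order_ge_analytic)
        qed
        hence "order_ge h z (int 4 * 0 + (int 2 * 0 + int 2 * 0))"
          unfolding h_def by (intro order_ge_mult[OF order_ge_power] order_ge_mult order_ge_power order_ge_analytic[OF inv(1)] order_ge_analytic[OF inv(2)])
        thus ?thesis by simp
      qed
      thus ?thesis using order_ge_analytic[OF an(1)] order_ge_analytic[OF an(2)]
        by (intro product_locally_bounded[of h z 0 0]) auto
    qed
  qed
  thus ?thesis
    using composite_nonzero(1)[OF f] composite_nonzero(1)[OF g] deriv_nonzero_cosparse[OF f] deriv_nonzero_cosparse[OF g]
      avoids_value_cosparse[OF f, of a] avoids_value_cosparse[OF f, of b] avoids_value_cosparse[OF g, of a] avoids_value_cosparse[OF g, of b]
    by eventually_elim (auto simp: h_def weight_def)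
qed

end

section \<open>Uniqueness\<close>

text \<open>
  Equality of the pre-Schwarzians means that \<open>(1/F)'\<close> and \<open>(1/G)'\<close> have the same logarithmic derivative, so their quotient is a
  constant, and \<open>1/F - K/G\<close> is another constant \<open>B\<close>.
\<close>

lemma equal_pre_schwarzians_imp_moebius:
  fixes F F1 F2 G G1 G2 :: "complex \<Rightarrow> complex"
  assumes U: "open U" "connected U" "U \<noteq> {}"
    and D: "\<And>z. z \<in> U \<Longrightarrow> (F has_field_derivative F1 z) (at z)" "\<And>z. z \<in> U \<Longrightarrow> (F1 has_field_derivative F2 z) (at z)"
      "\<And>z. z \<in> U \<Longrightarrow> (G has_field_derivative G1 z) (at z)" "\<And>z. z \<in> U \<Longrightarrow> (G1 has_field_derivative G2 z) (at z)"
    and nz: "\<And>z. z \<in> U \<Longrightarrow> F z \<noteq> 0 \<and> F1 z \<noteq> 0 \<and> G z \<noteq> 0 \<and> G1 z \<noteq> 0"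
    and eq: "\<And>z. z \<in> U \<Longrightarrow> F2 z / F1 z - 2 * (F1 z / F z) = G2 z / G1 z - 2 * (G1 z / G z)"
  obtains K B where "K \<noteq> 0" "\<And>z. z \<in> U \<Longrightarrow> G z = K * F z + B * F z * G z"
proof -
  define w where "w = (\<lambda>z. F1 z * G z ^ 2 / (F z ^ 2 * G1 z))"
  have "w constant_on U"
  proof (rule has_field_derivative_0_imp_constant_on[OF _ U(2,1)])
    fix z assume z: "z \<in> U"
    let ?d = "((F2 z * G z ^ 2 + 2 * G z * G1 z * F1 z) * (F z ^ 2 * G1 z)
        - F1 z * G z ^ 2 * (2 * F z * F1 z * G1 z + G2 z * F z ^ 2)) / (F z ^ 2 * G1 z) ^ 2"
    have "(w has_field_derivative ?d) (at z)"
      unfolding w_def using nz[OF z] by (auto intro!: derivative_eq_intros D[OF z] simp: power2_eq_square algebra_simps)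
    moreover have "(F2 z * G z ^ 2 + 2 * G z * G1 z * F1 z) * (F z ^ 2 * G1 z) - F1 z * G z ^ 2 * (2 * F z * F1 z * G1 z + G2 z * F z ^ 2)
        = F1 z * G1 z * F z ^ 2 * G z ^ 2 * ((F2 z / F1 z - 2 * (F1 z / F z)) - (G2 z / G1 z - 2 * (G1 z / G z)))"
      using nz[OF z] by (simp add: field_simps power2_eq_square)
    ultimately show "(w has_field_derivative 0) (at z)" using eq[OF z] by simp
  qed
  then obtain K where K: "\<And>z. z \<in> U \<Longrightarrow> w z = K" by (auto simp: constant_on_def)
  have K0: "K \<noteq> 0" using K nz U(3) by (force simp: w_def)
  define V where "V = (\<lambda>z. 1 / F z - K / G z)"
  have "V constant_on U"
  proof (rule has_field_derivative_0_imp_constant_on[OF _ U(2,1)])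
    fix z assume z: "z \<in> U"
    have "(V has_field_derivative - (F1 z / F z ^ 2) + K * (G1 z / G z ^ 2)) (at z)"
      unfolding V_def using nz[OF z] by (auto intro!: derivative_eq_intros D[OF z] simp: power2_eq_square)
    moreover have "F1 z / F z ^ 2 = K * (G1 z / G z ^ 2)"
      using K[OF z, symmetric] nz[OF z] by (simp add: w_def)
    ultimately show "(V has_field_derivative 0) (at z)" by simp
  qed
  then obtain B where B: "\<And>z. z \<in> U \<Longrightarrow> V z = B" by (auto simp: constant_on_def)
  show ?thesis
  proof (rule that[OF K0])
    fix z assume z: "z \<in> U"
    have "B = 1 / F z - K / G z" using B[OF z] by (simp add: V_def)
    thus "G z = K * F z + B * F z * G z" using nz[OF z] by (simp add: field_simps)
  qed
qed

context two_critical_points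
begin

text \<open>
  The complement of a sparse set is connected, so the two integrations can be carried out globally.
\<close>

lemma moebius_relation:
  assumes f: "f nicely_meromorphic_on UNIV" "\<not> f constant_on UNIV"
    and g: "g nicely_meromorphic_on UNIV" "\<not> g constant_on UNIV"
    and eq: "\<forall>\<^sub>\<approx>z\<in>UNIV. pre_schwarzian f z = pre_schwarzian g z"
  obtains K B where "K \<noteq> 0" "\<forall>\<^sub>\<approx>z\<in>UNIV. poly p (g z) = K * poly p (f z) + B * poly p (f z) * poly p (g z)"
proof -
  let ?F = "\<lambda>z. poly p (f z)" and ?G = "\<lambda>z. poly p (g z)"
  have "\<forall>\<^sub>\<approx>z\<in>UNIV. f analytic_on {z} \<and> g analytic_on {z} \<and> ?F z \<noteq> 0 \<and> ?G z \<noteq> 0 \<and> deriv ?F z \<noteq> 0 \<and> deriv ?G z \<noteq> 0 \<and> pre_schwarzian f z = pre_schwarzian g z"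
    using composite_nonzero[OF f] composite_nonzero[OF g] eq by eventually_elim blast
  then obtain E where E: "E sparse_in UNIV" "\<And>z. z \<notin> E \<Longrightarrow> f analytic_on {z} \<and> g analytic_on {z} \<and> ?F z \<noteq> 0 \<and> ?G z \<noteq> 0 \<and> deriv ?F z \<noteq> 0 \<and> deriv ?G z \<noteq> 0 \<and> pre_schwarzian f z = pre_schwarzian g z"
    unfolding eventually_cosparse by blast
  have op: "open (- E)" using sparse_in_UNIV_imp_closed[OF E(1)] by auto
  have "connected (UNIV - E)" by (rule sparse_imp_connected) (use E(1) in auto)
  hence conn: "connected (- E)" by (simp add: Compl_eq_Diff_UNIV)
  have D: "(?F has_field_derivative deriv ?F z) (at z)" "(?G has_field_derivative deriv ?G z) (at z)"
    "(deriv ?F has_field_derivative deriv (deriv ?F) z) (at z)" "(deriv ?G has_field_derivative deriv (deriv ?G) z) (at z)" if "z \<notin> E" for z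
    using E(2)[OF that] by (auto intro!: analytic_at_imp_deriv analytic_deriv poly_analytic)
  have "E \<noteq> UNIV" using not_cosparse_False E(1) by (auto simp: eventually_cosparse)
  hence ne: "- E \<noteq> {}" by auto
  obtain K B where K: "K \<noteq> 0" "\<And>z. z \<in> - E \<Longrightarrow> ?G z = K * ?F z + B * ?F z * ?G z"
  proof (rule equal_pre_schwarzians_imp_moebius[OF op conn ne, of ?F "deriv ?F" "deriv (deriv ?F)" ?G "deriv ?G" "deriv (deriv ?G)"])
    show "deriv (deriv ?F) z / deriv ?F z - 2 * (deriv ?F z / ?F z) = deriv (deriv ?G) z / deriv ?G z - 2 * (deriv ?G z / ?G z)" if "z \<in> - E" for z
      using E(2)[of z] that by (simp add: pre_schwarzian_def)
  qed (use D E(2) in auto)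
  have "\<forall>\<^sub>\<approx>z\<in>UNIV. ?G z = K * ?F z + B * ?F z * ?G z"
    unfolding eventually_cosparse using K(2) by (auto intro: sparse_in_subset2[OF E(1)])
  thus ?thesis using that K(1) by blast
qed

text \<open>
  A critical value \<open>p(a)\<close> has besides \<open>a\<close> another preimage, because the multiplicity of \<open>a\<close> is only \<open>n + 1\<close>, while the degree is \<open>n + m + 1\<close>.
\<close>

lemma two_preimages:
  obtains x y where "x \<noteq> y" "poly p x = v" "poly p y = v"
proof -
  have main: "\<exists>x y. x \<noteq> y \<and> poly p x = poly p a' \<and> poly p y = poly p a'" if "two_critical_points a' b' n' m' p" for a' b' n' m'
  proof -
    interpret t: two_critical_points a' b' n' m' p by (rule that)
    obtain R where R: "\<And>w. poly p w - poly p a' = (w - a') ^ (n' + 1) * poly R w" "poly R a' \<noteq> 0" "degree R = m'" using t.factor_at_a by metis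
    have "\<not> constant (poly R)" using R(3) t.nm by (simp add: constant_degree)
    then obtain r where r: "poly R r = 0" using fundamental_theorem_of_algebra by blast
    hence "poly p r = poly p a'" using R(1)[of r] by simp
    thus ?thesis using r R(2) by metis
  qed
  consider "v = poly p a" | "v = poly p b" | "v \<noteq> poly p a" "v \<noteq> poly p b" by blast
  hence "\<exists>x y. x \<noteq> y \<and> poly p x = v \<and> poly p y = v"
  proof cases
    case 1 thus ?thesis using main[OF two_critical_points_axioms] by simp
  next
    case 2 thus ?thesis using main[OF swap] by simp
  next
    case 3
    have "card {w. poly p w = v} \<ge> 2" using noncritical_value(2)[OF 3] nm by simp
    then obtain A where "A \<subseteq> {w. poly p w = v}" "card A = 2" using obtain_subset_with_card_n by metis
    thus ?thesis by (auto simp: card_2_iff)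
  qed
  thus ?thesis using that by blast
qed

text \<open>
  At a common pole \<open>F\<close> and \<open>G\<close> both tend to infinity, so the term \<open>B F G\<close> could not be balanced by \<open>G - K F\<close>. Hence \<open>f\<close> and \<open>g\<close> are entire.
  Moreover \<open>F\<close> cannot take the value \<open>1/B\<close>, as then the relation would read \<open>G = K/B + G\<close>. But every value of \<open>p\<close> has two
  different preimages, and \<open>f\<close> omits both of them.
\<close>

lemma no_moebius_relation:
  assumes f: "f nicely_meromorphic_on UNIV" "\<not> f constant_on UNIV"
    and g: "g nicely_meromorphic_on UNIV" "\<not> g constant_on UNIV"
    and poles: "\<And>z. is_pole f z \<longleftrightarrow> is_pole g z"
    and K: "K \<noteq> 0" and rel: "\<forall>\<^sub>\<approx>z\<in>UNIV. poly p (g z) = K * poly p (f z) + B * poly p (f z) * poly p (g z)"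
  shows "B = 0"
proof (rule ccontr)
  assume B: "B \<noteq> 0"
  obtain C where C: "1 \<le> C" "\<And>w. (1 + norm w) ^ (n + m + 1) \<le> C * (1 + norm (poly p w))" using growth_lower_bound by metis
  have big: "M \<le> norm (poly p w)" if "C * (1 + M) \<le> norm w" for M w
  proof -
    have "C * (1 + M) \<le> (1 + norm w) ^ 1" using that by simp
    also have "\<dots> \<le> (1 + norm w) ^ (n + m + 1)" by (intro power_increasing) auto
    also have "\<dots> \<le> C * (1 + norm (poly p w))" by (rule C(2))
    finally show ?thesis using C(1) by simp
  qed
  have nopole: "\<not> is_pole f z" for z
  proof
    assume fp: "is_pole f z"
    hence gp: "is_pole g z" using poles by blast
    \<comment> \<open>If \<open>|F|\<close> and \<open>|G|\<close> are at least \<open>M\<close>, then \<open>|B F G|\<close> exceeds \<open>|G| + |K| |F|\<close>.\<close>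
    define M where "M = 2 * (1 + norm K) / norm B"
    have M: "0 < M" unfolding M_def using B by (intro divide_pos_pos) (auto intro: add_pos_nonneg)
    have "\<forall>\<^sub>F w in at z. False"
      using pole_large[OF fp, of "C * (1 + M)"] pole_large[OF gp, of "C * (1 + M)"] cosparse_imp_at[OF rel, of z]
    proof eventually_elim
      case (elim w)
      let ?F = "poly p (f w)" and ?G = "poly p (g w)"
      have FG: "M \<le> norm ?F" "M \<le> norm ?G" using elim big by auto
      have nz: "?F \<noteq> 0" "?G \<noteq> 0" using FG M by auto
      have "B * ?F * ?G = ?G - K * ?F" using elim(3) by (simp add: algebra_simps)
      hence "norm B * norm ?F * norm ?G = norm (?G - K * ?F)" by (metis norm_mult)
      also have "\<dots> \<le> norm ?G + norm K * norm ?F" by (rule order.trans[OF norm_triangle_ineq4]) (simp add: norm_mult)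
      finally have 1: "norm B * norm ?F * norm ?G \<le> norm ?G + norm K * norm ?F" .
      have "M * norm ?G \<le> norm ?F * norm ?G" "M * norm ?F \<le> norm ?G * norm ?F" using FG by (auto intro: mult_right_mono)
      hence "M * (norm ?G + norm K * norm ?F) \<le> norm ?F * norm ?G + norm K * (norm ?G * norm ?F)"
        using mult_left_mono[of "M * norm ?F" "norm ?G * norm ?F" "norm K"] by (simp add: algebra_simps)
      hence "M * (norm B * norm ?F * norm ?G) \<le> (1 + norm K) * (norm ?F * norm ?G)"
        using mult_left_mono[OF 1, of M] M by (simp add: algebra_simps)
      hence "(M * norm B) * (norm ?F * norm ?G) \<le> (1 + norm K) * (norm ?F * norm ?G)" by (simp add: mult_ac)
      hence "M * norm B \<le> 1 + norm K" using nz by (subst (asm) mult_le_cancel_right) (auto simp: mult_less_0_iff)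
      moreover have "M * norm B = 2 * (1 + norm K)" using B by (simp add: M_def)
      ultimately have "2 * (1 + norm K) \<le> 1 + norm K" by simp
      thus ?case using norm_ge_zero[of K] by (simp add: not_le add_pos_nonneg)
    qed
    thus False by simp
  qed
  have an: "f analytic_on {z}" "g analytic_on {z}" for z
    using nicely_meromorphic_on_imp_analytic_at[OF f(1) _ nopole] nicely_meromorphic_on_imp_analytic_at[OF g(1)] nopole poles by auto
  have rel': "poly p (g z) = K * poly p (f z) + B * poly p (f z) * poly p (g z)" for z
    by (rule analytic_eventually_eq_at[OF _ _ cosparse_imp_at[OF rel]]) (intro analytic_intros poly_analytic an)+
  have omit: "poly p (f z) \<noteq> 1 / B" for z
  proof
    assume "poly p (f z) = 1 / B"
    hence "poly p (g z) = K / B + poly p (g z)" using rel'[of z] B by simp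
    thus False using K B by simp
  qed
  obtain x y where xy: "x \<noteq> y" "poly p x = 1 / B" "poly p y = 1 / B" using two_preimages by metis
  have "f holomorphic_on UNIV" using an(1) analytic_on_analytic_at analytic_on_open by blast
  moreover have "range f \<inter> {x, y} = {}" using omit xy by (metis (no_types, lifting) disjoint_iff imageE insertE singletonD)
  ultimately obtain c where "f = (\<lambda>_. c)" using little_Picard[OF _ xy(1)] by metis
  thus False using f(2) by (auto simp: constant_on_def)
qed

theorem sharing_zeros_unique:
  assumes f: "f nicely_meromorphic_on UNIV" "\<not> f constant_on UNIV"
    and g: "g nicely_meromorphic_on UNIV" "\<not> g constant_on UNIV"
    and poles: "\<And>z. is_pole f z \<Longrightarrow> zorder f z \<le> -2" "\<And>z. is_pole g z \<Longrightarrow> zorder g z \<le> -2" "\<And>z. is_pole f z \<longleftrightarrow> is_pole g z"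
    and zeros: "\<And>z. \<not> is_pole f z \<Longrightarrow> poly p (f z) = 0 \<longleftrightarrow> poly p (g z) = 0"
      "\<And>z. \<not> is_pole f z \<Longrightarrow> poly p (f z) = 0 \<Longrightarrow> zorder (\<lambda>w. f w - f z) z = zorder (\<lambda>w. g w - g z) z"
    and v: "poly p a \<noteq> 0" "poly p b \<noteq> 0" "poly p a + poly p b \<noteq> 0" and deg: "7 \<le> n + m" and n2: "2 \<le> n" "2 \<le> m"
  shows "f = g"
proof -
  interpret s: two_critical_points b a m n p by (rule swap)
  have "\<forall>\<^sub>\<approx>z\<in>UNIV. pre_schwarzian f z = pre_schwarzian g z" by (rule pre_schwarzians_agree[OF f g poles zeros v(1,2) deg])
  then obtain K B where K: "K \<noteq> 0" and rel: "\<forall>\<^sub>\<approx>z\<in>UNIV. poly p (g z) = K * poly p (f z) + B * poly p (f z) * poly p (g z)"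
    using moebius_relation[OF f g] by metis
  have "B = 0" by (rule no_moebius_relation[OF f g poles(3) K rel])
  hence rel: "\<forall>\<^sub>\<approx>z\<in>UNIV. poly p (g z) = K * poly p (f z)" using rel by simp
  show ?thesis
  proof (cases "K = 1")
    case True
    thus ?thesis using uniqueness_polynomial[OF f g poles(1) _ n2] rel by simp
  next
    case False
    have "K * poly p a \<noteq> poly p a" "K * poly p b \<noteq> poly p b" using False v by auto
    \<comment> \<open>Multiplication by \<open>K \<noteq> 1\<close> would have to interchange the two critical values, so that \<open>K = -1\<close>, which is
        excluded by \<open>p(a) + p(b) \<noteq> 0\<close>.\<close>
    moreover have "K * poly p a \<noteq> poly p b \<or> K * poly p b \<noteq> poly p a"
    proof (rule ccontr)
      assume "\<not> ?thesis"
      hence e: "K * poly p a = poly p b" "K * poly p b = poly p a" by auto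
      hence "K * (K * poly p a) = poly p a" by simp
      hence "(K * K - 1) * poly p a = 0" by (simp add: algebra_simps)
      hence "K * K = 1" using v by simp
      hence "(K - 1) * (K + 1) = 0" by (simp add: algebra_simps)
      hence "K = -1" using False by (simp add: eq_neg_iff_add_eq_0)
      hence "poly p b = - poly p a" using e(1) by simp
      thus False using v(3) by simp
    qed
    ultimately have False
      using no_relation_at_noncritical_value[OF f g poles(1) rel K _ _ n2(1)]
        s.no_relation_at_noncritical_value[OF f g poles(1) rel K _ _ n2(2)] by blast
    thus ?thesis ..
  qed
qed

end

lemma pderiv_sum: "pderiv (\<Sum>x\<in>X. q x) = (\<Sum>x\<in>X. pderiv (q x :: complex poly))"
  by (induction X rule: infinite_finite_induct) (auto simp: pderiv_add)

definition P_poly :: "nat \<Rightarrow> nat \<Rightarrow> complex \<Rightarrow> complex \<Rightarrow> complex \<Rightarrow> complex poly" where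
  "P_poly m n a b c = (\<Sum>i=0..m. \<Sum>j=0..n.
     monom (of_nat (m choose i) * of_nat (n choose j) * ((-1) ^ (i + j) / of_nat (n + m + 1 - i - j)) * a ^ j * b ^ i) (n + m + 1 - i - j)) + [:c:]"

lemma poly_P_poly: "poly (P_poly m n a b c) z = P m n a b c z"
  by (simp add: P_poly_def P_def Q_def poly_sum poly_monom mult_ac)

text \<open>
  Differentiation cancels the denominators of the coefficients; what remains is the product of the binomial expansions of
  \<open>(z - b)^m\<close> and \<open>(z - a)^n\<close>.
\<close>

lemma pderiv_P_poly: "pderiv (P_poly m n a b c) = [:-a, 1:] ^ n * [:-b, 1:] ^ m"
proof -
  have bin: "(z - x) ^ k = (\<Sum>j=0..k. of_nat (k choose j) * (-1) ^ j * x ^ j * z ^ (k - j))" for z x :: complex and k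
  proof -
    have "(- x + z) ^ k = (\<Sum>j\<le>k. of_nat (k choose j) * (- x) ^ j * z ^ (k - j))" by (rule binomial_ring)
    also have "\<dots> = (\<Sum>j=0..k. of_nat (k choose j) * (-1) ^ j * x ^ j * z ^ (k - j))"
      by (intro sum.cong) (auto simp: power_minus[of x] atMost_atLeast0 mult_ac)
    finally show ?thesis by simp
  qed
  have "poly (pderiv (P_poly m n a b c)) z = poly ([:-a, 1:] ^ n * [:-b, 1:] ^ m) z" for z
  proof -
    have "poly (pderiv (P_poly m n a b c)) z =
       (\<Sum>i=0..m. \<Sum>j=0..n. of_nat (m choose i) * of_nat (n choose j) * (-1) ^ (i + j) * a ^ j * b ^ i * z ^ (n + m - i - j))"
    proof -
      have h: "poly (pderiv (monom (x / of_nat (n + m + 1 - i - j)) (n + m + 1 - i - j))) z = x * z ^ (n + m - i - j)"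
        if "i \<le> m" "j \<le> n" for i j and x :: complex
      proof -
        have "n + m + 1 - i - j = Suc (n + m - i - j)" using that by simp
        thus ?thesis by (simp add: pderiv_monom poly_monom del: of_nat_Suc)
      qed
      have "poly (pderiv (monom (of_nat (m choose i) * of_nat (n choose j) * ((-1) ^ (i + j) / of_nat (n + m + 1 - i - j)) * a ^ j * b ^ i) (n + m + 1 - i - j))) z
        = of_nat (m choose i) * of_nat (n choose j) * (-1) ^ (i + j) * a ^ j * b ^ i * z ^ (n + m - i - j)" if "i \<le> m" "j \<le> n" for i j
      proof -
        have c: "of_nat (m choose i) * of_nat (n choose j) * ((-1) ^ (i + j) / of_nat (n + m + 1 - i - j)) * a ^ j * b ^ i
          = (of_nat (m choose i) * of_nat (n choose j) * (-1) ^ (i + j) * a ^ j * b ^ i) / of_nat (n + m + 1 - i - j)" by simp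
        show ?thesis unfolding c by (rule h[OF that])
      qed
      thus ?thesis unfolding P_poly_def pderiv_add pderiv_sum poly_add poly_sum by (simp add: pderiv_pCons)
    qed
    also have "\<dots> = (\<Sum>i=0..m. \<Sum>j=0..n. (of_nat (m choose i) * (-1) ^ i * b ^ i * z ^ (m - i)) * (of_nat (n choose j) * (-1) ^ j * a ^ j * z ^ (n - j)))"
    proof (intro sum.cong refl)
      fix i j assume "i \<in> {0..m}" "j \<in> {0..n}"
      hence "n + m - i - j = (m - i) + (n - j)" by simp
      thus "of_nat (m choose i) * of_nat (n choose j) * (-1) ^ (i + j) * a ^ j * b ^ i * z ^ (n + m - i - j)
        = (of_nat (m choose i) * (-1) ^ i * b ^ i * z ^ (m - i)) * (of_nat (n choose j) * (-1) ^ j * a ^ j * z ^ (n - j))"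
        by (simp add: power_add mult_ac)
    qed
    also have "\<dots> = (z - b) ^ m * (z - a) ^ n" unfolding bin[of z b] bin[of z a] by (rule sum_product[symmetric])
    finally show ?thesis by (simp add: mult.commute)
  qed
  thus ?thesis by (intro poly_eq_poly_eq_iff[THEN iffD1] ext)
qed

theorem theorem3p5:
  fixes m n :: nat and a b c :: complex and f g :: "complex \<Rightarrow> complex"
  assumes "m + n \<ge> 7" and "min m n \<ge> 2" and "max m n \<ge> 3"
    and "b \<noteq> 0" and "a \<noteq> b"
    and "c \<notin> {0, - Q m n a b a, - Q m n a b b, - ((Q m n a b a + Q m n a b b) / 2)}"
    and "f nicely_meromorphic_on UNIV" and "g nicely_meromorphic_on UNIV"
    and "\<not> f constant_on UNIV" and "\<not> g constant_on UNIV"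
    and "no_simple_poles f" and "no_simple_poles g"
    and "share_IM f g {Infty}"
    and "share_CM f g (Fin ` {z. P m n a b c z = 0})"
  shows "f = g"
proof -
  let ?p = "P_poly m n a b c"
  interpret two_critical_points a b n m ?p
    by unfold_locales (use assms(2,5) pderiv_P_poly in auto)
  have pole2: "zorder F z \<le> -2" if "F nicely_meromorphic_on UNIV" "no_simple_poles F" "is_pole F z" for F z
  proof -
    have "zorder F z < 0"
      using nicely_meromorphic_at(1)[OF that(1), of z] that(3) by (intro isolated_pole_imp_neg_zorder) (auto simp: meromorphic_at_iff)
    moreover have "- zorder F z \<noteq> 1" using that(2,3) by (simp add: no_simple_poles_def)
    ultimately show ?thesis by linarith
  qed
  have E_pole: "E_IM F {Infty} = {z. is_pole F z}" for F by (auto simp: E_IM_def E_CM_def image_iff)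
  have poles: "is_pole f z \<longleftrightarrow> is_pole g z" for z
    using assms(13) unfolding share_IM_def E_pole by blast
  have E_zero: "(z, k) \<in> E_CM F (Fin ` {z. P m n a b c z = 0}) \<longleftrightarrow> \<not> is_pole F z \<and> poly ?p (F z) = 0 \<and> k = zorder (\<lambda>w. F w - F z) z" for F z k
    by (auto simp: E_CM_def poly_P_poly)
  have CM: "(z, k) \<in> E_CM f (Fin ` {z. P m n a b c z = 0}) \<longleftrightarrow> (z, k) \<in> E_CM g (Fin ` {z. P m n a b c z = 0})" for z k
    using assms(14) by (simp add: share_CM_def)
  have zeros: "poly ?p (f z) = 0 \<longleftrightarrow> poly ?p (g z) = 0" if "\<not> is_pole f z" for z
    using CM[of z "zorder (\<lambda>w. f w - f z) z"] CM[of z "zorder (\<lambda>w. g w - g z) z"] that poles unfolding E_zero by blast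
  have mult: "zorder (\<lambda>w. f w - f z) z = zorder (\<lambda>w. g w - g z) z" if "\<not> is_pole f z" "poly ?p (f z) = 0" for z
    using CM[of z "zorder (\<lambda>w. f w - f z) z"] that unfolding E_zero by blast
  have pv: "poly ?p x = Q m n a b x + c" for x by (simp add: poly_P_poly P_def)
  have nz: "poly ?p a \<noteq> 0" "poly ?p b \<noteq> 0" using assms(6) unfolding pv by (auto simp: add_eq_0_iff2)
  have sum_nz: "poly ?p a + poly ?p b \<noteq> 0"
  proof
    assume "poly ?p a + poly ?p b = 0"
    hence "Q m n a b a + Q m n a b b + 2 * c = 0" unfolding pv by (simp add: algebra_simps)
    hence "c = - ((Q m n a b a + Q m n a b b) / 2)" by (simp add: field_simps eq_neg_iff_add_eq_0)
    thus False using assms(6) by blast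
  qed
  show ?thesis
  proof (rule sharing_zeros_unique[OF assms(7,9,8,10)])
    show "zorder f z \<le> -2" if "is_pole f z" for z by (rule pole2[OF assms(7,11) that])
    show "zorder g z \<le> -2" if "is_pole g z" for z by (rule pole2[OF assms(8,12) that])
    show "7 \<le> n + m" "2 \<le> n" "2 \<le> m" using assms(1,2) by auto
  qed (use poles zeros mult nz sum_nz in auto)
qed

end
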